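(* Let $x_0<x_1$, $\Omega=(x_0,x_1)\times(-1,1)$, $\Sigma_0=\{x_0\}\times(0,1)$, $\Sigma_1=\{x_1\}\times(-1,0)$, and for $i\in\{0,1\}$ let $\bar u^i_{\mathrm{sing}}(x,y):=r_i^{1/2}\,\Lambda_0(t_i)\,\chi_i(x,y)$ be the singular profile defined in the context. For each $i\in\{0,1\}$, there exists $\overline{f_i}\in C^\infty(\overline\Omega)$, with $\overline{f_i}\equiv0$ in neighborhoods of $(x_i,0)$ and of $\{y=\pm1\}$, such that $\bar u^i_{\mathrm{sing}}$ is the unique solution with $Z^0(\Omega)$ regularity to $$\begin{cases} y\,\partial_x\bar u^i_{\mathrm{sing}}-\partial_{yy}\bar u^i_{\mathrm{sing}}=\overline{f_i}&\text{in }\Omega,\\ \bar u^i_{\mathrm{sing}}{}_{|\Sigma_0\cup\Sigma_1}=0,\\ \bar u^i_{\mathrm{sing}}{}_{|y=\pm1}=0.\end{cases}$$ Moreover, $\bar u^i_{\mathrm{sing}}\in C^\infty(\overline\Omega\setminus\{(x_i,0)\})$ but $\bar u^i_{\mathrm{sing}}\notin H^1_x(H^1_y)$.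
   Context: Here $Z^0(\Omega):=\{u\in L^2(\Omega):\ y\partial_xu,\ \partial_yu,\ \partial_{yy}u\in L^2(\Omega)\}$ and $H^1_x(H^1_y)=H^1((x_0,x_1);H^1(-1,1))$. $\Lambda_0\in C^\infty(\mathbb{R};\mathbb{R})$ is the smooth bounded function with $\lim_{t\to-\infty}\Lambda_0(t)=1$, $\lim_{t\to+\infty}\Lambda_0(t)=0$ and such that $v_0(x,y):=r^{1/2}\Lambda_0(t)$, with $r=(y^2+x^{2/3})^{1/2}$ and $t=yx^{-1/3}$, solves $y\partial_xv_0-\partial_{yy}v_0=0$ in $(0,+\infty)\times\mathbb{R}$ with $v_0(x=0,y)=0$ for $y>0$. The existence of $\Lambda_0$ is known and may be taken as given. For $i\in\{0,1\}$, set $r_i:=(y^2+|x-x_i|^{2/3})^{1/2}$ and $t_i:=(-1)^i\,y\,|x-x_i|^{-1/3}$; at $x=x_i$, $y\neq0$, the function $r_i^{1/2}\Lambda_0(t_i)$ is understood as the limit $x\to x_i$. Let $\chi_i\in C^\infty(\overline\Omega)$ be a cut-off function with $\chi_i\equiv1$ in a neighborhood of $(x_i,0)$ and $\operatorname{supp}\chi_i\subset B((x_i,0),\bar R)$ for some $\bar R<\min(1,x_1-x_0)/2$. *)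

theory Defs
  imports "HOL-Analysis.Analysis"
begin

section \<open>Smooth functions\<close>

definition smooth_real :: "(real \<Rightarrow> real) \<Rightarrow> bool" where
  "smooth_real f \<longleftrightarrow> (\<forall>n x. (deriv ^^ n) f differentiable (at x))"

text \<open>
  For a set S lying between an open set and its closure, this is the usual space of smooth
  functions on S: all partial derivatives exist in the interior and extend continuously to S.
  The function D j k is the partial derivative of order j in x and k in y, extended to S.
\<close>

definition smooth_on :: "(real \<times> real) set \<Rightarrow> (real \<times> real \<Rightarrow> real) \<Rightarrow> bool" where
  "smooth_on S f \<longleftrightarrow>
    (\<exists>D :: nat \<Rightarrow> nat \<Rightarrow> real \<times> real \<Rightarrow> real.
      (\<forall>p\<in>S. D 0 0 p = f p) \<and>
      (\<forall>j k. continuous_on S (D j k)) \<and>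
      (\<forall>j k x y. (x, y) \<in> interior S \<longrightarrow>
        ((\<lambda>s. D j k (s, y)) has_real_derivative D (Suc j) k (x, y)) (at x) \<and>
        ((\<lambda>s. D j k (x, s)) has_real_derivative D j (Suc k) (x, y)) (at y)))"

definition test_fun :: "(real \<times> real) set \<Rightarrow> (real \<times> real \<Rightarrow> real) \<Rightarrow> bool" where
  "test_fun U \<phi> \<longleftrightarrow>
    smooth_on UNIV \<phi> \<and> compact (closure {p. \<phi> p \<noteq> 0}) \<and> closure {p. \<phi> p \<noteq> 0} \<subseteq> U"

definition test_fun_real :: "real set \<Rightarrow> (real \<Rightarrow> real) \<Rightarrow> bool" where
  "test_fun_real I \<psi> \<longleftrightarrow>
    smooth_real \<psi> \<and> compact (closure {s. \<psi> s \<noteq> 0}) \<and> closure {s. \<psi> s \<noteq> 0} \<subseteq> I"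


section \<open>Square-integrable functions and distributions\<close>

text \<open>Elements of L2 are represented by functions; equality in L2 is equality almost everywhere.\<close>

definition L2 :: "'a::euclidean_space set \<Rightarrow> ('a \<Rightarrow> real) set" where
  "L2 U = {u. u \<in> borel_measurable (lebesgue_on U) \<and> integrable (lebesgue_on U) (\<lambda>p. (u p)\<^sup>2)}"

text \<open>
  A distribution on U is represented by a functional that is only ever evaluated
  (and compared, see \<open>distr_eq\<close>) on test functions with support in U.
\<close>

type_synonym distr = "(real \<times> real \<Rightarrow> real) \<Rightarrow> real"

definition distr_of :: "(real \<times> real) set \<Rightarrow> (real \<times> real \<Rightarrow> real) \<Rightarrow> distr" where
  "distr_of U u = (\<lambda>\<phi>. integral\<^sup>L (lebesgue_on U) (\<lambda>p. u p * \<phi> p))"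

definition distr_dx :: "distr \<Rightarrow> distr" where
  "distr_dx T = (\<lambda>\<phi>. - T (\<lambda>(x, y). deriv (\<lambda>s. \<phi> (s, y)) x))"

definition distr_dy :: "distr \<Rightarrow> distr" where
  "distr_dy T = (\<lambda>\<phi>. - T (\<lambda>(x, y). deriv (\<lambda>s. \<phi> (x, s)) y))"

definition distr_mult :: "(real \<times> real \<Rightarrow> real) \<Rightarrow> distr \<Rightarrow> distr" where
  "distr_mult a T = (\<lambda>\<phi>. T (\<lambda>p. a p * \<phi> p))"

definition distr_diff :: "distr \<Rightarrow> distr \<Rightarrow> distr" where
  "distr_diff T T' = (\<lambda>\<phi>. T \<phi> - T' \<phi>)"

definition distr_eq :: "(real \<times> real) set \<Rightarrow> distr \<Rightarrow> distr \<Rightarrow> bool" where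
  "distr_eq U T T' \<longleftrightarrow> (\<forall>\<phi>. test_fun U \<phi> \<longrightarrow> T \<phi> = T' \<phi>)"

definition distr_in_L2 :: "(real \<times> real) set \<Rightarrow> distr \<Rightarrow> bool" where
  "distr_in_L2 U T \<longleftrightarrow> (\<exists>g\<in>L2 U. distr_eq U T (distr_of U g))"

definition Z0 :: "(real \<times> real) set \<Rightarrow> (real \<times> real \<Rightarrow> real) set" where
  "Z0 U = {u \<in> L2 U.
     distr_in_L2 U (distr_mult snd (distr_dx (distr_of U u))) \<and>
     distr_in_L2 U (distr_dy (distr_of U u)) \<and>
     distr_in_L2 U (distr_dy (distr_dy (distr_of U u)))}"


section \<open>The space of H1 functions of x with values in H1 of y\<close>

text \<open>The function v belongs to H1 of the open interval J, with weak derivative g.\<close>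

definition H1_deriv :: "real set \<Rightarrow> (real \<Rightarrow> real) \<Rightarrow> (real \<Rightarrow> real) \<Rightarrow> bool" where
  "H1_deriv J v g \<longleftrightarrow> v \<in> L2 J \<and> g \<in> L2 J \<and>
    (\<forall>\<psi>. test_fun_real J \<psi> \<longrightarrow>
      integral\<^sup>L (lebesgue_on J) (\<lambda>y. v y * deriv \<psi> y)
        = - integral\<^sup>L (lebesgue_on J) (\<lambda>y. g y * \<psi> y))"

text \<open>
  A function u on the product of I and J is identified with the map sending x to the slice
  \<open>u (x, \<cdot>)\<close>. Almost every slice must lie in H1 of J, and the squared L2 norm over I of the
  H1 norms of the slices is the integral of \<open>u\<^sup>2 + g\<^sup>2\<close> over the product, where
  \<open>g (x, \<cdot>)\<close> is the weak derivative of \<open>u (x, \<cdot>)\<close>. Strong measurability of the map into the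
  separable space H1 of J follows from the joint measurability of u and g.
\<close>

definition L2x_H1y :: "real set \<Rightarrow> real set \<Rightarrow> (real \<times> real \<Rightarrow> real) set" where
  "L2x_H1y I J = {u \<in> L2 (I \<times> J). \<exists>g\<in>L2 (I \<times> J).
     AE x in lebesgue_on I. H1_deriv J (\<lambda>y. u (x, y)) (\<lambda>y. g (x, y))}"

text \<open>
  Here w is the weak derivative of the vector-valued map x to \<open>u (x, \<cdot>)\<close>; the two
  integrals over I are the vector-valued integrals of \<open>\<psi>' u\<close> and \<open>\<psi> w\<close>, which
  are compared as elements of H1 of J, that is, for almost every y.
\<close>

definition H1x_H1y :: "real set \<Rightarrow> real set \<Rightarrow> (real \<times> real \<Rightarrow> real) set" where
  "H1x_H1y I J = {u \<in> L2x_H1y I J. \<exists>w\<in>L2x_H1y I J.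
     \<forall>\<psi>. test_fun_real I \<psi> \<longrightarrow>
       (AE y in lebesgue_on J.
         integral\<^sup>L (lebesgue_on I) (\<lambda>x. u (x, y) * deriv \<psi> x)
           = - integral\<^sup>L (lebesgue_on I) (\<lambda>x. w (x, y) * \<psi> x))}"


section \<open>The boundary value problem\<close>

text \<open>The endpoints of the interval in x are \<open>X 0 < X 1\<close>.\<close>

definition Dom :: "(nat \<Rightarrow> real) \<Rightarrow> (real \<times> real) set" where
  "Dom X = {X 0<..<X 1} \<times> {-1<..<1}"

text \<open>
  Trace on the straight boundary piece \<open>\<gamma> ` I\<close> with inward unit normal n. It is the limit
  along the normal at almost every boundary point, for a suitable representative of u, and does
  not depend on the representative. A function in \<open>Z0\<close> has a representative that is
  absolutely continuous on almost every line parallel to an axis (its weak x-derivative is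
  square-integrable away from y = 0), so these limits are its Sobolev traces.
\<close>

definition has_trace ::
    "(real \<times> real) set \<Rightarrow> (real \<times> real \<Rightarrow> real) \<Rightarrow> real set \<Rightarrow> (real \<Rightarrow> real \<times> real)
      \<Rightarrow> real \<times> real \<Rightarrow> (real \<Rightarrow> real) \<Rightarrow> bool" where
  "has_trace U u I \<gamma> n g \<longleftrightarrow>
    (\<exists>v. (AE p in lebesgue_on U. v p = u p) \<and>
         (AE s in lebesgue_on I. ((\<lambda>h. v (\<gamma> s + h *\<^sub>R n)) \<longlongrightarrow> g s) (at_right 0)))"

definition bvp_solution ::
    "(nat \<Rightarrow> real) \<Rightarrow> (real \<times> real \<Rightarrow> real) \<Rightarrow> (real \<times> real \<Rightarrow> real) \<Rightarrow> bool" where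
  "bvp_solution X f u \<longleftrightarrow>
    distr_eq (Dom X)
      (distr_diff (distr_mult snd (distr_dx (distr_of (Dom X) u)))
                  (distr_dy (distr_dy (distr_of (Dom X) u))))
      (distr_of (Dom X) f) \<and>
    has_trace (Dom X) u {0<..<1} (\<lambda>y. (X 0, y)) (1, 0) (\<lambda>_. 0) \<and>
    has_trace (Dom X) u {-1<..<0} (\<lambda>y. (X 1, y)) (-1, 0) (\<lambda>_. 0) \<and>
    has_trace (Dom X) u {X 0<..<X 1} (\<lambda>x. (x, -1)) (0, 1) (\<lambda>_. 0) \<and>
    has_trace (Dom X) u {X 0<..<X 1} (\<lambda>x. (x, 1)) (0, -1) (\<lambda>_. 0)"


section \<open>The singular profiles\<close>

definition v0 :: "(real \<Rightarrow> real) \<Rightarrow> real \<Rightarrow> real \<Rightarrow> real" where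
  "v0 \<Lambda> x y =
    (let r = (y\<^sup>2 + x powr (2/3)) powr (1/2); t = y * x powr (-1/3) in r powr (1/2) * \<Lambda> t)"

text \<open>
  At x = 0 the variable t is infinite, so the value of \<open>v0\<close> there is a limit.
  The conditions determine \<open>\<Lambda>\<close> uniquely.
\<close>

definition is_Lambda0 :: "(real \<Rightarrow> real) \<Rightarrow> bool" where
  "is_Lambda0 \<Lambda> \<longleftrightarrow>
    smooth_real \<Lambda> \<and> bounded (range \<Lambda>) \<and>
    (\<Lambda> \<longlongrightarrow> 1) at_bot \<and> (\<Lambda> \<longlongrightarrow> 0) at_top \<and>
    (\<forall>x>0. \<forall>y. y * deriv (\<lambda>s. v0 \<Lambda> s y) x - (deriv ^^ 2) (\<lambda>s. v0 \<Lambda> x s) y = 0) \<and>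
    (\<forall>y>0. ((\<lambda>x. v0 \<Lambda> x y) \<longlongrightarrow> 0) (at_right 0))"

text \<open>The cut-off of the profile at \<open>(X i, 0)\<close>; its support is the support relative to the closed domain.\<close>

definition cutoff :: "(nat \<Rightarrow> real) \<Rightarrow> nat \<Rightarrow> (real \<times> real \<Rightarrow> real) \<Rightarrow> bool" where
  "cutoff X i \<eta> \<longleftrightarrow>
    smooth_on (closure (Dom X)) \<eta> \<and>
    (\<exists>U. open U \<and> (X i, 0) \<in> U \<and> (\<forall>p \<in> U \<inter> closure (Dom X). \<eta> p = 1)) \<and>
    (\<exists>R. R < min 1 (X 1 - X 0) / 2 \<and>
      closure {p \<in> closure (Dom X). \<eta> p \<noteq> 0} \<subseteq> ball (X i, 0) R)"

definition sing_core :: "(real \<Rightarrow> real) \<Rightarrow> (nat \<Rightarrow> real) \<Rightarrow> nat \<Rightarrow> real \<Rightarrow> real \<Rightarrow> real" where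
  "sing_core \<Lambda> X i x y =
    (let r = (y\<^sup>2 + \<bar>x - X i\<bar> powr (2/3)) powr (1/2);
         t = (-1) ^ i * y * \<bar>x - X i\<bar> powr (-1/3)
     in r powr (1/2) * \<Lambda> t)"

text \<open>
  The value of \<open>sing_core\<close> at \<open>x = X i\<close>, \<open>y \<noteq> 0\<close> is meaningless (\<open>0 powr a = 0\<close>
  would give \<open>t = 0\<close>) and is replaced by the limit; at \<open>(X i, 0)\<close> it is 0 because \<open>r = 0\<close>.
\<close>

definition u_sing ::
    "(real \<Rightarrow> real) \<Rightarrow> (nat \<Rightarrow> real) \<Rightarrow> (nat \<Rightarrow> real \<times> real \<Rightarrow> real) \<Rightarrow> nat
      \<Rightarrow> real \<times> real \<Rightarrow> real" where
  "u_sing \<Lambda> X \<eta> i = (\<lambda>(x, y).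
    (if x = X i \<and> y \<noteq> 0 then Lim (at (X i)) (\<lambda>x'. sing_core \<Lambda> X i x' y)
     else sing_core \<Lambda> X i x y) * \<eta> i (x, y))"

end

theory Submission
  imports Defs
begin

text \<open>
  In the variable \<open>t = y x powr (-1/3)\<close> the singular solution is \<open>x powr (1/6) * g t\<close>, and the equation becomes
  \<open>g'' = t g / 6 - t\<^sup>2 g' / 3\<close>. Its derivatives of order j in x and k in y have the same form, with profiles
  \<open>G j k\<close>. At infinity the differential equation for a suitably rescaled derivative of g has a single
  equilibrium, attracting for \<open>t \<rightarrow> \<infinity>\<close> and repelling for \<open>t \<rightarrow> - \<infinity>\<close>, and the growth of g excludes
  escape from it; hence all \<open>G j k\<close> have power asymptotics, which is smoothness up to the line x = 0 away
  from the origin, and yields the square integrability of the derivatives that occur in \<open>Z0\<close>. The mixed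
  derivative is too singular to be square integrable unless its profile vanishes, which would force g = 0.

  For uniqueness, the weak derivatives of a difference w of two solutions give representatives that are
  absolutely continuous on almost every line. Testing the equation with w itself,
  \<open>\<integral> y w w\<^sub>x\<close> is nonnegative because of the zero traces on the inflow boundary, so \<open>w\<^sub>y = 0\<close>.
\<close>

section \<open>Families of derivatives\<close>

text \<open>Two obstacles shape the proof. Differentiating
  \<open>x powr e * G (y * x powr (-1/3))\<close> in x combines two terms whose leading parts at
  infinity cancel, so the asymptotics of one profile do not give those of the next x-derivative.
  Profiles of higher x-order are therefore recovered from the differentiated equation, which trades
  one x-derivative and a factor t for two y-derivatives. In the uniqueness part the weak
  x-derivative is controlled only after multiplication by y, and no density of smooth functions in
  \<open>Z0\<close> is used. The energy identity is derived on almost every line separately, from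
  the primitives themselves, and the equation is tested with tensor products only. The exponents
  come from scaling with weight 3 for x and 1 for y: area has degree 4 and the solution degree 1/2.
  The square of the second y-derivative has degree -3, that of the mixed derivative degree -7, and
  -4 is the borderline for integrability at the singular point.\<close>

definition is_jet1 :: "(nat \<Rightarrow> real \<Rightarrow> real) \<Rightarrow> bool" where
  "is_jet1 F \<longleftrightarrow> (\<forall>n x. (F n has_real_derivative F (Suc n) x) (at x))"

text \<open>At points of \<open>S\<close> outside its interior, \<open>D j k\<close> is tied to the
  derivatives by continuity alone. Naming the whole family, instead of iterating
  \<open>deriv\<close>, makes shifts, products and restrictions smooth by exhibiting the new
  family.\<close>

definition is_jet2 :: "(real \<times> real) set \<Rightarrow> (nat \<Rightarrow> nat \<Rightarrow> real \<times> real \<Rightarrow> real) \<Rightarrow> bool" where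
  "is_jet2 S D \<longleftrightarrow>
      (\<forall>j k. continuous_on S (D j k)) \<and>
      (\<forall>j k x y. (x, y) \<in> interior S \<longrightarrow>
        ((\<lambda>s. D j k (s, y)) has_real_derivative D (Suc j) k (x, y)) (at x) \<and>
        ((\<lambda>s. D j k (x, s)) has_real_derivative D j (Suc k) (x, y)) (at y))"

lemma smooth_on_iff_jet2: "smooth_on S f \<longleftrightarrow> (\<exists>D. is_jet2 S D \<and> (\<forall>p\<in>S. D 0 0 p = f p))"
  unfolding smooth_on_def is_jet2_def by blast

lemma is_jet2_continuous: "is_jet2 S D \<Longrightarrow> continuous_on S (D j k)"
  by (auto simp: is_jet2_def)

lemma is_jet2_dx:
  "is_jet2 S D \<Longrightarrow> (x, y) \<in> interior S \<Longrightarrow>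
    ((\<lambda>s. D j k (s, y)) has_real_derivative D (Suc j) k (x, y)) (at x)"
  by (auto simp: is_jet2_def)

lemma is_jet2_dy:
  "is_jet2 S D \<Longrightarrow> (x, y) \<in> interior S \<Longrightarrow>
    ((\<lambda>s. D j k (x, s)) has_real_derivative D j (Suc k) (x, y)) (at y)"
  by (auto simp: is_jet2_def)

lemma is_jet2_subset: "is_jet2 S D \<Longrightarrow> T \<subseteq> S \<Longrightarrow> is_jet2 T D"
  unfolding is_jet2_def by (meson continuous_on_subset interior_mono subsetD)

lemma is_jet2_shift: "is_jet2 S D \<Longrightarrow> is_jet2 S (\<lambda>j k. D (m + j) (n + k))"
  unfolding is_jet2_def by auto

lemma is_jet2_diff:
  "is_jet2 S D \<Longrightarrow> is_jet2 S E \<Longrightarrow> is_jet2 S (\<lambda>j k p. D j k p - E j k p)"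
  unfolding is_jet2_def by (auto intro!: continuous_intros derivative_intros)

lemma deriv_funpow_jet1:
  assumes "is_jet1 F"
  shows "(deriv ^^ n) (F 0) = F n"
proof (induction n)
  case (Suc n)
  have "deriv (F n) = F (Suc n)"
    using assms by (auto simp: is_jet1_def fun_eq_iff intro!: DERIV_imp_deriv)
  then show ?case using Suc by simp
qed simp

lemma smooth_real_jet1: "is_jet1 F \<Longrightarrow> smooth_real (F 0)"
  unfolding smooth_real_def deriv_funpow_jet1
  by (auto simp: deriv_funpow_jet1 is_jet1_def real_differentiable_def)

lemma is_jet1_smooth_real: "smooth_real f \<Longrightarrow> is_jet1 (\<lambda>n. (deriv ^^ n) f)"
  unfolding smooth_real_def is_jet1_def
  by (auto simp: DERIV_deriv_iff_real_differentiable)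

lemma is_jet1_continuous: "is_jet1 F \<Longrightarrow> continuous_on S (F n)"
  unfolding is_jet1_def by (meson DERIV_isCont continuous_at_imp_continuous_on)

lemma smooth_real_has_deriv: "smooth_real f \<Longrightarrow> (f has_real_derivative deriv f x) (at x)"
  using is_jet1_smooth_real[of f] unfolding is_jet1_def by (metis funpow_0 funpow_simps_right(2) comp_apply funpow.simps(2))

lemma smooth_real_deriv: "smooth_real f \<Longrightarrow> smooth_real (deriv f)"
  unfolding smooth_real_def
proof (intro allI)
  fix n x assume "\<forall>n x. (deriv ^^ n) f differentiable at x"
  then have "(deriv ^^ (Suc n)) f differentiable at x" by blast
  then show "(deriv ^^ n) (deriv f) differentiable at x" by (simp add: funpow_swap1)
qed

lemma smooth_real_continuous: "smooth_real f \<Longrightarrow> continuous_on S f"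
  using is_jet1_continuous[OF is_jet1_smooth_real, of f S 0] by simp

text \<open>Pascal's rule, arranged for Leibniz: the left side is what differentiating the Leibniz
  sum of order n term by term produces.\<close>

lemma binomial_convolution_Suc:
  fixes a b :: "nat \<Rightarrow> real"
  shows "(\<Sum>i\<le>n. real (n choose i) * (a (Suc i) * b (n - i) + a i * b (Suc n - i)))
       = (\<Sum>i\<le>Suc n. real (Suc n choose i) * (a i * b (Suc n - i)))"
proof -
  have "(\<Sum>i\<le>Suc n. real (Suc n choose i) * (a i * b (Suc n - i)))
     = a 0 * b (Suc n) + (\<Sum>i\<le>n. real (Suc n choose Suc i) * (a (Suc i) * b (n - i)))"
    by (subst sum.atMost_Suc_shift) simp
  also have "\<dots> = a 0 * b (Suc n) + (\<Sum>i\<le>n. real (n choose Suc i) * (a (Suc i) * b (n - i)))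
      + (\<Sum>i\<le>n. real (n choose i) * (a (Suc i) * b (n - i)))"
    by (simp add: algebra_simps sum.distrib)
  also have "a 0 * b (Suc n) + (\<Sum>i\<le>n. real (n choose Suc i) * (a (Suc i) * b (n - i)))
      = (\<Sum>i\<le>Suc n. real (n choose i) * (a i * b (Suc n - i)))"
    by (subst sum.atMost_Suc_shift) simp
  also have "\<dots> = (\<Sum>i\<le>n. real (n choose i) * (a i * b (Suc n - i)))" by simp
  finally show ?thesis by (simp add: algebra_simps sum.distrib)
qed

lemma DERIV_leibniz:
  fixes a b :: "nat \<Rightarrow> real \<Rightarrow> real"
  assumes "\<And>i. (a i has_real_derivative a (Suc i) x) (at x)"
    and "\<And>i. (b i has_real_derivative b (Suc i) x) (at x)"
  shows "((\<lambda>s. \<Sum>i\<le>n. real (n choose i) * (a i s * b (n - i) s)) has_real_derivative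
          (\<Sum>i\<le>Suc n. real (Suc n choose i) * (a i x * b (Suc n - i) x))) (at x)"
proof -
  have "((\<lambda>s. \<Sum>i\<le>n. real (n choose i) * (a i s * b (n - i) s)) has_real_derivative
      (\<Sum>i\<le>n. real (n choose i) * (a (Suc i) x * b (n - i) x + a i x * b (Suc n - i) x))) (at x)"
    by (intro DERIV_sum) (auto intro!: derivative_eq_intros assms simp: Suc_diff_le algebra_simps)
  then show ?thesis unfolding binomial_convolution_Suc[of n "\<lambda>i. a i x" "\<lambda>i. b i x"] .
qed

lemma is_jet1_mult:
  assumes "is_jet1 F" "is_jet1 G"
  shows "is_jet1 (\<lambda>n s. \<Sum>i\<le>n. real (n choose i) * (F i s * G (n - i) s))"
  using assms unfolding is_jet1_def by (intro allI DERIV_leibniz) auto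

lemma smooth_real_mult:
  assumes "smooth_real f" "smooth_real g"
  shows "smooth_real (\<lambda>x. f x * g x)"
  using smooth_real_jet1[OF is_jet1_mult[OF assms[THEN is_jet1_smooth_real]]] by simp

lemma smooth_real_cmult:
  assumes "smooth_real f"
  shows "smooth_real (\<lambda>x. c * f x)"
proof -
  have "is_jet1 (\<lambda>n x. c * (deriv ^^ n) f x)"
    using is_jet1_smooth_real[OF assms] unfolding is_jet1_def by (auto intro!: DERIV_cmult)
  from smooth_real_jet1[OF this] show ?thesis by simp
qed

lemma smooth_real_diff:
  assumes "smooth_real f" "smooth_real g"
  shows "smooth_real (\<lambda>x. f x - g x)"
proof -
  have "is_jet1 (\<lambda>n x. (deriv ^^ n) f x - (deriv ^^ n) g x)"
    using assms[THEN is_jet1_smooth_real] unfolding is_jet1_def by (auto intro!: DERIV_diff)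
  from smooth_real_jet1[OF this] show ?thesis by simp
qed

lemma smooth_real_affine:
  assumes "smooth_real f"
  shows "smooth_real (\<lambda>x. f (c * x + d))"
proof -
  have "((\<lambda>x. (deriv ^^ n) f (c * x + d)) has_real_derivative (deriv ^^ Suc n) f (c * x + d) * c) (at x)" for n x
    using is_jet1_smooth_real[OF assms] unfolding is_jet1_def
    by (intro DERIV_chain2[where g="\<lambda>x. c * x + d"]) (auto intro!: derivative_eq_intros)
  then have "is_jet1 (\<lambda>n x. c ^ n * (deriv ^^ n) f (c * x + d))"
    unfolding is_jet1_def by (auto intro!: derivative_eq_intros simp: algebra_simps)
  from smooth_real_jet1[OF this] show ?thesis by simp
qed

lemma is_jet2_mult:
  assumes F: "is_jet2 S F" and G: "is_jet2 S G"
  shows "is_jet2 S (\<lambda>j k p. \<Sum>l\<le>k. real (k choose l) * (\<Sum>i\<le>j. real (j choose i) * (F i l p * G (j - i) (k - l) p)))"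
    (is "is_jet2 S ?D")
  unfolding is_jet2_def
proof (intro conjI allI impI)
  fix j k show "continuous_on S (?D j k)"
    by (intro continuous_intros is_jet2_continuous[OF F] is_jet2_continuous[OF G])
next
  fix j k x y assume xy: "(x, y) \<in> interior S"
  show "((\<lambda>s. ?D j k (s, y)) has_real_derivative ?D (Suc j) k (x, y)) (at x)"
    by (intro DERIV_sum DERIV_cmult DERIV_leibniz[where a="\<lambda>i s. F i _ (s, y)" and b="\<lambda>i s. G i _ (s, y)"]
        is_jet2_dx[OF F xy] is_jet2_dx[OF G xy])
  \<comment> \<open>Exchanging the two sums puts the sum over y-orders innermost, so that the
    one-variable Leibniz rule applies in y as well.\<close>
  have swap: "?D j k p = (\<Sum>i\<le>j. real (j choose i) * (\<Sum>l\<le>k. real (k choose l) * (F i l p * G (j - i) (k - l) p)))" for j k p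
    unfolding sum_distrib_left by (subst sum.swap) (simp add: mult_ac)
  show "((\<lambda>s. ?D j k (x, s)) has_real_derivative ?D j (Suc k) (x, y)) (at y)"
    unfolding swap
    by (intro DERIV_sum DERIV_cmult DERIV_leibniz[where a="\<lambda>l s. F _ l (x, s)" and b="\<lambda>l s. G _ l (x, s)"]
        is_jet2_dy[OF F xy] is_jet2_dy[OF G xy])
qed

lemma is_jet2_snd: "is_jet2 S (\<lambda>j k p. if j = 0 then if k = 0 then snd p else if k = 1 then 1 else 0 else 0)"
  (is "is_jet2 S ?D")
  unfolding is_jet2_def
proof (intro conjI allI impI)
  fix j k show "continuous_on S (?D j k)"
    by (cases "j = 0"; cases "k = 0"; cases "k = 1") (simp_all add: continuous_on_snd)
next
  fix j k x y
  show "((\<lambda>s. ?D j k (s, y)) has_real_derivative ?D (Suc j) k (x, y)) (at x)"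
    by (cases "j = 0"; cases "k = 0"; cases "k = 1") simp_all
  show "((\<lambda>s. ?D j k (x, s)) has_real_derivative ?D j (Suc k) (x, y)) (at y)"
    by (cases "j = 0"; cases "k = 0"; cases "k = 1") simp_all
qed

lemma is_jet2_mult_snd:
  assumes "is_jet2 S D"
  obtains E where "is_jet2 S E" "\<And>p. E 0 0 p = snd p * D 0 0 p"
  by (rule that[OF is_jet2_mult[OF is_jet2_snd assms]]) auto

lemma is_jet2_tensor:
  assumes "is_jet1 F" "is_jet1 G"
  shows "is_jet2 S (\<lambda>j k (x, y). F j x * G k y)"
  unfolding is_jet2_def split_beta
proof (intro conjI allI impI)
  fix j k show "continuous_on S (\<lambda>p. F j (fst p) * G k (snd p))"
    by (intro continuous_intros continuous_on_compose2[OF is_jet1_continuous[OF assms(1), of UNIV]]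
        continuous_on_compose2[OF is_jet1_continuous[OF assms(2), of UNIV]]) auto
qed (use assms in \<open>auto simp: is_jet1_def intro!: derivative_eq_intros\<close>)

text \<open>For \<sigma> = -1 this is a point reflection. The operators y d/dx and d2/dy2 are
  invariant under it, so it carries the singular point at one end of the domain to that at the
  other.\<close>

lemma is_jet2_affine:
  fixes a \<sigma> :: real
  assumes D: "is_jet2 S D" and T: "\<And>x y. (x, y) \<in> T \<longleftrightarrow> (\<sigma> * (x - a), \<sigma> * y) \<in> S" and "\<sigma> \<noteq> 0"
  shows "is_jet2 T (\<lambda>j k (x, y). \<sigma> ^ (j + k) * D j k (\<sigma> * (x - a), \<sigma> * y))"
  unfolding is_jet2_def
proof (intro conjI allI impI)
  fix j k show "continuous_on T (\<lambda>(x, y). \<sigma> ^ (j + k) * D j k (\<sigma> * (x - a), \<sigma> * y))"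
    unfolding split_beta
    by (intro continuous_intros continuous_on_compose2[OF is_jet2_continuous[OF D]])
       (use T in \<open>auto intro!: continuous_intros\<close>)
next
  fix j k x y assume xy: "(x, y) \<in> interior T"
  \<comment> \<open>\<open>h\<close> inverts the affine map. Its preimage of the interior of
    \<open>T\<close> is an open subset of \<open>S\<close>, which places the image point in the
    interior of \<open>S\<close>.\<close>
  define h where "h = (\<lambda>p :: real \<times> real. (fst p / \<sigma> + a, snd p / \<sigma>))"
  have hS: "h -` T = S"
  proof (intro set_eqI)
    fix p show "p \<in> h -` T \<longleftrightarrow> p \<in> S"
      using T[of "fst p / \<sigma> + a" "snd p / \<sigma>"] \<open>\<sigma> \<noteq> 0\<close> by (simp add: h_def)
  qed
  have "open (h -` interior T)"
    unfolding h_def using \<open>\<sigma> \<noteq> 0\<close>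
    by (intro open_vimage) (auto intro!: continuous_intros)
  moreover have "h -` interior T \<subseteq> S" using interior_subset hS by blast
  moreover have "(\<sigma> * (x - a), \<sigma> * y) \<in> h -` interior T"
    using xy \<open>\<sigma> \<noteq> 0\<close> by (simp add: h_def)
  ultimately have in_S: "(\<sigma> * (x - a), \<sigma> * y) \<in> interior S" by (meson interior_maximal subsetD)
  have "((\<lambda>s. D j k (\<sigma> * (s - a), \<sigma> * y)) has_real_derivative D (Suc j) k (\<sigma> * (x - a), \<sigma> * y) * \<sigma>) (at x)"
    by (rule DERIV_chain2[where g="\<lambda>s. \<sigma> * (s - a)", OF is_jet2_dx[OF D in_S]])
       (auto intro!: derivative_eq_intros)
  from DERIV_cmult[OF this, of "\<sigma> ^ (j + k)"]
  show "((\<lambda>s. case (s, y) of (x, y) \<Rightarrow> \<sigma> ^ (j + k) * D j k (\<sigma> * (x - a), \<sigma> * y)) has_real_derivative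
      (case (x, y) of (x, y) \<Rightarrow> \<sigma> ^ (Suc j + k) * D (Suc j) k (\<sigma> * (x - a), \<sigma> * y))) (at x)"
    by (simp add: mult_ac)
  have "((\<lambda>s. D j k (\<sigma> * (x - a), \<sigma> * s)) has_real_derivative D j (Suc k) (\<sigma> * (x - a), \<sigma> * y) * \<sigma>) (at y)"
    by (rule DERIV_chain2[where g="\<lambda>s. \<sigma> * s", OF is_jet2_dy[OF D in_S]])
       (auto intro!: derivative_eq_intros)
  from DERIV_cmult[OF this, of "\<sigma> ^ (j + k)"]
  show "((\<lambda>s. case (x, s) of (x, y) \<Rightarrow> \<sigma> ^ (j + k) * D j k (\<sigma> * (x - a), \<sigma> * y)) has_real_derivative
      (case (x, y) of (x, y) \<Rightarrow> \<sigma> ^ (j + Suc k) * D j (Suc k) (\<sigma> * (x - a), \<sigma> * y))) (at y)"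
    by (simp add: mult_ac)
qed

lemma dense_interior_meets:
  fixes S :: "'a::topological_space set"
  assumes "S \<subseteq> closure (interior S)" "open W"
  shows "W \<inter> S \<subseteq> closure (W \<inter> interior S)"
  using assms open_Int_closure_subset by fastforce

text \<open>Derivatives are compared in the interior only; density of the interior and continuity
  carry the identity to boundary points, and the open set \<open>W\<close> makes this local.\<close>

lemma continuous_on_dense_eq:
  fixes f :: "'a::topological_space \<Rightarrow> real"
  assumes f: "continuous_on S f" and S: "S \<subseteq> closure (interior S)" and W: "open W"
    and eq: "\<And>p. p \<in> W \<inter> interior S \<Longrightarrow> f p = c" and p: "p \<in> W \<inter> S"
  shows "f p = c"
proof -
  have "closedin (top_of_set S) (S \<inter> f -` {c})"
    using f by (intro continuous_closedin_preimage) auto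
  then obtain C where C: "closed C" "S \<inter> f -` {c} = S \<inter> C" by (auto simp: closedin_closed)
  have "W \<inter> interior S \<subseteq> C" using eq C interior_subset[of S] by blast
  then have "closure (W \<inter> interior S) \<subseteq> C" using C(1) closure_minimal by blast
  then show ?thesis using dense_interior_meets[OF S W] p C(2) by blast
qed

text \<open>Constancy on an open set kills every derivative there by induction on the order, and
  continuity reaches the boundary. Applied to the difference of two families, this is uniqueness of
  derivatives, boundary values included.\<close>

lemma is_jet2_const_zero:
  assumes D: "is_jet2 S D" and S: "S \<subseteq> closure (interior S)" and W: "open W"
    and c: "\<And>p. p \<in> W \<inter> interior S \<Longrightarrow> D 0 0 p = c"
    and jk: "j + k > 0" and p: "p \<in> W \<inter> S"
  shows "D j k p = 0"
proof -
  define B where "B = W \<inter> interior S"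
  have B: "open B" unfolding B_def using W by auto
  have step: "D (Suc j) k q = 0 \<and> D j (Suc k) q = 0"
    if "\<And>q. q \<in> B \<Longrightarrow> D j k q = c" "q \<in> B" for j k c q
  proof -
    obtain x y where q: "q = (x, y)" by (cases q)
    have xy: "(x, y) \<in> interior S" using that q by (auto simp: B_def)
    have "open ((\<lambda>s. (s, y)) -` B)" "open ((\<lambda>s. (x, s)) -` B)"
      using B by (auto intro!: open_vimage continuous_intros)
    then have e: "\<forall>\<^sub>F s in nhds x. (s, y) \<in> B" "\<forall>\<^sub>F s in nhds y. (x, s) \<in> B"
      using that(2) q by (auto simp: eventually_nhds)
    have "((\<lambda>s. D j k (s, y)) has_real_derivative 0) (at x) \<longleftrightarrow> ((\<lambda>s. c) has_real_derivative 0) (at x)"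
      by (rule DERIV_cong_ev) (use e that in \<open>auto elim!: eventually_mono\<close>)
    moreover have "((\<lambda>s. D j k (x, s)) has_real_derivative 0) (at y) \<longleftrightarrow> ((\<lambda>s. c) has_real_derivative 0) (at y)"
      by (rule DERIV_cong_ev) (use e that in \<open>auto elim!: eventually_mono\<close>)
    ultimately show ?thesis unfolding q
      using is_jet2_dx[OF D xy] is_jet2_dy[OF D xy] DERIV_unique by fastforce
  qed
  have "\<forall>q\<in>B. D j k q = (if j + k = 0 then c else 0)" for j k
  proof (induction "j + k" arbitrary: j k)
    case 0
    then show ?case using c by (auto simp: B_def)
  next
    case (Suc n)
    show ?case
    proof (cases j)
      case 0
      then obtain k' where "k = Suc k'" using Suc by (cases k) auto
      then show ?thesis using Suc 0 step[of j k' "if j + k' = 0 then c else 0"] by auto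
    next
      case (Suc j')
      then show ?thesis using Suc.hyps step[of j' k "if j' + k = 0 then c else 0"] by auto
    qed
  qed
  then have "\<And>q. q \<in> W \<inter> interior S \<Longrightarrow> D j k q = 0" using jk by (auto simp: B_def)
  from continuous_on_dense_eq[OF is_jet2_continuous[OF D] S W this p] show ?thesis by simp
qed

text \<open>A puncture outside the interior imposes continuity but no differentiability, and near it
  everything is zero. This will fill in the right-hand side at the singular point.\<close>

lemma is_jet2_extend_zero:
  assumes D: "is_jet2 (K - {p}) D" and K: "K \<subseteq> closure (interior K)" and p: "p \<notin> interior K"
    and W: "open W" "p \<in> W" and z: "\<And>q. q \<in> W \<inter> interior K \<Longrightarrow> D 0 0 q = 0"
  shows "is_jet2 K (\<lambda>j k q. if q = p then 0 else D j k q)"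
  unfolding is_jet2_def
proof (intro conjI allI impI)
  have int: "interior (K - {p}) = interior K"
  proof (rule antisym)
    show "interior K \<subseteq> interior (K - {p})"
      using p interior_subset[of K] by (intro interior_maximal) auto
    show "interior (K - {p}) \<subseteq> interior K" by (intro interior_mono) auto
  qed
  have S: "K - {p} \<subseteq> closure (interior (K - {p}))" using K int by auto
  have zero: "D j k q = 0" if "q \<in> W \<inter> (K - {p})" for j k q
  proof (cases "j + k = 0")
    case True
    then show ?thesis
      using continuous_on_dense_eq[OF is_jet2_continuous[OF D] S W(1) _ that, of 0 0 0] z int by auto
  next
    case False
    then show ?thesis
      using is_jet2_const_zero[OF D S W(1) _ _ that, of 0 j k] z int by auto
  qed
  fix j k
  show "continuous_on K (\<lambda>q. if q = p then 0 else D j k q)"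
  proof -
    have "continuous_on (K \<inter> W \<union> (K - {p})) (\<lambda>q. if q \<in> W then 0 else D j k q)"
    proof (rule continuous_on_cases_local_open)
      show "openin (top_of_set (K \<inter> W \<union> (K - {p}))) (K \<inter> W)"
        using W by (auto simp: openin_open)
      show "openin (top_of_set (K \<inter> W \<union> (K - {p}))) (K - {p})"
        unfolding openin_open by (rule exI[of _ "- {p}"]) auto
    qed (use zero is_jet2_continuous[OF D] in auto)
    moreover have "K \<inter> W \<union> (K - {p}) = K" using W by auto
    ultimately have "continuous_on K (\<lambda>q. if q \<in> W then 0 else D j k q)" by simp
    then show ?thesis
      by (rule continuous_on_eq) (use zero W in auto)
  qed
  fix x y assume xy: "(x, y) \<in> interior K"
  then have ne: "(x, y) \<noteq> p" using p by auto
  have xy': "(x, y) \<in> interior (K - {p})" using int xy by simp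
  have "open ((\<lambda>s. (s, y)) -` (- {p}))" "open ((\<lambda>s. (x, s)) -` (- {p}))"
    by (auto intro!: open_vimage continuous_intros)
  then have e: "\<forall>\<^sub>F s in nhds x. (s, y) \<noteq> p" "\<forall>\<^sub>F s in nhds y. (x, s) \<noteq> p"
    using ne by (auto simp: eventually_nhds)
  show "((\<lambda>s. if (s, y) = p then 0 else D j k (s, y)) has_real_derivative
      (if (x, y) = p then 0 else D (Suc j) k (x, y))) (at x)"
    using is_jet2_dx[OF D xy', of j k] ne
    by (subst DERIV_cong_ev[OF refl eventually_mono[OF e(1)] refl, of _ "\<lambda>s. D j k (s, y)"]) auto
  show "((\<lambda>s. if (x, s) = p then 0 else D j k (x, s)) has_real_derivative
      (if (x, y) = p then 0 else D j (Suc k) (x, y))) (at y)"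
    using is_jet2_dy[OF D xy', of j k] ne
    by (subst DERIV_cong_ev[OF refl eventually_mono[OF e(2)] refl, of _ "\<lambda>s. D j k (x, s)"]) auto
qed

section \<open>Bump functions\<close>

text \<open>The polynomial parameter closes the class under differentiation: the derivative of
  p(1/x) exp(-1/x) is q(1/x) exp(-1/x) with q = X^2 (p - p'). Smoothness at 0 then only needs that
  every member tends to 0 there.\<close>

definition flat :: "real poly \<Rightarrow> real \<Rightarrow> real" where
  "flat p x = (if x > 0 then poly p (1 / x) * exp (- (1 / x)) else 0)"

lemma poly_exp_tendsto_0: "((\<lambda>u. poly p u * exp (- u)) \<longlongrightarrow> 0) at_top" for p :: "real poly"
proof -
  have "((\<lambda>u. \<Sum>i\<le>degree p. coeff p i * (u ^ i / exp u)) \<longlongrightarrow> (\<Sum>i\<le>degree p. coeff p i * 0)) at_top"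
    by (intro tendsto_intros tendsto_power_div_exp_0)
  then show ?thesis by (simp add: poly_altdef sum_divide_distrib exp_minus divide_inverse sum_distrib_right mult.assoc)
qed

lemma flat_tendsto_0: "(flat p \<longlongrightarrow> 0) (at 0)"
proof (rule filterlim_split_at)
  have "((\<lambda>x. poly p (inverse x) * exp (- inverse x)) \<longlongrightarrow> 0) (at_right 0)"
    by (rule filterlim_compose[OF poly_exp_tendsto_0 filterlim_inverse_at_top_right])
  then show "(flat p \<longlongrightarrow> 0) (at_right 0)"
    by (rule Lim_transform_eventually)
       (auto simp: flat_def eventually_at_filter inverse_eq_divide)
  show "(flat p \<longlongrightarrow> 0) (at_left 0)"
    by (rule tendsto_eventually) (auto simp: flat_def eventually_at_filter)
qed

lemma flat_has_deriv:
  "(flat p has_real_derivative flat ([:0, 0, 1:] * (p - pderiv p)) x) (at x)"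
proof -
  consider "x > 0" | "x < 0" | "x = 0" by linarith
  then show ?thesis
  proof cases
    case 1
    have "((\<lambda>x. poly p (1 / x) * exp (- (1 / x))) has_real_derivative
      (poly (pderiv p) (1 / x) * (- 1 / x\<^sup>2)) * exp (- (1 / x)) + exp (- (1 / x)) * (1 / x\<^sup>2) * poly p (1 / x)) (at x)"
      using 1
      by (intro DERIV_mult DERIV_chain2[OF poly_DERIV])
         (auto intro!: derivative_eq_intros simp: power2_eq_square)
    moreover have "\<forall>\<^sub>F s in nhds x. flat p s = poly p (1 / s) * exp (- (1 / s))"
      using eventually_nhds_in_open[of "{0<..}" x] 1
      by (auto simp: flat_def elim!: eventually_mono)
    ultimately show ?thesis
      using 1 by (subst DERIV_cong_ev[OF refl _ refl])
        (auto simp: flat_def field_simps power2_eq_square)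
  next
    case 2
    have "\<forall>\<^sub>F s in nhds x. flat p s = 0"
      using eventually_nhds_in_open[of "{..<0}" x] 2
      by (auto simp: flat_def elim!: eventually_mono)
    then show ?thesis
      using 2 by (subst DERIV_cong_ev[OF refl _ refl, where g="\<lambda>_. 0"]) (auto simp: flat_def)
  next
    case 3
    \<comment> \<open>The difference quotient at 0 is \<open>flat\<close> of X p, because dividing
      by h multiplies by the variable 1/h.\<close>
    have "((\<lambda>h. (flat p (0 + h) - flat p 0) / h) \<longlongrightarrow> 0) (at 0)"
      by (rule Lim_transform_eventually[OF flat_tendsto_0[of "[:0, 1:] * p"]])
         (auto simp: flat_def eventually_at_filter)
    then show ?thesis
      unfolding 3 DERIV_def by (simp add: flat_def)
  qed
qed

lemma smooth_real_flat: "smooth_real (flat p)"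
proof -
  define P where "P n = ((\<lambda>q. [:0, 0, 1:] * (q - pderiv q)) ^^ n) p" for n
  have "is_jet1 (\<lambda>n. flat (P n))"
    unfolding is_jet1_def P_def using flat_has_deriv by auto
  from smooth_real_jet1[OF this] show ?thesis by (simp add: P_def)
qed

text \<open>The shift by 1 keeps the support away from the end points.\<close>

definition bump :: "nat \<Rightarrow> real \<Rightarrow> real \<Rightarrow> real \<Rightarrow> real" where
  "bump n a b x = flat 1 (real (Suc n) * (x - a) - 1) * flat 1 (real (Suc n) * (b - x) - 1)"

lemma smooth_real_bump: "smooth_real (bump n a b)"
proof -
  have "smooth_real (\<lambda>x. flat 1 (real (Suc n) * x + - (real (Suc n) * a + 1)) * flat 1 (- real (Suc n) * x + (real (Suc n) * b - 1)))"
    by (intro smooth_real_mult smooth_real_affine smooth_real_flat)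
  moreover have "(\<lambda>x. flat 1 (real (Suc n) * x + - (real (Suc n) * a + 1)) * flat 1 (- real (Suc n) * x + (real (Suc n) * b - 1))) = bump n a b"
    by (intro ext) (simp add: bump_def algebra_simps)
  ultimately show ?thesis by simp
qed

lemma flat_bounds: "0 \<le> flat 1 x" "flat 1 x \<le> 1"
  by (auto simp: flat_def)

lemma bump_bounds: "0 \<le> bump n a b x" "bump n a b x \<le> 1"
  unfolding bump_def using flat_bounds by (auto intro!: mult_le_one)

lemma flat_1_nonpos: "x \<le> 0 \<Longrightarrow> flat 1 x = 0"
  by (simp add: flat_def)

lemma bump_eq_0:
  assumes "x \<notin> {a + 1 / real (Suc n)..b - 1 / real (Suc n)}"
  shows "bump n a b x = 0"
proof -
  have "real (Suc n) * (x - a) - 1 \<le> 0 \<or> real (Suc n) * (b - x) - 1 \<le> 0"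
    using assms by (auto simp: field_simps simp del: of_nat_Suc)
  then show ?thesis by (auto simp: bump_def flat_1_nonpos)
qed

text \<open>Inside the interval the factor n + 1 sends the arguments of both \<open>flat\<close>
  factors to infinity, where \<open>flat 1\<close> tends to 1. Indicators of intervals thus become
  bounded limits of test functions.\<close>

lemma bump_tendsto: "(\<lambda>n. bump n a b x) \<longlonglongrightarrow> indicator {a<..<b} x"
proof (cases "x \<in> {a<..<b}")
  case True
  have lim: "(\<lambda>n. flat 1 (real (Suc n) * d - 1)) \<longlonglongrightarrow> 1" if "d > 0" for d :: real
  proof -
    have "filterlim (\<lambda>n. d * real (Suc n)) at_top sequentially"
      by (intro filterlim_tendsto_pos_mult_at_top[OF tendsto_const that]
          filterlim_compose[OF filterlim_real_sequentially filterlim_Suc])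
    from filterlim_tendsto_add_at_top[OF tendsto_const this, of "-1"]
    have top: "filterlim (\<lambda>n. real (Suc n) * d + - 1) at_top sequentially"
      by (simp add: mult.commute del: of_nat_Suc)
    have "((\<lambda>u::real. exp (- (inverse u))) \<longlongrightarrow> exp (- 0)) at_top"
      by (intro tendsto_intros tendsto_inverse_0_at_top filterlim_ident)
    moreover have "\<forall>\<^sub>F u in at_top. exp (- (inverse u)) = flat 1 u"
      using eventually_gt_at_top[of 0] by eventually_elim (simp add: flat_def inverse_eq_divide)
    ultimately have "(flat 1 \<longlongrightarrow> 1) at_top"
      using Lim_transform_eventually by fastforce
    from filterlim_compose[OF this top] show ?thesis by simp
  qed
  show ?thesis
    using tendsto_mult[OF lim[of "x - a"] lim[of "b - x"]] True by (simp add: bump_def)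
next
  case False
  have "x \<notin> {a + 1 / real (Suc n)..b - 1 / real (Suc n)}" for n
  proof
    assume x: "x \<in> {a + 1 / real (Suc n)..b - 1 / real (Suc n)}"
    have "1 / real (Suc n) > 0" by simp
    then show False using x False unfolding atLeastAtMost_iff greaterThanLessThan_iff by linarith
  qed
  then have "bump n a b x = 0" for n by (rule bump_eq_0)
  then show ?thesis using False by simp
qed

lemma test_fun_real_supportI:
  assumes "smooth_real \<psi>" "\<And>x. x \<notin> {a..b} \<Longrightarrow> \<psi> x = 0" "{a..b} \<subseteq> I"
  shows "test_fun_real I \<psi>"
proof -
  have sub: "closure {s. \<psi> s \<noteq> 0} \<subseteq> {a..b}"
    by (rule closure_minimal) (use assms(2) in \<open>blast, simp\<close>)
  then have "compact (closure {s. \<psi> s \<noteq> 0})"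
    using bounded_subset[OF _ sub] by (simp add: compact_eq_bounded_closed)
  then show ?thesis using sub assms unfolding test_fun_real_def by auto
qed

lemma test_fun_real_bump:
  assumes "{a<..<b} \<subseteq> I"
  shows "test_fun_real I (bump n a b)"
proof (rule test_fun_real_supportI[OF smooth_real_bump bump_eq_0])
  show "{a + 1 / real (Suc n)..b - 1 / real (Suc n)} \<subseteq> I"
  proof
    fix x assume x: "x \<in> {a + 1 / real (Suc n)..b - 1 / real (Suc n)}"
    have "1 / real (Suc n) > 0" by simp
    then have "a < x" "x < b" using x unfolding atLeastAtMost_iff by linarith+
    then show "x \<in> I" using assms by auto
  qed
qed

lemma closure_support_subset:
  fixes f g :: "'a::topological_space \<Rightarrow> real"
  assumes "\<And>p. g p \<noteq> 0 \<Longrightarrow> p \<in> closure {p. f p \<noteq> 0}"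
  shows "closure {p. g p \<noteq> 0} \<subseteq> closure {p. f p \<noteq> 0}"
  using assms by (intro closure_minimal) auto

lemma locally_zero_deriv:
  fixes f :: "real \<Rightarrow> real"
  assumes "open T" "x \<in> T" "\<And>s. s \<in> T \<Longrightarrow> f s = 0"
  shows "deriv f x = 0"
proof -
  have "(f has_real_derivative 0) (at x)"
    by (subst DERIV_cong_ev[OF refl eventually_mono[OF eventually_nhds_in_open[OF assms(1,2)]] refl, of _ "\<lambda>_. 0"])
       (auto simp: assms)
  then show ?thesis by (rule DERIV_imp_deriv)
qed

lemma test_fun_real_deriv: "test_fun_real I \<psi> \<Longrightarrow> test_fun_real I (deriv \<psi>)"
proof -
  assume t: "test_fun_real I \<psi>"
  have "closure {s. deriv \<psi> s \<noteq> 0} \<subseteq> closure {s. \<psi> s \<noteq> 0}"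
  proof (rule closure_support_subset)
    fix s assume "deriv \<psi> s \<noteq> 0"
    then show "s \<in> closure {s. \<psi> s \<noteq> 0}"
      using locally_zero_deriv[of "- closure {s. \<psi> s \<noteq> 0}" s \<psi>] closure_subset[of "{s. \<psi> s \<noteq> 0}"]
      by (metis (mono_tags, lifting) ComplI closed_closure compl_le_compl_iff mem_Collect_eq open_Compl subsetD ComplD)
  qed
  from this bounded_subset[OF _ this] show ?thesis
    using t unfolding test_fun_real_def compact_eq_bounded_closed
    by (blast intro: smooth_real_deriv)
qed

lemma test_fun_tensor:
  assumes a: "test_fun_real A \<alpha>" and b: "test_fun_real B \<beta>"
  shows "test_fun (A \<times> B) (\<lambda>(x, y). \<alpha> x * \<beta> y)"
proof -
  let ?K = "closure {s. \<alpha> s \<noteq> 0} \<times> closure {s. \<beta> s \<noteq> 0}"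
  have sub: "closure {p. (case p of (x, y) \<Rightarrow> \<alpha> x * \<beta> y) \<noteq> 0} \<subseteq> ?K"
    using closure_subset[of "{s. \<alpha> s \<noteq> 0}"] closure_subset[of "{s. \<beta> s \<noteq> 0}"]
    by (intro closure_minimal closed_Times) auto
  have K: "compact ?K" using a b by (intro compact_Times) (auto simp: test_fun_real_def)
  have "compact (closure {p. (case p of (x, y) \<Rightarrow> \<alpha> x * \<beta> y) \<noteq> 0})"
    using bounded_subset[OF _ sub] K by (simp add: compact_eq_bounded_closed)
  moreover have "smooth_on UNIV (\<lambda>(x, y). \<alpha> x * \<beta> y)"
    unfolding smooth_on_iff_jet2
    using is_jet2_tensor[of "\<lambda>n. (deriv ^^ n) \<alpha>" "\<lambda>n. (deriv ^^ n) \<beta>" UNIV] a b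
    by (auto simp: test_fun_real_def intro!: is_jet1_smooth_real exI[of _ "\<lambda>j k (x, y). (deriv ^^ j) \<alpha> x * (deriv ^^ k) \<beta> y"])
  moreover have "?K \<subseteq> A \<times> B" using a b by (auto simp: test_fun_real_def)
  ultimately show ?thesis using sub unfolding test_fun_def by blast
qed

lemma test_funE:
  assumes "test_fun U \<phi>"
  obtains D where "is_jet2 UNIV D" "D 0 0 = \<phi>"
    "(\<lambda>(x, y). deriv (\<lambda>s. \<phi> (s, y)) x) = D 1 0" "(\<lambda>(x, y). deriv (\<lambda>s. \<phi> (x, s)) y) = D 0 1"
proof -
  obtain D where D: "is_jet2 UNIV D" "D 0 0 = \<phi>"
    using assms by (auto simp: test_fun_def smooth_on_iff_jet2 fun_eq_iff)
  show ?thesis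
  proof (rule that[OF D])
    show "(\<lambda>(x, y). deriv (\<lambda>s. \<phi> (s, y)) x) = D 1 0"
      using is_jet2_dx[OF D(1), of _ _ 0 0] D(2) by (auto simp: fun_eq_iff intro!: DERIV_imp_deriv)
    show "(\<lambda>(x, y). deriv (\<lambda>s. \<phi> (x, s)) y) = D 0 1"
      using is_jet2_dy[OF D(1), of _ _ 0 0] D(2) by (auto simp: fun_eq_iff intro!: DERIV_imp_deriv)
  qed
qed

lemma test_fun_support_subset:
  assumes "test_fun U \<phi>" "smooth_on UNIV \<psi>" "\<And>p. \<psi> p \<noteq> 0 \<Longrightarrow> p \<in> closure {p. \<phi> p \<noteq> 0}"
  shows "test_fun U \<psi>"
proof -
  have sub: "closure {p. \<psi> p \<noteq> 0} \<subseteq> closure {p. \<phi> p \<noteq> 0}"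
    by (rule closure_support_subset[OF assms(3)])
  then show ?thesis
    using assms(1,2) bounded_subset[OF _ sub] unfolding test_fun_def compact_eq_bounded_closed by blast
qed

lemma test_fun_deriv:
  assumes "test_fun U \<phi>"
  shows "test_fun U (\<lambda>(x, y). deriv (\<lambda>s. \<phi> (s, y)) x)" "test_fun U (\<lambda>(x, y). deriv (\<lambda>s. \<phi> (x, s)) y)"
proof -
  obtain D where D: "is_jet2 UNIV D" "D 0 0 = \<phi>"
    "(\<lambda>(x, y). deriv (\<lambda>s. \<phi> (s, y)) x) = D 1 0" "(\<lambda>(x, y). deriv (\<lambda>s. \<phi> (x, s)) y) = D 0 1"
    using test_funE[OF assms] .
  have supp: "p \<in> closure {p. \<phi> p \<noteq> 0}" if "D j k p \<noteq> 0" for j k p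
  proof (rule ccontr)
    assume n: "p \<notin> closure {p. \<phi> p \<noteq> 0}"
    have "\<phi> p = 0" using n closure_subset[of "{p. \<phi> p \<noteq> 0}"] by blast
    moreover have "j = 0 \<Longrightarrow> k = 0 \<Longrightarrow> \<phi> p \<noteq> 0" using that D(2) by simp
    ultimately have "j + k > 0" by (metis add_gr_0 gr0I)
    moreover have "D 0 0 q = 0" if "q \<in> - closure {p. \<phi> p \<noteq> 0}" for q
      using that closure_subset[of "{p. \<phi> p \<noteq> 0}"] D(2) by blast
    ultimately have "D j k p = 0"
      using is_jet2_const_zero[OF D(1) _ _ _ _, of "- closure {p. \<phi> p \<noteq> 0}" 0 j k p] n by auto
    then show False using that by simp
  qed
  have "smooth_on UNIV (D 1 0)" "smooth_on UNIV (D 0 1)"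
    unfolding smooth_on_iff_jet2 using is_jet2_shift[OF D(1), of 1 0] is_jet2_shift[OF D(1), of 0 1] by auto
  then show "test_fun U (\<lambda>(x, y). deriv (\<lambda>s. \<phi> (s, y)) x)" "test_fun U (\<lambda>(x, y). deriv (\<lambda>s. \<phi> (x, s)) y)"
    unfolding D(3,4) using test_fun_support_subset[OF assms] supp by blast+
qed

lemma test_fun_mult_snd:
  assumes "test_fun U \<phi>"
  shows "test_fun U (\<lambda>p. snd p * \<phi> p)"
proof (rule test_fun_support_subset[OF assms])
  obtain D where D: "is_jet2 UNIV D" "D 0 0 = \<phi>" using test_funE[OF assms] by metis
  then show "smooth_on UNIV (\<lambda>p. snd p * \<phi> p)"
    unfolding smooth_on_iff_jet2 using is_jet2_mult_snd[OF D(1)] by metis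
qed (use closure_subset in force)

section \<open>Integration over the plane\<close>

lemma integrable_tensor:
  fixes f g :: "real \<Rightarrow> real"
  assumes f: "integrable lborel f" and g: "integrable lborel g"
  shows "integrable lborel (\<lambda>p. f (fst p) * g (snd p))"
proof -
  have [measurable]: "f \<in> borel_measurable borel" "g \<in> borel_measurable borel"
    using f g by auto
  have "integrable (lborel \<Otimes>\<^sub>M lborel) (\<lambda>p. f (fst p) * g (snd p))"
  proof (rule lborel_pair.Fubini_integrable)
    show "integrable lborel (\<lambda>x. LINT y|lborel. norm (f (fst (x, y)) * g (snd (x, y))))"
      using f by (simp add: abs_mult)
    show "AE x in lborel. integrable lborel (\<lambda>y. f (fst (x, y)) * g (snd (x, y)))"
      using g by simp
  qed measurable
  then show ?thesis by (simp add: lborel_prod)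
qed

lemma lborel_fubini_fst:
  fixes F :: "real \<times> real \<Rightarrow> real"
  assumes "integrable lborel F"
  shows "AE x in lborel. integrable lborel (\<lambda>y. F (x, y))"
    and "integrable lborel (\<lambda>x. LINT y|lborel. F (x, y))"
    and "(LINT p|lborel. F p) = (LINT x|lborel. LINT y|lborel. F (x, y))"
  using lborel_pair.AE_integrable_fst'[of F] lborel_pair.integrable_fst'[of F] lborel_pair.integral_fst'[of F] assms
  by (simp_all add: lborel_prod)

lemma lborel_fubini_snd:
  fixes F :: "real \<times> real \<Rightarrow> real"
  assumes "integrable lborel F"
  shows "AE y in lborel. integrable lborel (\<lambda>x. F (x, y))"
    and "integrable lborel (\<lambda>y. LINT x|lborel. F (x, y))"
    and "(LINT p|lborel. F p) = (LINT y|lborel. LINT x|lborel. F (x, y))"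
  using lborel_pair.AE_integrable_snd[of "curry F"] lborel_pair.integrable_snd[of "curry F"]
    lborel_pair.integral_snd[of "curry F"] assms
  by (simp_all add: lborel_prod)

lemma lborel_swap:
  fixes F :: "real \<times> real \<Rightarrow> real"
  shows "integrable lborel F \<Longrightarrow> integrable lborel (\<lambda>p. F (prod.swap p))"
    and "integrable lborel F \<Longrightarrow> (LINT p|lborel. F (prod.swap p)) = (LINT p|lborel. F p)"
  using lborel_pair.integrable_product_swap[of F] lborel_pair.integral_product_swap[of F]
  by (simp_all add: lborel_prod prod.swap_def case_prod_unfold)

lemma AE_lborel_fst:
  "AE p in (lborel :: (real \<times> real) measure). Q p \<Longrightarrow> AE x in lborel. AE y in lborel. Q (x, y)"
  using lborel_pair.AE_pair[of Q] unfolding lborel_prod .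

lemma AE_lborel_swap:
  assumes "AE p in (lborel :: (real \<times> real) measure). Q p"
  shows "AE p in lborel. Q (prod.swap p)"
proof -
  have "distr lborel lborel (\<lambda>(x, y). (y, x)) = (lborel :: (real \<times> real) measure)"
    using lborel_pair.distr_pair_swap[symmetric] unfolding lborel_prod .
  moreover have "(\<lambda>(x, y). (y, x)) \<in> lborel \<rightarrow>\<^sub>M (lborel :: (real \<times> real) measure)"
    using measurable_pair_swap'[of "lborel :: real measure" "lborel :: real measure"] by (simp add: lborel_prod)
  ultimately have "AE p in lborel. Q ((\<lambda>(x, y). (y, x)) p)"
    using assms by (metis AE_distrD)
  then show ?thesis by (simp add: prod.swap_def split_beta)
qed

lemma AE_lborel_snd:
  "AE p in (lborel :: (real \<times> real) measure). Q p \<Longrightarrow> AE y in lborel. AE x in lborel. Q (x, y)"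
  using AE_lborel_fst[OF AE_lborel_swap, of Q] by simp

lemma AE_lborel_pairI:
  assumes [measurable]: "Measurable.pred borel Q" and "AE x in lborel. AE y in lborel. Q (x :: real, y :: real)"
  shows "AE p in lborel. Q p"
proof -
  have "{p \<in> space lborel. Q p} \<in> sets lborel" using assms(1) by simp
  then show ?thesis
    using lborel_pair.AE_pair_measure[of Q] assms(2) unfolding lborel_prod by blast
qed

lemma borel_measurable_curry:
  fixes F :: "real \<times> real \<Rightarrow> real"
  assumes F: "F \<in> borel_measurable borel"
  shows "(\<lambda>y. F (x, y)) \<in> borel_measurable borel" "(\<lambda>x. F (x, y)) \<in> borel_measurable borel"
proof -
  have [measurable]: "F \<in> borel_measurable (borel \<Otimes>\<^sub>M borel)" using F by (simp add: borel_prod)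
  show "(\<lambda>y. F (x, y)) \<in> borel_measurable borel" "(\<lambda>x. F (x, y)) \<in> borel_measurable borel"
    by measurable
qed

section \<open>Testing against tensor products\<close>

text \<open>The Borel sets over which \<open>F\<close> integrates to zero form a Dynkin system, and
  the open boxes generate the Borel sets and are stable under intersection. The vanishing total
  integral is what admits complements.\<close>

lemma AE_zero_of_boxes:
  fixes F :: "real \<times> real \<Rightarrow> real"
  assumes F: "integrable lborel F" and boxes: "\<And>a b. (LINT p|lborel. indicator (box a b) p * F p) = 0"
    and all: "(LINT p|lborel. F p) = 0"
  shows "AE p in lborel. F p = 0"
proof -
  have set0: "(LINT p:A|lborel. F p) = 0" if "A \<in> sets borel" for A
  proof -
    have ibl: "set_integrable lborel B F" if "B \<in> sets borel" for B
      using F that integrable_mult_indicator[of B lborel F] by (simp add: set_integrable_def)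
    have eq: "sets (borel :: (real \<times> real) measure) = sigma_sets UNIV (range (\<lambda>(a, b). box a b))"
      by (subst borel_eq_box) simp
    have "Int_stable (range (\<lambda>(a, b). box a b :: (real \<times> real) set))"
      by (auto simp: Int_stable_def box_Int_box)
    moreover have "range (\<lambda>(a, b). box a b) \<subseteq> Pow (UNIV :: (real \<times> real) set)" by auto
    ultimately show ?thesis using that[unfolded eq]
    proof (induction rule: sigma_sets_induct_disjoint)
      case (basic A)
      then show ?case using boxes by (auto simp: set_lebesgue_integral_def)
    next
      case empty
      then show ?case by (simp add: set_lebesgue_integral_def)
    next
      case (compl A)
      then have A: "A \<in> sets borel" using eq by simp
      have "(LINT p:UNIV - A|lborel. F p) = (LINT p|lborel. F p - indicator A p * F p)"
        unfolding set_lebesgue_integral_def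
        by (intro Bochner_Integration.integral_cong) (auto simp: indicator_def)
      also have "\<dots> = (LINT p|lborel. F p) - (LINT p:A|lborel. F p)"
        using F ibl[OF A] by (simp add: set_lebesgue_integral_def set_integrable_def)
      finally show ?case using compl all by simp
    next
      case (union A)
      have A: "A i \<in> sets borel" for i using union(2) eq by auto
      have "(LINT p:(\<Union>i. A i)|lborel. F p) = (\<Sum>i. (LINT p:(A i)|lborel. F p))"
        using union(1) A by (intro lebesgue_integral_countable_add ibl) (auto simp: disjoint_family_on_def)
      then show ?case using union by simp
    qed
  qed
  have "AE p in lborel. F p = (\<lambda>_. 0) p"
    by (rule density_unique_real[OF F]) (use set0 in \<open>simp_all add: set_lebesgue_integral_def\<close>)
  then show ?thesis by simp
qed

lemma bump_measurable [measurable]: "bump n a b \<in> borel_measurable borel"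
  by (intro borel_measurable_continuous_onI smooth_real_continuous smooth_real_bump)

text \<open>Indicators of rectangles are bounded limits of products of bumps, so orthogonality to
  tensor products alone makes the integral over every subrectangle vanish.\<close>

lemma tensor_AE_zero:
  fixes F :: "real \<times> real \<Rightarrow> real" and a b c d :: real
  assumes F: "integrable lborel F"
    and orth: "\<And>\<alpha> \<beta>. test_fun_real {a<..<b} \<alpha> \<Longrightarrow> test_fun_real {c<..<d} \<beta> \<Longrightarrow>
      (LINT p|lborel. F p * (\<alpha> (fst p) * \<beta> (snd p))) = 0"
  shows "AE p in lborel. p \<in> {a<..<b} \<times> {c<..<d} \<longrightarrow> F p = 0"
proof -
  define R where "R = {a<..<b} \<times> {c<..<d}"
  define G where "G p = indicator R p * F p" for p
  have Rb: "R \<in> sets borel" unfolding R_def by (intro borel_open open_Times) auto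
  have G: "integrable lborel G"
    using integrable_mult_indicator[of R lborel F] Rb F by (simp add: G_def[abs_def])
  have sub: "(LINT p|lborel. indicator ({a'<..<b'} \<times> {c'<..<d'}) p * F p) = 0"
    if "{a'<..<b'} \<subseteq> {a<..<b}" "{c'<..<d'} \<subseteq> {c<..<d}" for a' b' c' d'
  proof -
    have "(\<lambda>n. LINT p|lborel. F p * (bump n a' b' (fst p) * bump n c' d' (snd p)))
       \<longlonglongrightarrow> (LINT p|lborel. F p * (indicator {a'<..<b'} (fst p) * indicator {c'<..<d'} (snd p)))"
    proof (rule integral_dominated_convergence[where w="\<lambda>p. norm (F p)"])
      have [measurable]: "F \<in> borel_measurable (borel \<Otimes>\<^sub>M borel)" using F by (simp add: borel_prod)
      have "(\<lambda>p. F p * (indicator {a'<..<b'} (fst p) * indicator {c'<..<d'} (snd p))) \<in> borel_measurable (borel \<Otimes>\<^sub>M borel)"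
         "(\<lambda>p. F p * (bump n a' b' (fst p) * bump n c' d' (snd p))) \<in> borel_measurable (borel \<Otimes>\<^sub>M borel)" for n
        by measurable
      then show "(\<lambda>p. F p * (indicator {a'<..<b'} (fst p) * indicator {c'<..<d'} (snd p))) \<in> borel_measurable lborel"
         "(\<lambda>p. F p * (bump n a' b' (fst p) * bump n c' d' (snd p))) \<in> borel_measurable lborel" for n
        by (simp_all add: borel_prod)
      show "AE p in lborel. norm (F p * (bump n a' b' (fst p) * bump n c' d' (snd p))) \<le> norm (F p)" for n
        using bump_bounds by (intro AE_I2) (auto simp: abs_mult intro!: mult_left_le mult_le_one)
    qed (use F in \<open>auto intro!: tendsto_intros bump_tendsto\<close>)
    moreover have "(LINT p|lborel. F p * (bump n a' b' (fst p) * bump n c' d' (snd p))) = 0" for n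
      by (intro orth test_fun_real_bump that)
    ultimately have "(LINT p|lborel. F p * (indicator {a'<..<b'} (fst p) * indicator {c'<..<d'} (snd p))) = 0"
      by (simp add: LIMSEQ_const_iff)
    then show ?thesis
      by (rule trans[rotated]) (intro Bochner_Integration.integral_cong, auto simp: indicator_def split: if_splits)
  qed
  have "AE p in lborel. G p = 0"
  proof (rule AE_zero_of_boxes[OF G])
    fix p q :: "real \<times> real"
    have "indicator (box p q) r * G r
      = indicator ({max (fst p) a<..<min (fst q) b} \<times> {max (snd p) c<..<min (snd q) d}) r * F r" for r
      by (cases p; cases q; cases r) (auto simp: G_def R_def indicator_def box_prod box_real)
    then show "(LINT r|lborel. indicator (box p q) r * G r) = 0"
      by (simp only:) (intro sub; auto)
    show "(LINT r|lborel. G r) = 0"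
      unfolding G_def R_def by (intro sub) auto
  qed
  then show ?thesis by (rule AE_mp) (auto simp: G_def R_def indicator_def)
qed

section \<open>Primitives of integrable functions\<close>

text \<open>Integrating from minus infinity avoids carrying a left end point; the functions it is
  applied to later vanish outside a rectangle or an interval.\<close>

definition prim :: "(real \<Rightarrow> real) \<Rightarrow> real \<Rightarrow> real" where
  "prim f x = (LINT s|lborel. f s * indicator {..x} s)"

lemma integrable_cutoff_left:
  fixes f :: "real \<Rightarrow> real"
  shows "integrable lborel f \<Longrightarrow> integrable lborel (\<lambda>s. f s * indicator {..x} s)"
  using integrable_mult_indicator[of "{..x}" lborel f] by (simp add: mult.commute)

lemma prim_bound:
  assumes "integrable lborel f" shows "\<bar>prim f x\<bar> \<le> (LINT s|lborel. \<bar>f s\<bar>)"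
proof -
  have "\<bar>prim f x\<bar> \<le> (LINT s|lborel. \<bar>f s * indicator {..x} s\<bar>)"
    unfolding prim_def by (rule integral_abs_bound)
  also have "\<dots> \<le> (LINT s|lborel. \<bar>f s\<bar>)"
    using assms integrable_cutoff_left[OF assms] by (intro integral_mono) (auto simp: indicator_def)
  finally show ?thesis .
qed

lemma borel_measurable_prim2:
  fixes F :: "real \<times> real \<Rightarrow> real"
  assumes F: "F \<in> borel_measurable borel"
  shows "(\<lambda>p. prim (\<lambda>s. F (s, snd p)) (fst p)) \<in> borel_measurable borel"
proof -
  have [measurable]: "F \<in> borel_measurable (borel \<Otimes>\<^sub>M borel)" using F by (simp add: borel_prod)
  have "(\<lambda>p. LINT s|lborel. F (s, snd p) * (if s \<le> fst p then 1 else 0)) \<in> borel_measurable (borel \<Otimes>\<^sub>M borel)"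
    by measurable
  then show ?thesis by (simp add: prim_def indicator_def of_bool_def borel_prod)
qed

lemma borel_measurable_prim:
  assumes f: "f \<in> borel_measurable borel"
  shows "prim f \<in> borel_measurable borel"
proof -
  note [measurable] = f
  have "(\<lambda>p :: real \<times> real. f (fst p)) \<in> borel_measurable (borel \<Otimes>\<^sub>M borel)" by measurable
  then have "(\<lambda>p. f (fst p)) \<in> borel_measurable (borel :: (real \<times> real) measure)" by (simp add: borel_prod)
  from borel_measurable_curry(2)[OF borel_measurable_prim2[OF this]] show ?thesis by simp
qed

lemma integrable_mult_prim:
  assumes f: "integrable lborel f" and g: "integrable lborel g"
  shows "integrable lborel (\<lambda>x. f x * prim g x)"
proof (rule Bochner_Integration.integrable_bound)
  show "integrable lborel (\<lambda>x. (LINT s|lborel. \<bar>g s\<bar>) * f x)" using f by simp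
  show "(\<lambda>x. f x * prim g x) \<in> borel_measurable lborel"
    using f borel_measurable_prim[of g] g by simp
  have "\<bar>f x\<bar> * \<bar>prim g x\<bar> \<le> \<bar>f x\<bar> * (LINT s|lborel. \<bar>g s\<bar>)" for x
    by (intro mult_left_mono prim_bound g) auto
  then show "AE x in lborel. norm (f x * prim g x) \<le> norm ((LINT s|lborel. \<bar>g s\<bar>) * f x)"
    by (auto simp: abs_mult mult.commute)
qed

text \<open>Integration by parts without derivatives: the two terms integrate f(x) g(y) over the
  half planes below and above the diagonal, and the diagonal is a null set.\<close>

lemma prim_parts:
  assumes f: "integrable lborel f" and g: "integrable lborel g"
  shows "(LINT x|lborel. f x * prim g x) + (LINT x|lborel. g x * prim f x)
       = (LINT x|lborel. f x) * (LINT x|lborel. g x)"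
proof -
  define K where "K p = f (fst p) * g (snd p)" for p :: "real \<times> real"
  have K: "integrable lborel K" unfolding K_def by (rule integrable_tensor[OF f g])
  have m: "{p. snd p \<le> fst p} \<in> sets (borel :: (real \<times> real) measure)"
     "{p. fst p \<le> snd p} \<in> sets (borel :: (real \<times> real) measure)"
    by (auto intro!: borel_closed closed_Collect_le continuous_intros)
  have K1: "integrable lborel (\<lambda>p. indicator {p. snd p \<le> fst p} p * K p)"
    and K2: "integrable lborel (\<lambda>p. indicator {p. fst p \<le> snd p} p * K p)"
    using integrable_mult_indicator[OF _ K] m by auto
  have 1: "(LINT x|lborel. f x * prim g x) = (LINT p|lborel. indicator {p. snd p \<le> fst p} p * K p)"
    unfolding lborel_fubini_fst(3)[OF K1] prim_def integral_mult_right_zero[symmetric]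
    by (intro Bochner_Integration.integral_cong refl) (auto simp: K_def indicator_def)
  have 2: "(LINT x|lborel. g x * prim f x) = (LINT p|lborel. indicator {p. fst p \<le> snd p} p * K p)"
    unfolding lborel_fubini_snd(3)[OF K2] prim_def integral_mult_right_zero[symmetric]
    by (intro Bochner_Integration.integral_cong refl) (auto simp: K_def indicator_def)
  have "AE p in lborel. fst p \<noteq> (snd p :: real)"
  proof (rule AE_lborel_pairI)
    have "open {p :: real \<times> real. fst p \<noteq> snd p}" by (intro open_Collect_neq continuous_intros)
    then show "Measurable.pred borel (\<lambda>p :: real \<times> real. fst p \<noteq> snd p)"
      by (simp add: pred_def)
    have "AE y in lborel. x \<noteq> y" for x :: real
      using AE_lborel_singleton[of x] by (rule AE_mp) auto
    then show "AE x in lborel. AE y in lborel. fst (x, y) \<noteq> (snd (x, y) :: real)" by simp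
  qed
  then have "(LINT p|lborel. indicator {p. snd p \<le> fst p} p * K p + indicator {p. fst p \<le> snd p} p * K p)
      = (LINT p|lborel. K p)"
    using K1 K2 K by (intro integral_cong_AE) (auto simp: indicator_def)
  also have "(LINT p|lborel. K p) = (LINT x|lborel. f x) * (LINT x|lborel. g x)"
    unfolding lborel_fubini_fst(3)[OF K] by (simp add: K_def)
  finally show ?thesis unfolding 1 2 using K1 K2 by simp
qed

lemma prim_square:
  assumes f: "integrable lborel f"
  shows "(LINT x|lborel. f x * prim f x) = (LINT x|lborel. f x)\<^sup>2 / 2"
  using prim_parts[OF f f] by (simp add: power2_eq_square)

lemma prim_tendsto_left_end:
  assumes f: "integrable lborel f" and 0: "\<And>x. x \<le> a \<Longrightarrow> f x = 0"
  shows "(prim f \<longlongrightarrow> 0) (at_right a)"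
proof (rule tendsto_at_right_sequentially[of a "a + 1"])
  fix S :: "nat \<Rightarrow> real" assume S: "S \<longlonglongrightarrow> a"
  have "(\<lambda>n. LINT s|lborel. f s * indicator {..S n} s) \<longlonglongrightarrow> (LINT s|(lborel :: real measure). (0 :: real))"
  proof (rule integral_dominated_convergence[where w="\<lambda>s. norm (f s)"])
    show "AE s in lborel. (\<lambda>n. f s * indicator {..S n} s) \<longlonglongrightarrow> 0"
    proof (intro AE_I2)
      fix s show "(\<lambda>n. f s * indicator {..S n} s) \<longlonglongrightarrow> 0"
      proof (cases "s \<le> a")
        case False
        then have "\<forall>\<^sub>F n in sequentially. S n < s" using S order_tendstoD(2) by force
        then show ?thesis
          by (intro tendsto_eventually) (erule eventually_mono, simp add: indicator_def)
      qed (simp add: 0)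
    qed
  qed (use f in \<open>auto simp: indicator_def\<close>)
  then show "(\<lambda>n. prim f (S n)) \<longlonglongrightarrow> 0" by (simp add: prim_def)
qed simp

lemma prim_tendsto_right_end:
  assumes f: "integrable lborel f" and 0: "\<And>x. b \<le> x \<Longrightarrow> f x = 0"
  shows "(prim f \<longlongrightarrow> (LINT x|lborel. f x)) (at_left b)"
proof (rule tendsto_at_left_sequentially[of "b - 1"])
  fix S :: "nat \<Rightarrow> real" assume S: "S \<longlonglongrightarrow> b"
  have "(\<lambda>n. LINT s|lborel. f s * indicator {..S n} s) \<longlonglongrightarrow> (LINT s|lborel. f s)"
  proof (rule integral_dominated_convergence[where w="\<lambda>s. norm (f s)"])
    show "AE s in lborel. (\<lambda>n. f s * indicator {..S n} s) \<longlonglongrightarrow> f s"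
    proof (intro AE_I2)
      fix s show "(\<lambda>n. f s * indicator {..S n} s) \<longlonglongrightarrow> f s"
      proof (cases "b \<le> s")
        case False
        then have "\<forall>\<^sub>F n in sequentially. s < S n" using S order_tendstoD(1) by force
        then show ?thesis
          by (intro tendsto_eventually) (erule eventually_mono, simp add: indicator_def)
      qed (simp add: 0)
    qed
  qed (use f in \<open>auto simp: indicator_def\<close>)
  then show "(\<lambda>n. prim f (S n)) \<longlonglongrightarrow> (LINT x|lborel. f x)" by (simp add: prim_def)
qed simp

lemma prim_eq_diff:
  fixes F f :: "real \<Rightarrow> real"
  assumes F: "\<And>x. (F has_real_derivative f x) (at x)" and f: "continuous_on UNIV f"
    and 0: "\<And>x. x \<le> a \<Longrightarrow> f x = 0" and "a \<le> x"
  shows "prim f x = F x - F a"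
proof -
  have "prim f x = (LINT s|lborel. f s * indicator {a..x} s)"
    unfolding prim_def by (intro Bochner_Integration.integral_cong) (auto simp: indicator_def 0)
  also have "\<dots> = F x - F a"
    using assms by (intro integral_FTC_Icc_real) (auto simp: continuous_on_eq_continuous_at)
  finally show ?thesis .
qed

lemma has_real_derivative_prim:
  fixes f :: "real \<Rightarrow> real"
  assumes f: "continuous_on UNIV f" and 0: "\<And>x. x \<le> a \<Longrightarrow> f x = 0"
  shows "(prim f has_real_derivative f x) (at x)"
proof -
  obtain F where F: "\<And>x. (F has_real_derivative f x) (at x)"
  proof -
    have "\<exists>g. \<forall>x. (g has_vector_derivative f x) (at x)"
      using interval_integral_FTC2 einterval_antiderivative[of "-\<infinity>" \<infinity> f] f
      by (auto simp: continuous_on_eq_continuous_at)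
    then show ?thesis using that by (auto simp: has_real_derivative_iff_has_vector_derivative)
  qed
  define m where "m = min a (x - 1)"
  have ev: "\<forall>\<^sub>F s in nhds x. s \<in> {m<..}"
    by (rule eventually_nhds_in_open) (auto simp: m_def)
  have "\<forall>\<^sub>F s in nhds x. prim f s = F s - F m"
    using ev by (rule eventually_mono) (rule prim_eq_diff[OF F f], use 0 in \<open>auto simp: m_def\<close>)
  then show ?thesis
    by (subst DERIV_cong_ev[OF refl _ refl]) (auto intro!: derivative_eq_intros F)
qed

text \<open>If the limits differed, the functions would differ on a whole interval at the end point,
  a set of positive measure. This compares a trace, given through an arbitrary representative, with
  the limit of an explicit primitive; \<sigma> selects the end point.\<close>

lemma AE_one_sided_limit_unique:
  fixes f g :: "real \<Rightarrow> real" and \<sigma> :: real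
  assumes ae: "AE x in lborel. x \<in> {a<..<b} \<longrightarrow> f x = g x"
    and \<sigma>: "\<sigma> = 1 \<and> p = a \<or> \<sigma> = -1 \<and> p = b" and "a < b"
    and f: "((\<lambda>h. f (p + \<sigma> * h)) \<longlongrightarrow> l) (at_right 0)" and g: "((\<lambda>h. g (p + \<sigma> * h)) \<longlongrightarrow> m) (at_right 0)"
  shows "l = m"
proof (rule ccontr)
  assume "l \<noteq> m"
  have "((\<lambda>h. f (p + \<sigma> * h) - g (p + \<sigma> * h)) \<longlongrightarrow> l - m) (at_right 0)"
    by (intro tendsto_intros f g)
  then have "\<forall>\<^sub>F h in at_right 0. f (p + \<sigma> * h) - g (p + \<sigma> * h) \<noteq> 0"
    by (rule tendsto_imp_eventually_ne) (use \<open>l \<noteq> m\<close> in simp)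
  then obtain e where e: "e > 0" "\<And>h. 0 < h \<Longrightarrow> h < e \<Longrightarrow> f (p + \<sigma> * h) \<noteq> g (p + \<sigma> * h)"
    by (auto simp: eventually_at_right_field)
  define e' where "e' = min e (b - a)"
  define I where "I = (if p = a then {a<..<a + e'} else {b - e'<..<b})"
  have le: "e' \<le> e" "e' \<le> b - a" by (simp_all add: e'_def)
  have "e' > 0" using e \<open>a < b\<close> by (simp add: e'_def)
  have ne: "x \<in> {a<..<b} \<and> f x \<noteq> g x" if "x \<in> I" for x
    using that e(2)[of "\<sigma> * (x - p)"] \<sigma> le by (auto simp: I_def split: if_splits)
  have "AE x in lborel. x \<notin> I"
    using ae by (rule AE_mp) (use ne in auto)
  then have "emeasure lborel I = 0"
    by (subst (asm) AE_iff_measurable[OF _ refl]) (auto simp: I_def)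
  then show False using \<open>e' > 0\<close> by (auto simp: I_def split: if_splits)
qed

section \<open>Test functions of one variable and their primitives\<close>

lemma integrable_indicator_Ioo: "integrable lborel (indicator {a<..<b :: real} :: real \<Rightarrow> real)"
  using emeasure_bounded_finite[of "{a<..<b}"] by (intro integrable_real_indicator) simp_all

lemma integrable_mult_bounded:
  fixes F w :: "'a \<Rightarrow> real"
  assumes F: "integrable M F" and w: "w \<in> borel_measurable M" and B: "\<And>p. \<bar>w p\<bar> \<le> B"
  shows "integrable M (\<lambda>p. F p * w p)"
proof (rule Bochner_Integration.integrable_bound)
  show "integrable M (\<lambda>p. B * F p)" using F by simp
  have "\<bar>F p\<bar> * \<bar>w p\<bar> \<le> \<bar>F p\<bar> * B" for p by (intro mult_left_mono B) auto
  then have "norm (F p * w p) \<le> norm (B * F p)" for p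
    using B[of p] by (auto simp: abs_mult mult.commute)
  then show "AE p in M. norm (F p * w p) \<le> norm (B * F p)" by simp
qed (use F w in measurable)

lemma test_fun_real_support_interval:
  fixes a b :: real
  assumes "test_fun_real {a<..<b} \<psi>" "a < b"
  obtains a' b' where "a < a'" "b' < b" "\<And>x. x \<notin> {a'..b'} \<Longrightarrow> \<psi> x = 0"
proof -
  define K where "K = closure {s. \<psi> s \<noteq> 0}"
  have K: "compact K" "K \<subseteq> {a<..<b}" "\<And>x. x \<notin> K \<Longrightarrow> \<psi> x = 0"
    using assms(1) closure_subset[of "{s. \<psi> s \<noteq> 0}"] by (auto simp: test_fun_real_def K_def)
  show ?thesis
  proof (cases "K = {}")
    case True
    then show ?thesis using that[of b a] K \<open>a < b\<close> by auto
  next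
    case False
    obtain u where u: "u \<in> K" "\<And>x. x \<in> K \<Longrightarrow> u \<le> x" using compact_attains_inf[OF K(1) False] by auto
    obtain v where v: "v \<in> K" "\<And>x. x \<in> K \<Longrightarrow> x \<le> v" using compact_attains_sup[OF K(1) False] by auto
    show ?thesis using that[of u v] K u v by (meson atLeastAtMost_iff greaterThanLessThan_iff subsetD)
  qed
qed

lemma test_fun_real_outside: "test_fun_real I \<psi> \<Longrightarrow> x \<notin> I \<Longrightarrow> \<psi> x = 0"
  using closure_subset[of "{s. \<psi> s \<noteq> 0}"] by (auto simp: test_fun_real_def)

lemma test_fun_real_smooth: "test_fun_real I \<psi> \<Longrightarrow> smooth_real \<psi>"
  by (auto simp: test_fun_real_def)

lemma test_fun_real_measurable: "test_fun_real I \<psi> \<Longrightarrow> \<psi> \<in> borel_measurable borel"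
  by (intro borel_measurable_continuous_onI smooth_real_continuous test_fun_real_smooth)

lemma test_fun_real_bounded:
  assumes "test_fun_real I \<psi>"
  obtains B where "\<And>x. \<bar>\<psi> x\<bar> \<le> B"
proof -
  have "compact (\<psi> ` closure {s. \<psi> s \<noteq> 0})"
    using assms by (intro compact_continuous_image smooth_real_continuous) (auto simp: test_fun_real_def)
  then obtain B where "\<forall>z\<in>\<psi> ` closure {s. \<psi> s \<noteq> 0}. norm z \<le> B"
    using compact_imp_bounded bounded_iff by blast
  then have B: "\<bar>\<psi> x\<bar> \<le> B" if "x \<in> closure {s. \<psi> s \<noteq> 0}" for x using that by auto
  have "\<bar>\<psi> x\<bar> \<le> max B 0" for x
  proof (cases "\<psi> x = 0")
    case False
    then have "x \<in> closure {s. \<psi> s \<noteq> 0}" using closure_subset[of "{s. \<psi> s \<noteq> 0}"] by blast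
    then show ?thesis using B by fastforce
  qed simp
  then show ?thesis by (rule that)
qed

lemma test_fun_real_integrable:
  fixes a b :: real
  assumes "test_fun_real {a<..<b} \<psi>"
  shows "integrable lborel \<psi>"
proof -
  obtain B where B: "\<And>x. \<bar>\<psi> x\<bar> \<le> B" by (rule test_fun_real_bounded[OF assms]) blast
  have "integrable lborel (\<lambda>x. indicator {a<..<b} x * \<psi> x)"
    by (rule integrable_mult_bounded[OF integrable_indicator_Ioo _ B]) (use test_fun_real_measurable[OF assms] in auto)
  moreover have "(\<lambda>x. indicator {a<..<b} x * \<psi> x) = \<psi>"
    using test_fun_real_outside[OF assms] by (auto simp: fun_eq_iff indicator_def)
  ultimately show ?thesis by simp
qed

lemma prim_deriv_test_fun:
  fixes a b :: real
  assumes t: "test_fun_real {a<..<b} \<psi>"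
  shows "prim (deriv \<psi>) x = \<psi> x" "(LINT x|lborel. deriv \<psi> x) = 0"
proof -
  have 0: "deriv \<psi> x = 0" if "x \<notin> {a<..<b}" for x
    using test_fun_real_outside[OF test_fun_real_deriv[OF t] that] .
  have *: "prim (deriv \<psi>) x = \<psi> x" for x
  proof -
    have "prim (deriv \<psi>) x = \<psi> x - \<psi> (min a x)"
      using smooth_real_deriv[OF test_fun_real_smooth[OF t]]
      by (intro prim_eq_diff smooth_real_has_deriv smooth_real_continuous test_fun_real_smooth[OF t]) (auto simp: 0)
    moreover have "\<psi> (min a x) = 0" by (rule test_fun_real_outside[OF t]) auto
    ultimately show ?thesis by simp
  qed
  then show "prim (deriv \<psi>) x = \<psi> x" .
  have "(LINT x|lborel. deriv \<psi> x) = prim (deriv \<psi>) b"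
    unfolding prim_def by (intro Bochner_Integration.integral_cong) (auto simp: indicator_def 0)
  also have "\<dots> = 0" using * test_fun_real_outside[OF t, of b] by simp
  finally show "(LINT x|lborel. deriv \<psi> x) = 0" .
qed

text \<open>To the right of the support the primitive is constant and equal to the total integral,
  which is zero. Test functions of mean zero are thus exactly what the derivative of a test function
  can be.\<close>

lemma test_fun_real_prim:
  fixes a b :: real
  assumes t: "test_fun_real {a<..<b} \<psi>" and 0: "(LINT x|lborel. \<psi> x) = 0" and "a < b"
  shows "test_fun_real {a<..<b} (prim \<psi>)" "deriv (prim \<psi>) = \<psi>"
proof -
  obtain a' b' where ab: "a < a'" "b' < b" "\<And>x. x \<notin> {a'..b'} \<Longrightarrow> \<psi> x = 0"
    by (rule test_fun_real_support_interval[OF t \<open>a < b\<close>]) blast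
  have D: "(prim \<psi> has_real_derivative \<psi> x) (at x)" for x
    by (rule has_real_derivative_prim[OF smooth_real_continuous[OF test_fun_real_smooth[OF t]], of "min a a'"])
       (auto intro: test_fun_real_outside[OF t])
  then show "deriv (prim \<psi>) = \<psi>" by (auto intro!: DERIV_imp_deriv)
  have "is_jet1 (\<lambda>n. case n of 0 \<Rightarrow> prim \<psi> | Suc m \<Rightarrow> (deriv ^^ m) \<psi>)"
    using D is_jet1_smooth_real[OF test_fun_real_smooth[OF t]]
    unfolding is_jet1_def by (auto split: nat.split)
  from smooth_real_jet1[OF this] have "smooth_real (prim \<psi>)" by simp
  then show "test_fun_real {a<..<b} (prim \<psi>)"
  proof (rule test_fun_real_supportI)
    fix x assume x: "x \<notin> {a'..b'}"
    show "prim \<psi> x = 0"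
    proof (cases "x < a'")
      case True
      have "\<psi> s * indicator {..x} s = 0" for s using True ab(3)[of s] by (auto simp: indicator_def)
      then show ?thesis unfolding prim_def by (simp only:) simp
    next
      case False
      then have "b' < x" using x by auto
      then have "\<psi> s * indicator {..x} s = \<psi> s" for s using ab(3)[of s] by (auto simp: indicator_def)
      then show ?thesis unfolding prim_def using 0 by (simp only:)
    qed
  qed (use ab in auto)
qed

text \<open>The masses of the bumps converge to \<open>b - a\<close>, so some bump has nonzero mass
  and can be normalised.\<close>

lemma test_fun_real_unit_mass:
  fixes a b :: real
  assumes "a < b"
  obtains \<rho> where "test_fun_real {a<..<b} \<rho>" "(LINT x|lborel. \<rho> x) = 1"
proof -
  have "(\<lambda>n. LINT x|lborel. bump n a b x) \<longlonglongrightarrow> (LINT x|lborel. indicator {a<..<b} x)"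
  proof (rule integral_dominated_convergence[where w="indicator {a<..<b}"])
    have "norm (bump n a b x) \<le> indicator {a<..<b} x" for n x
      using bump_bounds[of n a b x] test_fun_real_outside[OF test_fun_real_bump[OF order_refl], of x a b n]
      by (auto simp: indicator_def)
    then show "AE x in lborel. norm (bump n a b x) \<le> indicator {a<..<b} x" for n by simp
  qed (auto intro: bump_tendsto integrable_indicator_Ioo)
  moreover have "(LINT x|lborel. indicator {a<..<b} x) = b - a" using assms by simp
  ultimately have "\<forall>\<^sub>F n in sequentially. (LINT x|lborel. bump n a b x) \<noteq> 0"
    using assms by (intro tendsto_imp_eventually_ne) auto
  then obtain n where n: "(LINT x|lborel. bump n a b x) \<noteq> 0" by (auto simp: eventually_sequentially)
  define c where "c = 1 / (LINT x|lborel. bump n a b x)"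
  have "test_fun_real {a<..<b} (\<lambda>x. c * bump n a b x)"
  proof (rule test_fun_real_supportI[OF smooth_real_cmult[OF smooth_real_bump]])
    show "c * bump n a b x = 0" if "x \<notin> {a + 1 / real (Suc n)..b - 1 / real (Suc n)}" for x
      using bump_eq_0[OF that] by simp
    show "{a + 1 / real (Suc n)..b - 1 / real (Suc n)} \<subseteq> {a<..<b}"
    proof
      fix x assume x: "x \<in> {a + 1 / real (Suc n)..b - 1 / real (Suc n)}"
      have "1 / real (Suc n) > 0" by simp
      then show "x \<in> {a<..<b}" using x unfolding atLeastAtMost_iff greaterThanLessThan_iff by linarith
    qed
  qed
  moreover have "(LINT x|lborel. c * bump n a b x) = 1" using n by (simp add: c_def)
  ultimately show ?thesis by (rule that)
qed

lemma test_fun_real_combine: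
  fixes a b :: real
  assumes "test_fun_real {a<..<b} f" "test_fun_real {a<..<b} g" "a < b"
  shows "test_fun_real {a<..<b} (\<lambda>x. f x - c * g x)"
proof -
  obtain a1 b1 where 1: "a < a1" "b1 < b" "\<And>x. x \<notin> {a1..b1} \<Longrightarrow> f x = 0"
    by (rule test_fun_real_support_interval[OF assms(1,3)]) blast
  obtain a2 b2 where 2: "a < a2" "b2 < b" "\<And>x. x \<notin> {a2..b2} \<Longrightarrow> g x = 0"
    by (rule test_fun_real_support_interval[OF assms(2,3)]) blast
  show ?thesis
  proof (rule test_fun_real_supportI)
    show "smooth_real (\<lambda>x. f x - c * g x)"
      by (intro smooth_real_diff smooth_real_cmult test_fun_real_smooth[OF assms(1)] test_fun_real_smooth[OF assms(2)])
    show "f x - c * g x = 0" if "x \<notin> {min a1 a2..max b1 b2}" for x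
    proof -
      have "x \<notin> {a1..b1}" "x \<notin> {a2..b2}" using that by auto
      then show ?thesis using 1(3) 2(3) by simp
    qed
  qed (use 1 2 in auto)
qed

lemma integrable_tensor_weight:
  fixes F :: "real \<times> real \<Rightarrow> real"
  assumes F: "integrable lborel F" and a: "test_fun_real A \<alpha>" and b: "test_fun_real B \<beta>"
  shows "integrable lborel (\<lambda>p. F p * (\<alpha> (fst p) * \<beta> (snd p)))"
proof -
  obtain K L where KL: "\<And>x. \<bar>\<alpha> x\<bar> \<le> K" "\<And>x. \<bar>\<beta> x\<bar> \<le> L"
    using test_fun_real_bounded[OF a] test_fun_real_bounded[OF b] by metis
  note [measurable] = test_fun_real_measurable[OF a] test_fun_real_measurable[OF b]
  have "(\<lambda>p. \<alpha> (fst p) * \<beta> (snd p)) \<in> borel_measurable (borel \<Otimes>\<^sub>M borel)" by measurable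
  moreover have "\<bar>\<alpha> x * \<beta> y\<bar> \<le> K * L" for x y
    unfolding abs_mult using KL by (intro mult_mono) (auto intro: order_trans[OF abs_ge_zero])
  ultimately show ?thesis
    by (intro integrable_mult_bounded[OF F, of _ "K * L"]) (auto simp: borel_prod)
qed

lemma AE_lborel_snd_lift:
  assumes "AE y in lborel. Q (y :: real)"
  shows "AE p in (lborel :: (real \<times> real) measure). Q (snd p)"
proof -
  obtain N where N: "N \<in> null_sets lborel" "{y. \<not> Q y} \<subseteq> N"
    using assms by (auto simp: eventually_ae_filter)
  have "AE p in (lborel :: (real \<times> real) measure). snd p \<notin> N"
  proof (rule AE_lborel_pairI)
    have [measurable]: "N \<in> sets borel" using N by auto
    have "Measurable.pred (borel \<Otimes>\<^sub>M borel) (\<lambda>p :: real \<times> real. snd p \<notin> N)" by measurable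
    then show "Measurable.pred borel (\<lambda>p :: real \<times> real. snd p \<notin> N)" by (simp add: borel_prod)
    show "AE x in lborel. AE y in lborel. snd (x :: real, y :: real) \<notin> N"
      using AE_not_in[OF N(1)] by simp
  qed
  then show ?thesis by (rule AE_mp) (use N in auto)
qed

section \<open>Primitives of weak derivatives\<close>

text \<open>The argument of du Bois-Reymond: the difference of E and the primitive of P is orthogonal
  to all functions with vanishing mean in x, so it does not depend on x.\<close>

lemma weak_dx_primitive:
  fixes E P :: "real \<times> real \<Rightarrow> real" and a b c d :: real
  defines "R \<equiv> {a<..<b} \<times> {c<..<d}"
  assumes "a < b" and E: "integrable lborel E" and P: "integrable lborel P"
    and orth: "\<And>\<alpha> \<beta>. test_fun_real {a<..<b} \<alpha> \<Longrightarrow> test_fun_real {c<..<d} \<beta> \<Longrightarrow>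
      (LINT p|lborel. E p * (deriv \<alpha> (fst p) * \<beta> (snd p))) = - (LINT p|lborel. P p * (\<alpha> (fst p) * \<beta> (snd p)))"
  obtains \<kappa> where "AE p in lborel. p \<in> R \<longrightarrow> E p = prim (\<lambda>s. P (s, snd p)) (fst p) + \<kappa> (snd p)"
proof -
  define A where "A p = prim (\<lambda>s. P (s, snd p)) (fst p)" for p
  have Rb[measurable]: "R \<in> sets borel" unfolding R_def by (intro borel_open open_Times) auto
  have [measurable]: "P \<in> borel_measurable borel" using P by simp
  have [measurable]: "A \<in> borel_measurable borel"
    unfolding A_def using borel_measurable_prim2[of P] by simp
  have RA: "integrable lborel (\<lambda>p. indicator R p * A p)"
  proof (rule Bochner_Integration.integrable_bound)
    \<comment> \<open>On almost every horizontal line the primitive is bounded by the L1 norm of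
      \<open>P\<close> on that line. This norm is integrable in y, and the cut-off in x makes the
      product integrable.\<close>
    show "integrable lborel (\<lambda>p :: real \<times> real. indicator {a<..<b} (fst p) * (LINT s|lborel. \<bar>P (s, snd p)\<bar>))"
      by (rule integrable_tensor[OF integrable_indicator_Ioo]) (use lborel_fubini_snd(2)[of "\<lambda>p. \<bar>P p\<bar>"] P in auto)
    show "AE p in lborel. norm (indicator R p * A p)
        \<le> norm (indicator {a<..<b} (fst p) * (LINT s|lborel. \<bar>P (s, snd p)\<bar>))"
      using AE_lborel_snd_lift[OF lborel_fubini_snd(1)[OF P]]
    proof eventually_elim
      case (elim p)
      have "\<bar>A p\<bar> \<le> (LINT s|lborel. \<bar>P (s, snd p)\<bar>)" unfolding A_def by (rule prim_bound[OF elim])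
      then show ?case by (auto simp: indicator_def R_def split: if_splits)
    qed
  qed measurable
  define H where "H p = indicator R p * E p - indicator R p * A p" for p
  have RE: "integrable lborel (\<lambda>p. indicator R p * E p)"
    using integrable_mult_indicator[of R lborel E] E by simp
  have H: "integrable lborel H" unfolding H_def using RE RA by simp
  have H0: "(LINT p|lborel. H p * (deriv \<alpha> (fst p) * \<beta> (snd p))) = 0"
    if a: "test_fun_real {a<..<b} \<alpha>" and b: "test_fun_real {c<..<d} \<beta>" for \<alpha> \<beta>
  proof -
    have a': "test_fun_real {a<..<b} (deriv \<alpha>)" by (rule test_fun_real_deriv[OF a])
    have out: "indicator R p * g * (deriv \<alpha> (fst p) * \<beta> (snd p)) = g * (deriv \<alpha> (fst p) * \<beta> (snd p))" for p g
      using test_fun_real_outside[OF a', of "fst p"] test_fun_real_outside[OF b, of "snd p"]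
      by (cases p) (auto simp: R_def indicator_def)
    have iA: "integrable lborel (\<lambda>p. A p * (deriv \<alpha> (fst p) * \<beta> (snd p)))"
      and iE: "integrable lborel (\<lambda>p. E p * (deriv \<alpha> (fst p) * \<beta> (snd p)))"
      using integrable_tensor_weight[OF RA a' b] integrable_tensor_weight[OF RE a' b] by (simp_all add: out)
    have iP: "integrable lborel (\<lambda>p. P p * (\<alpha> (fst p) * \<beta> (snd p)))"
      by (rule integrable_tensor_weight[OF P a b])
    have "(LINT p|lborel. A p * (deriv \<alpha> (fst p) * \<beta> (snd p)))
        = (LINT y|lborel. LINT x|lborel. A (x, y) * (deriv \<alpha> x * \<beta> y))"
      unfolding lborel_fubini_snd(3)[OF iA] by simp
    also have "\<dots> = (LINT y|lborel. LINT x|lborel. - (P (x, y) * (\<alpha> x * \<beta> y)))"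
    proof (rule integral_cong_AE)
      show "(\<lambda>y. LINT x|lborel. A (x, y) * (deriv \<alpha> x * \<beta> y)) \<in> borel_measurable lborel"
        using lborel_fubini_snd(2)[OF iA] by simp
      show "(\<lambda>y. LINT x|lborel. - (P (x, y) * (\<alpha> x * \<beta> y))) \<in> borel_measurable lborel"
        using lborel_fubini_snd(2)[OF iP] by simp
      show "AE y in lborel. (LINT x|lborel. A (x, y) * (deriv \<alpha> x * \<beta> y)) = (LINT x|lborel. - (P (x, y) * (\<alpha> x * \<beta> y)))"
        using lborel_fubini_snd(1)[OF P]
      proof eventually_elim
        case (elim y)
        have "(LINT x|lborel. A (x, y) * deriv \<alpha> x) = - (LINT x|lborel. P (x, y) * \<alpha> x)"
          using prim_parts[OF elim test_fun_real_integrable[OF a']] prim_deriv_test_fun[OF a]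
          by (simp add: A_def mult.commute)
        then show ?case
          by (simp flip: mult.assoc)
      qed
    qed
    also have "\<dots> = - (LINT p|lborel. P p * (\<alpha> (fst p) * \<beta> (snd p)))"
      unfolding lborel_fubini_snd(3)[OF iP] by simp
    finally show ?thesis
      using orth[OF a b] iA iE by (simp add: H_def left_diff_distrib out)
  qed
  obtain \<rho>0 where \<rho>0: "test_fun_real {a<..<b} \<rho>0" "(LINT x|lborel. \<rho>0 x) = 1"
    using test_fun_real_unit_mass[OF \<open>a < b\<close>] .
  \<comment> \<open>Once \<open>H\<close> is known to be independent of x, its value is recovered by
    averaging in x against a weight of mass 1.\<close>
  define \<kappa> where "\<kappa> y = (LINT x|lborel. H (x, y) * \<rho>0 x)" for y
  obtain B where B: "\<And>x. \<bar>\<rho>0 x\<bar> \<le> B" by (rule test_fun_real_bounded[OF \<rho>0(1)]) blast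
  have iH: "integrable lborel (\<lambda>p. H p * \<rho>0 (fst p))"
  proof (rule integrable_mult_bounded[OF H _ B])
    note [measurable] = test_fun_real_measurable[OF \<rho>0(1)]
    have "(\<lambda>p :: real \<times> real. \<rho>0 (fst p)) \<in> borel_measurable (borel \<Otimes>\<^sub>M borel)" by measurable
    then show "(\<lambda>p :: real \<times> real. \<rho>0 (fst p)) \<in> borel_measurable lborel" by (simp add: borel_prod)
  qed
  have \<kappa>: "integrable lborel \<kappa>"
    using lborel_fubini_snd(2)[OF iH] by (simp add: \<kappa>_def[abs_def])
  define F where "F p = H p - indicator {a<..<b} (fst p) * (indicator {c<..<d} (snd p) * \<kappa> (snd p))" for p
  have iK: "integrable lborel (\<lambda>p. indicator {a<..<b} (fst p) * (indicator {c<..<d} (snd p) * \<kappa> (snd p)))"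
    by (rule integrable_tensor[OF integrable_indicator_Ioo]) (use integrable_mult_indicator[OF _ \<kappa>] in auto)
  have F: "integrable lborel F" unfolding F_def using H iK by simp
  have "AE p in lborel. p \<in> {a<..<b} \<times> {c<..<d} \<longrightarrow> F p = 0"
  proof (rule tensor_AE_zero[OF F])
    fix \<rho> \<beta> assume r: "test_fun_real {a<..<b} \<rho>" and b: "test_fun_real {c<..<d} \<beta>"
    define m where "m = (LINT x|lborel. \<rho> x)"
    \<comment> \<open>Removing the mass with the fixed function \<open>\<rho>0\<close> leaves a test
      function of mean zero, hence the derivative of a test function, to which \<open>H\<close> is
      orthogonal.\<close>
    define \<tau> where "\<tau> x = \<rho> x - m * \<rho>0 x" for x
    have \<tau>: "test_fun_real {a<..<b} \<tau>"
      unfolding \<tau>_def by (rule test_fun_real_combine[OF r \<rho>0(1) \<open>a < b\<close>])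
    have "(LINT x|lborel. \<tau> x) = 0"
      unfolding \<tau>_def using test_fun_real_integrable[OF r] test_fun_real_integrable[OF \<rho>0(1)] \<rho>0(2)
      by (simp add: m_def)
    note \<alpha> = test_fun_real_prim[OF \<tau> this \<open>a < b\<close>]
    have "(LINT p|lborel. H p * (\<tau> (fst p) * \<beta> (snd p))) = 0"
      using H0[OF \<alpha>(1) b] unfolding \<alpha>(2) .
    moreover have "(LINT p|lborel. H p * (\<tau> (fst p) * \<beta> (snd p)))
        = (LINT p|lborel. H p * (\<rho> (fst p) * \<beta> (snd p))) - m * (LINT p|lborel. H p * (\<rho>0 (fst p) * \<beta> (snd p)))"
      using integrable_tensor_weight[OF H r b] integrable_tensor_weight[OF H \<rho>0(1) b]
      by (simp add: \<tau>_def algebra_simps)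
    moreover have "(LINT p|lborel. H p * (\<rho>0 (fst p) * \<beta> (snd p))) = (LINT y|lborel. \<kappa> y * \<beta> y)"
      unfolding lborel_fubini_snd(3)[OF integrable_tensor_weight[OF H \<rho>0(1) b]]
      by (simp add: \<kappa>_def flip: mult.assoc)
    moreover have "(LINT p|lborel. indicator {a<..<b} (fst p) * (indicator {c<..<d} (snd p) * \<kappa> (snd p)) * (\<rho> (fst p) * \<beta> (snd p)))
        = m * (LINT y|lborel. \<kappa> y * \<beta> y)"
    proof -
      have eq: "indicator {a<..<b} (fst p) * (indicator {c<..<d} (snd p) * \<kappa> (snd p)) * (\<rho> (fst p) * \<beta> (snd p))
        = \<rho> (fst p) * (\<kappa> (snd p) * \<beta> (snd p))" for p
        using test_fun_real_outside[OF r, of "fst p"] test_fun_real_outside[OF b, of "snd p"]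
        by (auto simp: indicator_def)
      obtain B where "\<And>x. \<bar>\<beta> x\<bar> \<le> B" by (rule test_fun_real_bounded[OF b]) blast
      from integrable_mult_bounded[OF \<kappa> _ this]
      have "integrable lborel (\<lambda>y. \<kappa> y * \<beta> y)" using test_fun_real_measurable[OF b] by simp
      from lborel_fubini_fst(3)[OF integrable_tensor[OF test_fun_real_integrable[OF r] this]]
      show ?thesis unfolding eq by (simp add: m_def)
    qed
    ultimately show "(LINT p|lborel. F p * (\<rho> (fst p) * \<beta> (snd p))) = 0"
      using integrable_tensor_weight[OF H r b] integrable_tensor_weight[OF iK r b]
      by (simp add: F_def left_diff_distrib)
  qed
  then have "AE p in lborel. p \<in> R \<longrightarrow> E p = prim (\<lambda>s. P (s, snd p)) (fst p) + \<kappa> (snd p)"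
    by (rule AE_mp) (auto simp: R_def F_def H_def A_def indicator_def)
  then show ?thesis by (rule that)
qed

lemma weak_dy_primitive:
  fixes E P :: "real \<times> real \<Rightarrow> real" and a b c d :: real
  defines "R \<equiv> {a<..<b} \<times> {c<..<d}"
  assumes "c < d" and E: "integrable lborel E" and P: "integrable lborel P"
    and orth: "\<And>\<alpha> \<beta>. test_fun_real {a<..<b} \<alpha> \<Longrightarrow> test_fun_real {c<..<d} \<beta> \<Longrightarrow>
      (LINT p|lborel. E p * (\<alpha> (fst p) * deriv \<beta> (snd p))) = - (LINT p|lborel. P p * (\<alpha> (fst p) * \<beta> (snd p)))"
  obtains \<kappa> where "AE p in lborel. p \<in> R \<longrightarrow> E p = prim (\<lambda>s. P (fst p, s)) (snd p) + \<kappa> (fst p)"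
proof -
  obtain \<kappa> where \<kappa>: "AE p in lborel. p \<in> {c<..<d} \<times> {a<..<b} \<longrightarrow>
     E (prod.swap p) = prim (\<lambda>s. P (prod.swap (s, snd p))) (fst p) + \<kappa> (snd p)"
  proof (rule weak_dx_primitive[OF \<open>c < d\<close> lborel_swap(1)[OF E] lborel_swap(1)[OF P]])
    fix \<beta> \<alpha> assume b: "test_fun_real {c<..<d} \<beta>" and a: "test_fun_real {a<..<b} \<alpha>"
    show "(LINT p|lborel. E (prod.swap p) * (deriv \<beta> (fst p) * \<alpha> (snd p)))
        = - (LINT p|lborel. P (prod.swap p) * (\<beta> (fst p) * \<alpha> (snd p)))"
      using orth[OF a b]
        lborel_swap(2)[OF integrable_tensor_weight[OF E a test_fun_real_deriv[OF b]]]
        lborel_swap(2)[OF integrable_tensor_weight[OF P a b]]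
      by (simp add: mult_ac)
  qed
  have "AE p in lborel. p \<in> R \<longrightarrow> E p = prim (\<lambda>s. P (fst p, s)) (snd p) + \<kappa> (fst p)"
    using AE_lborel_swap[OF \<kappa>] by (rule AE_mp) (auto simp: R_def)
  then show ?thesis by (rule that)
qed

section \<open>Uniqueness\<close>

lemma integrable_mult_L2:
  fixes f g :: "'a \<Rightarrow> real"
  assumes "f \<in> borel_measurable M" "g \<in> borel_measurable M"
    and "integrable M (\<lambda>x. (f x)\<^sup>2)" "integrable M (\<lambda>x. (g x)\<^sup>2)"
  shows "integrable M (\<lambda>x. f x * g x)"
proof (rule Bochner_Integration.integrable_bound)
  show "integrable M (\<lambda>x. (f x)\<^sup>2 + (g x)\<^sup>2)" using assms by simp
  have "\<bar>f x * g x\<bar> \<le> (f x)\<^sup>2 + (g x)\<^sup>2" for x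
    using sum_squares_bound[of "\<bar>f x\<bar>" "\<bar>g x\<bar>"] abs_ge_zero[of "f x * g x"]
    unfolding power2_abs abs_mult by linarith
  then show "AE x in M. norm (f x * g x) \<le> norm ((f x)\<^sup>2 + (g x)\<^sup>2)" by simp
qed (use assms in measurable)

text \<open>The equation P = S is tested with w itself: the x-derivative contributes boundary terms of a
  favourable sign, and the y-derivative contributes minus the square of the norm of Q.\<close>

lemma kinetic_uniqueness:
  fixes w P Q S :: "real \<times> real \<Rightarrow> real" and a b c d :: real
  defines "R \<equiv> {a<..<b} \<times> {c<..<d}"
  assumes "a < b" "c < 0" "0 < d"
    and w: "integrable lborel w" "integrable lborel (\<lambda>p. (w p)\<^sup>2)"
    and P: "integrable lborel P" "integrable lborel (\<lambda>p. (P p)\<^sup>2)"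
    and Q: "integrable lborel Q" "integrable lborel (\<lambda>p. (Q p)\<^sup>2)"
    and S: "integrable lborel S" "integrable lborel (\<lambda>p. (S p)\<^sup>2)"
    and out: "\<And>p. p \<notin> R \<Longrightarrow> w p = 0" "\<And>p. p \<notin> R \<Longrightarrow> P p = 0" "\<And>p. p \<notin> R \<Longrightarrow> Q p = 0" "\<And>p. p \<notin> R \<Longrightarrow> S p = 0"
    and wP: "\<And>\<alpha> \<beta>. test_fun_real {a<..<b} \<alpha> \<Longrightarrow> test_fun_real {c<..<d} \<beta> \<Longrightarrow>
      (LINT p|lborel. snd p * w p * (deriv \<alpha> (fst p) * \<beta> (snd p))) = - (LINT p|lborel. P p * (\<alpha> (fst p) * \<beta> (snd p)))"
    and wQ: "\<And>\<alpha> \<beta>. test_fun_real {a<..<b} \<alpha> \<Longrightarrow> test_fun_real {c<..<d} \<beta> \<Longrightarrow>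
      (LINT p|lborel. w p * (\<alpha> (fst p) * deriv \<beta> (snd p))) = - (LINT p|lborel. Q p * (\<alpha> (fst p) * \<beta> (snd p)))"
    and QS: "\<And>\<alpha> \<beta>. test_fun_real {a<..<b} \<alpha> \<Longrightarrow> test_fun_real {c<..<d} \<beta> \<Longrightarrow>
      (LINT p|lborel. Q p * (\<alpha> (fst p) * deriv \<beta> (snd p))) = - (LINT p|lborel. S p * (\<alpha> (fst p) * \<beta> (snd p)))"
    and PS: "AE p in lborel. P p = S p"
    and left: "AE p in lborel. v1 p = w p \<or> p \<notin> R" "AE y in lborel. y \<in> {0<..<d} \<longrightarrow> ((\<lambda>h. v1 (a + h, y)) \<longlongrightarrow> 0) (at_right 0)"
    and right: "AE p in lborel. v2 p = w p \<or> p \<notin> R" "AE y in lborel. y \<in> {c<..<0} \<longrightarrow> ((\<lambda>h. v2 (b - h, y)) \<longlongrightarrow> 0) (at_right 0)"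
    and bottom: "AE p in lborel. v3 p = w p \<or> p \<notin> R" "AE x in lborel. x \<in> {a<..<b} \<longrightarrow> ((\<lambda>h. v3 (x, c + h)) \<longlongrightarrow> 0) (at_right 0)"
    and top: "AE p in lborel. v4 p = w p \<or> p \<notin> R" "AE x in lborel. x \<in> {a<..<b} \<longrightarrow> ((\<lambda>h. v4 (x, d - h)) \<longlongrightarrow> 0) (at_right 0)"
  shows "AE p in lborel. w p = 0"
proof -
  have "c < d" using \<open>c < 0\<close> \<open>0 < d\<close> by simp
  have Pw: "integrable lborel (\<lambda>p. P p * w p)" and Sw: "integrable lborel (\<lambda>p. S p * w p)"
    using integrable_mult_L2[OF _ _ P(2) w(2)] integrable_mult_L2[OF _ _ S(2) w(2)] P w S by auto
  have yw: "integrable lborel (\<lambda>p. snd p * w p)"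
  proof (rule Bochner_Integration.integrable_bound)
    show "integrable lborel (\<lambda>p. max \<bar>c\<bar> \<bar>d\<bar> * w p)" using w by simp
    have "\<bar>snd p\<bar> * \<bar>w p\<bar> \<le> max \<bar>c\<bar> \<bar>d\<bar> * \<bar>w p\<bar>" for p
    proof (cases "p \<in> R")
      case True then show ?thesis by (intro mult_right_mono) (auto simp: R_def)
    qed (simp add: out)
    then show "AE p in lborel. norm (snd p * w p) \<le> norm (max \<bar>c\<bar> \<bar>d\<bar> * w p)" by (auto simp: abs_mult)
    have [measurable]: "w \<in> borel_measurable (borel \<Otimes>\<^sub>M borel)" using w(1) by (simp add: borel_prod)
    have "(\<lambda>p. snd p * w p) \<in> borel_measurable (borel \<Otimes>\<^sub>M borel)" by measurable
    then show "(\<lambda>p. snd p * w p) \<in> borel_measurable lborel" by (simp add: borel_prod)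
  qed
  \<comment> \<open>On almost every line the weak derivatives become primitives: \<open>P\<close> of
    \<open>y w\<close> in x, \<open>Q\<close> of \<open>w\<close> and \<open>S\<close> of
    \<open>Q\<close> in y. The traces determine the constants \<open>\<kappa>\<close> and
    \<open>e\<close>; the constant \<open>m\<close> drops out because \<open>Q\<close> will have
    mean zero on vertical lines.\<close>
  obtain \<kappa> where \<kappa>: "AE p in lborel. p \<in> R \<longrightarrow> snd p * w p = prim (\<lambda>s. P (s, snd p)) (fst p) + \<kappa> (snd p)"
    unfolding R_def by (rule weak_dx_primitive[OF \<open>a < b\<close> yw P(1) wP])
  obtain e where e: "AE p in lborel. p \<in> R \<longrightarrow> w p = prim (\<lambda>s. Q (fst p, s)) (snd p) + e (fst p)"
    unfolding R_def by (rule weak_dy_primitive[OF \<open>c < d\<close> w(1) Q(1) wQ])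
  obtain m where m: "AE p in lborel. p \<in> R \<longrightarrow> Q p = prim (\<lambda>s. S (fst p, s)) (snd p) + m (fst p)"
    unfolding R_def by (rule weak_dy_primitive[OF \<open>c < d\<close> Q(1) S(1) QS])

  have vert: "AE x in lborel. (AE y in lborel. w (x, y) = prim (\<lambda>s. Q (x, s)) y \<or> (x, y) \<notin> R) \<and>
      (LINT y|lborel. S (x, y) * w (x, y)) = - (LINT y|lborel. (Q (x, y))\<^sup>2)"
    using AE_lborel_fst[OF e] AE_lborel_fst[OF m]
      AE_lborel_fst[OF bottom(1)] bottom(2) AE_lborel_fst[OF top(1)] top(2)
      lborel_fubini_fst(1)[OF Q(1)] lborel_fubini_fst(1)[OF Q(2)] lborel_fubini_fst(1)[OF S(1)] lborel_fubini_fst(1)[OF w(1)]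
  proof eventually_elim
    case (elim x)
    show ?case
    proof (cases "x \<in> {a<..<b}")
      case x: False
      then have "(x, y) \<notin> R" for y by (auto simp: R_def)
      then show ?thesis using out by auto
    next
      case x: True
      have R: "(x, y) \<in> R \<longleftrightarrow> y \<in> {c<..<d}" for y using x by (auto simp: R_def)
      have outx: "y \<le> c \<Longrightarrow> Q (x, y) = 0" "d \<le> y \<Longrightarrow> Q (x, y) = 0" for y using out(3)[of "(x, y)"] R[of y] by auto
      have lim_c: "((\<lambda>y. prim (\<lambda>s. Q (x, s)) y + e x) \<longlongrightarrow> 0 + e x) (at_right c)"
        by (intro tendsto_intros prim_tendsto_left_end elim(7)) (use outx in auto)
      \<comment> \<open>\<open>v3\<close> and the primitive agree almost everywhere on this line, so
        their limits at \<open>c\<close> coincide and the constant vanishes. The same comparison at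
        \<open>d\<close> then says that \<open>Q\<close> has mean zero on the line.\<close>
      have "0 = 0 + e x"
      proof (rule AE_one_sided_limit_unique[of c d "\<lambda>y. v3 (x, y)" "\<lambda>y. prim (\<lambda>s. Q (x, s)) y + e x" 1 c])
        show "AE y in lborel. y \<in> {c<..<d} \<longrightarrow> v3 (x, y) = prim (\<lambda>s. Q (x, s)) y + e x"
          using elim(1) elim(3)
          proof eventually_elim
            case (elim y)
            then show ?case unfolding fst_conv snd_conv R[symmetric] by force
          qed
        show "((\<lambda>h. v3 (x, c + 1 * h)) \<longlongrightarrow> 0) (at_right 0)" using elim(4) x by simp
        show "((\<lambda>h. prim (\<lambda>s. Q (x, s)) (c + 1 * h) + e x) \<longlongrightarrow> 0 + e x) (at_right 0)"
          using lim_c unfolding filterlim_at_right_to_0[of _ _ c] by (simp add: add.commute)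
      qed (use \<open>c < d\<close> in auto)
      then have ex: "e x = 0" by simp
      have lim_d: "((\<lambda>y. prim (\<lambda>s. Q (x, s)) y + e x) \<longlongrightarrow> (LINT y|lborel. Q (x, y)) + e x) (at_left d)"
        by (intro tendsto_intros prim_tendsto_right_end elim(7)) (use outx in auto)
      have "0 = (LINT y|lborel. Q (x, y)) + e x"
      proof (rule AE_one_sided_limit_unique[of c d "\<lambda>y. v4 (x, y)" "\<lambda>y. prim (\<lambda>s. Q (x, s)) y + e x" "-1" d])
        show "AE y in lborel. y \<in> {c<..<d} \<longrightarrow> v4 (x, y) = prim (\<lambda>s. Q (x, s)) y + e x"
          using elim(1) elim(5)
          proof eventually_elim
            case (elim y)
            then show ?case unfolding fst_conv snd_conv R[symmetric] by force
          qed
        show "((\<lambda>h. v4 (x, d + -1 * h)) \<longlongrightarrow> 0) (at_right 0)" using elim(6) x by simp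
        show "((\<lambda>h. prim (\<lambda>s. Q (x, s)) (d + -1 * h) + e x) \<longlongrightarrow> (LINT y|lborel. Q (x, y)) + e x) (at_right 0)"
          using lim_d unfolding filterlim_at_left_to_right[of _ _ d] filterlim_at_right_to_0[of _ _ "-d"] by simp
      qed (use \<open>c < d\<close> in auto)
      then have Q0: "(LINT y|lborel. Q (x, y)) = 0" using ex by simp
      have w_eq: "AE y in lborel. w (x, y) = prim (\<lambda>s. Q (x, s)) y \<or> (x, y) \<notin> R"
        using elim(1) by eventually_elim (use ex in auto)
      have "(LINT y|lborel. S (x, y) * w (x, y)) = (LINT y|lborel. S (x, y) * prim (\<lambda>s. Q (x, s)) y)"
      proof (rule integral_cong_AE)
        show "(\<lambda>y. S (x, y) * w (x, y)) \<in> borel_measurable lborel" using elim(9,10) by simp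
        show "(\<lambda>y. S (x, y) * prim (\<lambda>s. Q (x, s)) y) \<in> borel_measurable lborel"
          using integrable_mult_prim[OF elim(9) elim(7)] by simp
        show "AE y in lborel. S (x, y) * w (x, y) = S (x, y) * prim (\<lambda>s. Q (x, s)) y"
          using w_eq by eventually_elim (use out(4) in auto)
      qed
      \<comment> \<open>The boundary product in \<open>prim_parts\<close> contains the mean of
        \<open>Q\<close>, which is zero; the same fact removes \<open>m x\<close> below.\<close>
      also have "\<dots> = - (LINT y|lborel. Q (x, y) * prim (\<lambda>s. S (x, s)) y)"
        using prim_parts[OF elim(9) elim(7)] Q0 by simp
      also have "(LINT y|lborel. Q (x, y) * prim (\<lambda>s. S (x, s)) y) = (LINT y|lborel. (Q (x, y))\<^sup>2 - m x * Q (x, y))"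
      proof (rule integral_cong_AE)
        show "(\<lambda>y. Q (x, y) * prim (\<lambda>s. S (x, s)) y) \<in> borel_measurable lborel"
          using integrable_mult_prim[OF elim(7) elim(9)] by simp
        show "(\<lambda>y. (Q (x, y))\<^sup>2 - m x * Q (x, y)) \<in> borel_measurable lborel" using elim(7) by simp
        show "AE y in lborel. Q (x, y) * prim (\<lambda>s. S (x, s)) y = (Q (x, y))\<^sup>2 - m x * Q (x, y)"
          using elim(2)
        proof eventually_elim
          case (elim y)
          then show ?case using out(3)[of "(x, y)"]
            by (cases "(x, y) \<in> R") (auto simp: power2_eq_square algebra_simps)
        qed
      qed
      also have "\<dots> = (LINT y|lborel. (Q (x, y))\<^sup>2)" using elim(7,8) Q0 by simp
      finally show ?thesis using w_eq by simp
    qed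
  qed

  have horiz: "AE y in lborel. 0 \<le> (LINT x|lborel. P (x, y) * w (x, y))"
    using AE_lborel_snd[OF \<kappa>] AE_lborel_snd[OF left(1)] left(2) AE_lborel_snd[OF right(1)] right(2)
      lborel_fubini_snd(1)[OF P(1)] lborel_fubini_snd(1)[OF w(1)] AE_lborel_singleton[of 0]
  proof eventually_elim
    case (elim y)
    show ?case
    proof (cases "y \<in> {c<..<d}")
      case False
      then have "P (x, y) = 0" for x by (intro out) (auto simp: R_def)
      then show ?thesis by simp
    next
      case y: True
      have R: "(x, y) \<in> R \<longleftrightarrow> x \<in> {a<..<b}" for x using y by (auto simp: R_def)
      have outy: "x \<le> a \<Longrightarrow> P (x, y) = 0" "b \<le> x \<Longrightarrow> P (x, y) = 0" for x using out(2)[of "(x, y)"] R[of x] by auto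
      define p where "p = (LINT x|lborel. P (x, y))"
      \<comment> \<open>Multiplication by y replaces \<open>w\<close> by the primitive plus
        \<open>\<kappa> y\<close>, so with p the integral of \<open>P\<close> on the line the result
        is p^2/2 + \<open>\<kappa> y\<close> p. For y > 0 the left trace gives
        \<open>\<kappa> y\<close> = 0, for y < 0 the right trace gives \<open>\<kappa> y\<close> =
        -p. The value is p^2/2 or -p^2/2, and division by y makes both nonnegative.\<close>
      have "y * (LINT x|lborel. P (x, y) * w (x, y)) = (LINT x|lborel. P (x, y) * (y * w (x, y)))"
        by (simp add: mult.left_commute)
      also have "\<dots> = (LINT x|lborel. P (x, y) * prim (\<lambda>s. P (s, y)) x + \<kappa> y * P (x, y))"
      proof (rule integral_cong_AE)
        show "(\<lambda>x. P (x, y) * (y * w (x, y))) \<in> borel_measurable lborel" using elim(6,7) by simp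
        show "(\<lambda>x. P (x, y) * prim (\<lambda>s. P (s, y)) x + \<kappa> y * P (x, y)) \<in> borel_measurable lborel"
          using integrable_mult_prim[OF elim(6) elim(6)] elim(6) by simp
        show "AE x in lborel. P (x, y) * (y * w (x, y)) = P (x, y) * prim (\<lambda>s. P (s, y)) x + \<kappa> y * P (x, y)"
          using elim(1)
        proof eventually_elim
          case (elim x)
          then show ?case using out(2)[of "(x, y)"]
            by (cases "(x, y) \<in> R") (auto simp: algebra_simps)
        qed
      qed
      also have "\<dots> = p\<^sup>2 / 2 + \<kappa> y * p"
        using integrable_mult_prim[OF elim(6) elim(6)] elim(6) prim_square[OF elim(6)] by (simp add: p_def)
      finally have eq: "y * (LINT x|lborel. P (x, y) * w (x, y)) = p\<^sup>2 / 2 + \<kappa> y * p" .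
      show ?thesis
      proof (cases "y > 0")
        case True
        have lim: "((\<lambda>x. prim (\<lambda>s. P (s, y)) x + \<kappa> y) \<longlongrightarrow> 0 + \<kappa> y) (at_right a)"
          by (intro tendsto_intros prim_tendsto_left_end elim(6)) (use outy in auto)
        have "y * 0 = 0 + \<kappa> y"
        proof (rule AE_one_sided_limit_unique[of a b "\<lambda>x. y * v1 (x, y)" "\<lambda>x. prim (\<lambda>s. P (s, y)) x + \<kappa> y" 1 a])
          show "AE x in lborel. x \<in> {a<..<b} \<longrightarrow> y * v1 (x, y) = prim (\<lambda>s. P (s, y)) x + \<kappa> y"
            using elim(1) elim(2)
          proof eventually_elim
            case (elim x)
            then show ?case unfolding fst_conv snd_conv R[symmetric] by force
          qed
          show "((\<lambda>h. y * v1 (a + 1 * h, y)) \<longlongrightarrow> y * 0) (at_right 0)"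
            using elim(3) y True by (intro tendsto_mult_left) simp
          show "((\<lambda>h. prim (\<lambda>s. P (s, y)) (a + 1 * h) + \<kappa> y) \<longlongrightarrow> 0 + \<kappa> y) (at_right 0)"
            using lim unfolding filterlim_at_right_to_0[of _ _ a] by (simp add: add.commute)
        qed (use \<open>a < b\<close> in auto)
        then have "y * (LINT x|lborel. P (x, y) * w (x, y)) = p\<^sup>2 / 2" using eq by simp
        also have "\<dots> \<ge> 0" by simp
        finally have "y * (LINT x|lborel. P (x, y) * w (x, y)) \<ge> 0" .
        then show ?thesis using True by (simp add: zero_le_mult_iff)
      next
        case False
        then have "y < 0" using elim(8) by auto
        have lim: "((\<lambda>x. prim (\<lambda>s. P (s, y)) x + \<kappa> y) \<longlongrightarrow> p + \<kappa> y) (at_left b)"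
          unfolding p_def by (intro tendsto_intros prim_tendsto_right_end elim(6)) (use outy in auto)
        have "y * 0 = p + \<kappa> y"
        proof (rule AE_one_sided_limit_unique[of a b "\<lambda>x. y * v2 (x, y)" "\<lambda>x. prim (\<lambda>s. P (s, y)) x + \<kappa> y" "-1" b])
          show "AE x in lborel. x \<in> {a<..<b} \<longrightarrow> y * v2 (x, y) = prim (\<lambda>s. P (s, y)) x + \<kappa> y"
            using elim(1) elim(4)
          proof eventually_elim
            case (elim x)
            then show ?case unfolding fst_conv snd_conv R[symmetric] by force
          qed
          show "((\<lambda>h. y * v2 (b + -1 * h, y)) \<longlongrightarrow> y * 0) (at_right 0)"
            using elim(5) y \<open>y < 0\<close> by (intro tendsto_mult_left) simp
          show "((\<lambda>h. prim (\<lambda>s. P (s, y)) (b + -1 * h) + \<kappa> y) \<longlongrightarrow> p + \<kappa> y) (at_right 0)"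
            using lim unfolding filterlim_at_left_to_right[of _ _ b] filterlim_at_right_to_0[of _ _ "-b"] by simp
        qed (use \<open>a < b\<close> in auto)
        then have "\<kappa> y = - p" by simp
        then have "y * (LINT x|lborel. P (x, y) * w (x, y)) = - (p\<^sup>2 / 2)" using eq by (simp add: power2_eq_square)
        then have "y * (LINT x|lborel. P (x, y) * w (x, y)) \<le> 0" by simp
        then show ?thesis using \<open>y < 0\<close> by (simp add: mult_le_0_iff)
      qed
    qed
  qed

  have "0 \<le> (LINT y|lborel. LINT x|lborel. P (x, y) * w (x, y))"
    using horiz by (rule integral_nonneg_AE)
  also have "\<dots> = (LINT p|lborel. P p * w p)" by (rule lborel_fubini_snd(3)[OF Pw, symmetric])
  also have "\<dots> = (LINT p|lborel. S p * w p)"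
    by (rule integral_cong_AE) (use Pw Sw PS in auto)
  also have "\<dots> = (LINT x|lborel. LINT y|lborel. S (x, y) * w (x, y))" by (rule lborel_fubini_fst(3)[OF Sw])
  also have "\<dots> = (LINT x|lborel. - (LINT y|lborel. (Q (x, y))\<^sup>2))"
    by (rule integral_cong_AE)
       (use vert lborel_fubini_fst(2)[OF Sw] lborel_fubini_fst(2)[OF Q(2)] in auto)
  also have "\<dots> = - (LINT p|lborel. (Q p)\<^sup>2)" using lborel_fubini_fst(3)[OF Q(2)] by simp
  finally have "(LINT p|lborel. (Q p)\<^sup>2) \<le> 0" by simp
  moreover have "0 \<le> (LINT p|lborel. (Q p)\<^sup>2)" by (rule Bochner_Integration.integral_nonneg) simp
  ultimately have "(LINT p|lborel. (Q p)\<^sup>2) = 0" by simp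
  then have "AE p in lborel. (Q p)\<^sup>2 = 0"
    by (subst (asm) integral_nonneg_eq_0_iff_AE[OF Q(2)]) auto
  then have Q_0: "AE p in lborel. Q p = 0" by simp
  have "AE x in lborel. AE y in lborel. w (x, y) = 0"
    using vert AE_lborel_fst[OF Q_0] lborel_fubini_fst(1)[OF Q(1)]
  proof eventually_elim
    case (elim x)
    have "prim (\<lambda>s. Q (x, s)) y = 0" for y
      unfolding prim_def using elim(2) by (intro integral_eq_zero_AE) auto
    then show ?case
      using elim(1) out(1) by (auto elim!: AE_mp)
  qed
  then show ?thesis
    using w(1) by (intro AE_lborel_pairI) auto
qed

section \<open>Borel representatives\<close>

lemma AE_lebesgue_on_iff:
  fixes U :: "'a::euclidean_space set"
  assumes "U \<in> sets borel"
  shows "(AE p in lebesgue_on U. Q p) \<longleftrightarrow> (AE p in lborel. p \<in> U \<longrightarrow> Q p)"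
  using assms by (subst AE_restrict_space_iff) (auto simp: AE_completion_iff)

lemma borel_measurable_lebesgue_AE:
  fixes f g :: "'a::euclidean_space \<Rightarrow> real"
  assumes g: "g \<in> borel_measurable borel" and ae: "AE p in lborel. f p = g p"
  shows "f \<in> borel_measurable lebesgue"
proof (rule measurableI)
  fix A :: "real set" assume A: "A \<in> sets borel"
  have "AE p in lborel. \<not> (f p \<noteq> g p)" using ae by simp
  from sets_completion_AE[OF this] have 1: "{p. f p \<noteq> g p} \<in> sets lebesgue" by (simp add: pred_def)
  have "AE p in lborel. \<not> (f p \<in> A \<and> f p \<noteq> g p)" using ae by eventually_elim simp
  from sets_completion_AE[OF this] have 2: "{p. f p \<in> A \<and> f p \<noteq> g p} \<in> sets lebesgue" by (simp add: pred_def)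
  have "g -` A \<in> sets borel" using measurable_sets_borel[OF g A] .
  then have 3: "g -` A \<in> sets lebesgue" by auto
  have "f -` A \<inter> space lebesgue = (g -` A - {p. f p \<noteq> g p}) \<union> {p. f p \<in> A \<and> f p \<noteq> g p}" by auto
  then show "f -` A \<inter> space lebesgue \<in> sets lebesgue" using 1 2 3 by auto
qed simp

lemma
  fixes f f' :: "'a::euclidean_space \<Rightarrow> real"
  assumes U: "U \<in> sets borel" and f': "f' \<in> borel_measurable borel"
    and ae: "AE p in lborel. p \<in> U \<longrightarrow> f p = f' p" and out: "\<And>p. p \<notin> U \<Longrightarrow> f' p = 0"
  shows lebesgue_on_integral_eq: "integral\<^sup>L (lebesgue_on U) f = (LINT p|lborel. f' p)"
    and lebesgue_on_integrable_iff: "integrable (lebesgue_on U) f \<longleftrightarrow> integrable lborel f'"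
proof -
  have eq: "AE p in lborel. indicator U p *\<^sub>R f p = f' p"
    using ae by eventually_elim (use out in \<open>auto simp: indicator_def\<close>)
  have m: "(\<lambda>p. indicator U p *\<^sub>R f p) \<in> borel_measurable lebesgue"
    by (rule borel_measurable_lebesgue_AE[OF f' eq])
  have m': "f' \<in> borel_measurable lebesgue" using f' by (simp add: measurable_completion)
  have eq': "AE p in lebesgue. indicator U p *\<^sub>R f p = f' p" using eq by (rule AE_completion)
  have "integral\<^sup>L (lebesgue_on U) f = integral\<^sup>L lebesgue (\<lambda>p. indicator U p *\<^sub>R f p)"
    using U by (subst integral_restrict_space) auto
  also have "\<dots> = integral\<^sup>L lebesgue f'" by (rule integral_cong_AE[OF m m' eq'])
  also have "\<dots> = (LINT p|lborel. f' p)" using f' by (simp add: integral_completion)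
  finally show "integral\<^sup>L (lebesgue_on U) f = (LINT p|lborel. f' p)" .
  have "integrable (lebesgue_on U) f \<longleftrightarrow> integrable lebesgue (\<lambda>p. indicator U p *\<^sub>R f p)"
    using U by (subst integrable_restrict_space) auto
  also have "\<dots> \<longleftrightarrow> integrable lebesgue f'" by (rule integrable_cong_AE[OF m m' eq'])
  also have "\<dots> \<longleftrightarrow> integrable lborel f'" using f' by (simp add: integrable_completion)
  finally show "integrable (lebesgue_on U) f \<longleftrightarrow> integrable lborel f'" .
qed

text \<open>Elements of \<open>L2\<close> are only Lebesgue measurable, while Fubini is applied to
  the Borel measure of the plane. The representative vanishes off the domain, so all integrals can
  run over the whole space.\<close>

definition borel_rep :: "'a::euclidean_space set \<Rightarrow> ('a \<Rightarrow> real) \<Rightarrow> ('a \<Rightarrow> real) \<Rightarrow> bool" where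
  "borel_rep U u u' \<longleftrightarrow> u' \<in> borel_measurable borel \<and> integrable lborel u' \<and> integrable lborel (\<lambda>p. (u' p)\<^sup>2) \<and>
    (\<forall>p. p \<notin> U \<longrightarrow> u' p = 0) \<and> (AE p in lborel. p \<in> U \<longrightarrow> u p = u' p)"

lemma ex_borel_rep:
  fixes U :: "'a::euclidean_space set"
  assumes u: "u \<in> L2 U" and U: "U \<in> sets borel" "bounded U"
  obtains u' where "borel_rep U u u'"
proof -
  have "(\<lambda>p. indicator U p *\<^sub>R u p) \<in> borel_measurable lebesgue"
    using u U(1) by (subst (asm) L2_def) (auto simp: borel_measurable_restrict_space_iff)
  then obtain g where g: "g \<in> borel_measurable lborel" "AE p in lborel. indicator U p *\<^sub>R u p = g p"
    using completion_ex_borel_measurable_real by blast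
  define u' where "u' p = indicator U p * g p" for p
  have m: "u' \<in> borel_measurable borel" unfolding u'_def using g(1) U(1) by simp
  have ae: "AE p in lborel. p \<in> U \<longrightarrow> u p = u' p"
    using g(2) by eventually_elim (auto simp: u'_def)
  have out: "u' p = 0" if "p \<notin> U" for p using that by (simp add: u'_def)
  have sq: "integrable lborel (\<lambda>p. (u' p)\<^sup>2)"
  proof (subst lebesgue_on_integrable_iff[symmetric, OF U(1)])
    show "AE p in lborel. p \<in> U \<longrightarrow> (u p)\<^sup>2 = (u' p)\<^sup>2" using ae by eventually_elim auto
    show "integrable (lebesgue_on U) (\<lambda>p. (u p)\<^sup>2)" using u by (simp add: L2_def)
  qed (use m out in auto)
  \<comment> \<open>On the bounded set \<open>U\<close> the square controls the function itself,
    through \<bar>z\<bar> \<le> 1 + z^2.\<close>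
  have "integrable lborel u'"
  proof (rule Bochner_Integration.integrable_bound)
    have "integrable lborel (indicator U :: 'a \<Rightarrow> real)"
      using emeasure_bounded_finite[OF U(2)] U(1) by (intro integrable_real_indicator) auto
    then show "integrable lborel (\<lambda>p. indicator U p + (u' p)\<^sup>2)" using sq by (rule Bochner_Integration.integrable_add)
    have "\<bar>u' p\<bar> \<le> indicator U p + (u' p)\<^sup>2" for p
    proof (cases "p \<in> U")
      case True
      have "0 \<le> (\<bar>u' p\<bar> - 1)\<^sup>2 + \<bar>u' p\<bar>\<^sup>2 + 1" by (intro add_nonneg_nonneg) auto
      then show ?thesis using True by (simp add: power2_eq_square algebra_simps)
    qed (simp add: out)
    then show "AE p in lborel. norm (u' p) \<le> norm (indicator U p + (u' p)\<^sup>2)" by (auto intro: order_trans[OF _ abs_ge_self])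
  qed (use m in simp)
  then show ?thesis using that[of u'] m ae out sq by (auto simp: borel_rep_def)
qed

lemma borel_repD:
  assumes "borel_rep U u u'"
  shows "u' \<in> borel_measurable borel" "integrable lborel u'" "integrable lborel (\<lambda>p. (u' p)\<^sup>2)"
    "p \<notin> U \<Longrightarrow> u' p = 0" "AE p in lborel. p \<in> U \<longrightarrow> u p = u' p"
  using assms by (auto simp: borel_rep_def)

lemma borel_rep_integral:
  assumes r: "borel_rep U u u'" and "U \<in> sets borel" "w \<in> borel_measurable borel"
  shows "integral\<^sup>L (lebesgue_on U) (\<lambda>p. u p * w p) = (LINT p|lborel. u' p * w p)"
  using assms borel_repD[OF r] by (intro lebesgue_on_integral_eq) auto

lemma distr_of_rep:
  "borel_rep U u u' \<Longrightarrow> U \<in> sets borel \<Longrightarrow> w \<in> borel_measurable borel \<Longrightarrow> distr_of U u w = (LINT p|lborel. u' p * w p)"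
  unfolding distr_of_def by (rule borel_rep_integral)

lemma borel_rep_diff:
  assumes "borel_rep U u u'" "borel_rep U v v'"
  shows "borel_rep U (\<lambda>p. u p - v p) (\<lambda>p. u' p - v' p)"
proof -
  note u = borel_repD[OF assms(1)] and v = borel_repD[OF assms(2)]
  have "integrable lborel (\<lambda>p. (u' p)\<^sup>2 + (v' p)\<^sup>2 - 2 * (u' p * v' p))"
    using integrable_mult_L2[OF _ _ u(3) v(3)] u v by simp
  then have "integrable lborel (\<lambda>p. (u' p - v' p)\<^sup>2)" by (simp add: power2_diff mult.assoc)
  moreover have "AE p in lborel. p \<in> U \<longrightarrow> u p - v p = u' p - v' p"
    using u(5) v(5) by eventually_elim auto
  ultimately show ?thesis using u v unfolding borel_rep_def by auto
qed

section \<open>Uniqueness for the boundary value problem\<close>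

lemma Dom_borel [simp]: "Dom X \<in> sets borel" "open (Dom X)"
  unfolding Dom_def by (auto intro!: borel_open open_Times)

lemma Dom_bounded: "bounded (Dom X)"
  unfolding Dom_def by (intro bounded_Times) auto

lemma tensor_measurable:
  assumes "f \<in> borel_measurable borel" "g \<in> borel_measurable borel"
  shows "(\<lambda>(x, y). f x * g y :: real) \<in> borel_measurable (borel :: (real \<times> real) measure)"
proof -
  note [measurable] = assms
  have "(\<lambda>(x, y). f x * g y) \<in> borel_measurable (borel \<Otimes>\<^sub>M borel)" by measurable
  then show ?thesis by (simp add: borel_prod)
qed

lemma tensor_dx:
  "smooth_real \<alpha> \<Longrightarrow> (\<lambda>(x, y). deriv (\<lambda>s. case (s, y) of (x, y) \<Rightarrow> \<alpha> x * \<beta> y) x) = (\<lambda>(x, y). deriv \<alpha> x * \<beta> y)"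
  by (auto simp: fun_eq_iff intro!: DERIV_imp_deriv DERIV_cmult_right smooth_real_has_deriv)

lemma tensor_dy:
  "smooth_real \<beta> \<Longrightarrow> (\<lambda>(x, y). deriv (\<lambda>s. case (x, s) of (x, y) \<Rightarrow> \<alpha> x * \<beta> y) y) = (\<lambda>(x, y). \<alpha> x * deriv \<beta> y)"
  by (auto simp: fun_eq_iff intro!: DERIV_imp_deriv DERIV_cmult smooth_real_has_deriv)

text \<open>Translates the distributions in \<open>Z0\<close> into Borel functions that satisfy
  integral identities against tensor products. The right-hand side stays in the form
  \<open>distr_of\<close>, with no integrability of \<open>f\<close> assumed; it cancels when two
  solutions are subtracted.\<close>

lemma Z0_weak_derivatives:
  assumes u: "u \<in> Z0 (Dom X)" and bvp: "bvp_solution X f u"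
  obtains u' P Q S where "borel_rep (Dom X) u u'" "borel_rep (Dom X) P P" "borel_rep (Dom X) Q Q" "borel_rep (Dom X) S S"
    "\<And>\<alpha> \<beta>. test_fun_real {X 0<..<X 1} \<alpha> \<Longrightarrow> test_fun_real {-1<..<1} \<beta> \<Longrightarrow>
      (LINT p|lborel. snd p * u' p * (deriv \<alpha> (fst p) * \<beta> (snd p))) = - (LINT p|lborel. P p * (\<alpha> (fst p) * \<beta> (snd p)))"
    "\<And>\<alpha> \<beta>. test_fun_real {X 0<..<X 1} \<alpha> \<Longrightarrow> test_fun_real {-1<..<1} \<beta> \<Longrightarrow>
      (LINT p|lborel. u' p * (\<alpha> (fst p) * deriv \<beta> (snd p))) = - (LINT p|lborel. Q p * (\<alpha> (fst p) * \<beta> (snd p)))"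
    "\<And>\<alpha> \<beta>. test_fun_real {X 0<..<X 1} \<alpha> \<Longrightarrow> test_fun_real {-1<..<1} \<beta> \<Longrightarrow>
      (LINT p|lborel. Q p * (\<alpha> (fst p) * deriv \<beta> (snd p))) = - (LINT p|lborel. S p * (\<alpha> (fst p) * \<beta> (snd p)))"
    "\<And>\<alpha> \<beta>. test_fun_real {X 0<..<X 1} \<alpha> \<Longrightarrow> test_fun_real {-1<..<1} \<beta> \<Longrightarrow>
      (LINT p|lborel. P p * (\<alpha> (fst p) * \<beta> (snd p))) - (LINT p|lborel. S p * (\<alpha> (fst p) * \<beta> (snd p)))
        = distr_of (Dom X) f (\<lambda>(x, y). \<alpha> x * \<beta> y)"
proof -
  let ?T = "distr_of (Dom X) u"
  have rep_self: "\<exists>h. borel_rep (Dom X) h h \<and> (\<forall>w. w \<in> borel_measurable borel \<longrightarrow> distr_of (Dom X) g w = (LINT p|lborel. h p * w p))"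
    if g: "g \<in> L2 (Dom X)" for g
  proof -
    obtain h where h: "borel_rep (Dom X) g h" using ex_borel_rep[OF g Dom_borel(1) Dom_bounded] .
    then have "borel_rep (Dom X) h h" by (auto simp: borel_rep_def)
    then show ?thesis using distr_of_rep[OF h] by auto
  qed
  have ex: "\<exists>h. borel_rep (Dom X) h h \<and> (\<forall>\<alpha> \<beta>. test_fun_real {X 0<..<X 1} \<alpha> \<longrightarrow> test_fun_real {-1<..<1} \<beta> \<longrightarrow>
      D (\<lambda>(x, y). \<alpha> x * \<beta> y) = (LINT p|lborel. h p * (\<alpha> (fst p) * \<beta> (snd p))))"
    if D: "distr_in_L2 (Dom X) D" for D
  proof -
    obtain g where g: "g \<in> L2 (Dom X)" "distr_eq (Dom X) D (distr_of (Dom X) g)"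
      using D by (auto simp: distr_in_L2_def)
    obtain h where h: "borel_rep (Dom X) h h"
      "\<And>w. w \<in> borel_measurable borel \<Longrightarrow> distr_of (Dom X) g w = (LINT p|lborel. h p * w p)"
      using rep_self[OF g(1)] by auto
    have "D (\<lambda>(x, y). \<alpha> x * \<beta> y) = (LINT p|lborel. h p * (\<alpha> (fst p) * \<beta> (snd p)))"
      if a: "test_fun_real {X 0<..<X 1} \<alpha>" and b: "test_fun_real {-1<..<1} \<beta>" for \<alpha> \<beta>
    proof -
      have "test_fun (Dom X) (\<lambda>(x, y). \<alpha> x * \<beta> y)" unfolding Dom_def by (rule test_fun_tensor[OF a b])
      then have "D (\<lambda>(x, y). \<alpha> x * \<beta> y) = distr_of (Dom X) g (\<lambda>(x, y). \<alpha> x * \<beta> y)"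
        using g(2) by (auto simp: distr_eq_def)
      also have "\<dots> = (LINT p|lborel. h p * (case p of (x, y) \<Rightarrow> \<alpha> x * \<beta> y))"
        by (intro h(2) tensor_measurable test_fun_real_measurable[OF a] test_fun_real_measurable[OF b])
      finally show ?thesis by (simp add: split_beta)
    qed
    then show ?thesis using h(1) by blast
  qed
  obtain u' where u': "borel_rep (Dom X) u u'"
    using ex_borel_rep[OF _ Dom_borel(1) Dom_bounded] u unfolding Z0_def by blast
  obtain P where P: "borel_rep (Dom X) P P" "\<And>\<alpha> \<beta>. test_fun_real {X 0<..<X 1} \<alpha> \<Longrightarrow> test_fun_real {-1<..<1} \<beta> \<Longrightarrow>
      distr_mult snd (distr_dx ?T) (\<lambda>(x, y). \<alpha> x * \<beta> y) = (LINT p|lborel. P p * (\<alpha> (fst p) * \<beta> (snd p)))"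
    using ex[of "distr_mult snd (distr_dx ?T)"] u unfolding Z0_def by blast
  obtain Q where Q: "borel_rep (Dom X) Q Q" "\<And>\<alpha> \<beta>. test_fun_real {X 0<..<X 1} \<alpha> \<Longrightarrow> test_fun_real {-1<..<1} \<beta> \<Longrightarrow>
      distr_dy ?T (\<lambda>(x, y). \<alpha> x * \<beta> y) = (LINT p|lborel. Q p * (\<alpha> (fst p) * \<beta> (snd p)))"
    using ex[of "distr_dy ?T"] u unfolding Z0_def by blast
  obtain S where S: "borel_rep (Dom X) S S" "\<And>\<alpha> \<beta>. test_fun_real {X 0<..<X 1} \<alpha> \<Longrightarrow> test_fun_real {-1<..<1} \<beta> \<Longrightarrow>
      distr_dy (distr_dy ?T) (\<lambda>(x, y). \<alpha> x * \<beta> y) = (LINT p|lborel. S p * (\<alpha> (fst p) * \<beta> (snd p)))"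
    using ex[of "distr_dy (distr_dy ?T)"] u unfolding Z0_def by blast
  have T: "?T (\<lambda>(x, y). a x * b y) = (LINT p|lborel. u' p * (a (fst p) * b (snd p)))"
    if "a \<in> borel_measurable borel" "b \<in> borel_measurable borel" for a b
    using distr_of_rep[OF u' Dom_borel(1) tensor_measurable[OF that]] by (simp add: split_beta)
  have dy: "distr_dy D (\<lambda>(x, y). \<alpha> x * \<beta> y) = - D (\<lambda>(x, y). \<alpha> x * deriv \<beta> y)"
    if b: "test_fun_real {-1<..<1} \<beta>" for \<alpha> \<beta> D
    unfolding distr_dy_def tensor_dy[OF test_fun_real_smooth[OF b]] ..
  show ?thesis
  proof (rule that[OF u' P(1) Q(1) S(1)])
    fix \<alpha> \<beta> assume a: "test_fun_real {X 0<..<X 1} \<alpha>" and b: "test_fun_real {-1<..<1} \<beta>"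
    note a' = test_fun_real_deriv[OF a] and b' = test_fun_real_deriv[OF b]
    have yb: "(\<lambda>y. y * \<beta> y) \<in> borel_measurable borel" using test_fun_real_measurable[OF b] by simp
    have "distr_mult snd (distr_dx ?T) (\<lambda>(x, y). \<alpha> x * \<beta> y) = - ?T (\<lambda>(x, y). deriv \<alpha> x * (y * \<beta> y))"
    proof -
      have "(\<lambda>(x, y). deriv (\<lambda>s. snd (s, y) * (case (s, y) of (x, y) \<Rightarrow> \<alpha> x * \<beta> y)) x) = (\<lambda>(x, y). deriv \<alpha> x * (y * \<beta> y))"
        using tensor_dx[OF test_fun_real_smooth[OF a], of "\<lambda>y. y * \<beta> y"] by (simp add: mult.left_commute)
      then show ?thesis unfolding distr_mult_def distr_dx_def by (simp only:)
    qed
    then show "(LINT p|lborel. snd p * u' p * (deriv \<alpha> (fst p) * \<beta> (snd p))) = - (LINT p|lborel. P p * (\<alpha> (fst p) * \<beta> (snd p)))"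
      using P(2)[OF a b] T[OF test_fun_real_measurable[OF a'] yb] by (simp add: mult_ac)
    show Q1: "(LINT p|lborel. u' p * (\<alpha> (fst p) * deriv \<beta> (snd p))) = - (LINT p|lborel. Q p * (\<alpha> (fst p) * \<beta> (snd p)))"
      using Q(2)[OF a b] dy[OF b, of ?T \<alpha>] T[OF test_fun_real_measurable[OF a] test_fun_real_measurable[OF b']] by simp
    show "(LINT p|lborel. Q p * (\<alpha> (fst p) * deriv \<beta> (snd p))) = - (LINT p|lborel. S p * (\<alpha> (fst p) * \<beta> (snd p)))"
      using S(2)[OF a b] dy[OF b, of "distr_dy ?T" \<alpha>] Q(2)[OF a b'] by simp
    have "test_fun (Dom X) (\<lambda>(x, y). \<alpha> x * \<beta> y)" unfolding Dom_def by (rule test_fun_tensor[OF a b])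
    then show "(LINT p|lborel. P p * (\<alpha> (fst p) * \<beta> (snd p))) - (LINT p|lborel. S p * (\<alpha> (fst p) * \<beta> (snd p)))
        = distr_of (Dom X) f (\<lambda>(x, y). \<alpha> x * \<beta> y)"
      using bvp P(2)[OF a b] S(2)[OF a b] by (auto simp: bvp_solution_def distr_eq_def distr_diff_def)
  qed
qed

lemma has_trace_diff_zero:
  assumes U: "U \<in> sets borel" and I: "I \<in> sets borel"
    and u: "has_trace U u I \<gamma> n (\<lambda>_. 0)" and w: "has_trace U w I \<gamma> n (\<lambda>_. 0)"
    and d: "AE p in lborel. p \<in> U \<longrightarrow> w p - u p = d p"
  obtains v where "AE p in lborel. v p = d p \<or> p \<notin> U"
    "AE s in lborel. s \<in> I \<longrightarrow> ((\<lambda>h. v (\<gamma> s + h *\<^sub>R n)) \<longlongrightarrow> 0) (at_right 0)"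
proof -
  obtain v1 where v1: "AE p in lborel. p \<in> U \<longrightarrow> v1 p = u p"
    "AE s in lborel. s \<in> I \<longrightarrow> ((\<lambda>h. v1 (\<gamma> s + h *\<^sub>R n)) \<longlongrightarrow> 0) (at_right 0)"
    using u unfolding has_trace_def AE_lebesgue_on_iff[OF U] AE_lebesgue_on_iff[OF I] by auto
  obtain v2 where v2: "AE p in lborel. p \<in> U \<longrightarrow> v2 p = w p"
    "AE s in lborel. s \<in> I \<longrightarrow> ((\<lambda>h. v2 (\<gamma> s + h *\<^sub>R n)) \<longlongrightarrow> 0) (at_right 0)"
    using w unfolding has_trace_def AE_lebesgue_on_iff[OF U] AE_lebesgue_on_iff[OF I] by auto
  show ?thesis
  proof (rule that[of "\<lambda>p. v2 p - v1 p"])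
    show "AE p in lborel. v2 p - v1 p = d p \<or> p \<notin> U"
      using v1(1) v2(1) d by eventually_elim auto
    show "AE s in lborel. s \<in> I \<longrightarrow> ((\<lambda>h. v2 (\<gamma> s + h *\<^sub>R n) - v1 (\<gamma> s + h *\<^sub>R n)) \<longlongrightarrow> 0) (at_right 0)"
      using v1(2) v2(2)
    proof eventually_elim
      case (elim s)
      show ?case
      proof
        assume "s \<in> I"
        then have "((\<lambda>h. v2 (\<gamma> s + h *\<^sub>R n) - v1 (\<gamma> s + h *\<^sub>R n)) \<longlongrightarrow> 0 - 0) (at_right 0)"
          using elim by (intro tendsto_diff) auto
        then show "((\<lambda>h. v2 (\<gamma> s + h *\<^sub>R n) - v1 (\<gamma> s + h *\<^sub>R n)) \<longlongrightarrow> 0) (at_right 0)" by simp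
      qed
    qed
  qed
qed

lemma bvp_unique:
  assumes X: "X 0 < X 1" and u: "u \<in> Z0 (Dom X)" "bvp_solution X f u" and w: "w \<in> Z0 (Dom X)" "bvp_solution X f w"
  shows "AE p in lebesgue_on (Dom X). w p = u p"
proof -
  let ?I = "{X 0<..<X 1}" and ?J = "{-1<..<1::real}"
  obtain u' P Q S where 1: "borel_rep (Dom X) u u'" "borel_rep (Dom X) P P" "borel_rep (Dom X) Q Q" "borel_rep (Dom X) S S"
    "\<And>\<alpha> \<beta>. test_fun_real ?I \<alpha> \<Longrightarrow> test_fun_real ?J \<beta> \<Longrightarrow>
      (LINT p|lborel. snd p * u' p * (deriv \<alpha> (fst p) * \<beta> (snd p))) = - (LINT p|lborel. P p * (\<alpha> (fst p) * \<beta> (snd p)))"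
    "\<And>\<alpha> \<beta>. test_fun_real ?I \<alpha> \<Longrightarrow> test_fun_real ?J \<beta> \<Longrightarrow>
      (LINT p|lborel. u' p * (\<alpha> (fst p) * deriv \<beta> (snd p))) = - (LINT p|lborel. Q p * (\<alpha> (fst p) * \<beta> (snd p)))"
    "\<And>\<alpha> \<beta>. test_fun_real ?I \<alpha> \<Longrightarrow> test_fun_real ?J \<beta> \<Longrightarrow>
      (LINT p|lborel. Q p * (\<alpha> (fst p) * deriv \<beta> (snd p))) = - (LINT p|lborel. S p * (\<alpha> (fst p) * \<beta> (snd p)))"
    "\<And>\<alpha> \<beta>. test_fun_real ?I \<alpha> \<Longrightarrow> test_fun_real ?J \<beta> \<Longrightarrow>
      (LINT p|lborel. P p * (\<alpha> (fst p) * \<beta> (snd p))) - (LINT p|lborel. S p * (\<alpha> (fst p) * \<beta> (snd p)))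
        = distr_of (Dom X) f (\<lambda>(x, y). \<alpha> x * \<beta> y)"
    using Z0_weak_derivatives[OF u] by blast
  obtain w' P' Q' S' where 2: "borel_rep (Dom X) w w'" "borel_rep (Dom X) P' P'" "borel_rep (Dom X) Q' Q'" "borel_rep (Dom X) S' S'"
    "\<And>\<alpha> \<beta>. test_fun_real ?I \<alpha> \<Longrightarrow> test_fun_real ?J \<beta> \<Longrightarrow>
      (LINT p|lborel. snd p * w' p * (deriv \<alpha> (fst p) * \<beta> (snd p))) = - (LINT p|lborel. P' p * (\<alpha> (fst p) * \<beta> (snd p)))"
    "\<And>\<alpha> \<beta>. test_fun_real ?I \<alpha> \<Longrightarrow> test_fun_real ?J \<beta> \<Longrightarrow>
      (LINT p|lborel. w' p * (\<alpha> (fst p) * deriv \<beta> (snd p))) = - (LINT p|lborel. Q' p * (\<alpha> (fst p) * \<beta> (snd p)))"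
    "\<And>\<alpha> \<beta>. test_fun_real ?I \<alpha> \<Longrightarrow> test_fun_real ?J \<beta> \<Longrightarrow>
      (LINT p|lborel. Q' p * (\<alpha> (fst p) * deriv \<beta> (snd p))) = - (LINT p|lborel. S' p * (\<alpha> (fst p) * \<beta> (snd p)))"
    "\<And>\<alpha> \<beta>. test_fun_real ?I \<alpha> \<Longrightarrow> test_fun_real ?J \<beta> \<Longrightarrow>
      (LINT p|lborel. P' p * (\<alpha> (fst p) * \<beta> (snd p))) - (LINT p|lborel. S' p * (\<alpha> (fst p) * \<beta> (snd p)))
        = distr_of (Dom X) f (\<lambda>(x, y). \<alpha> x * \<beta> y)"
    using Z0_weak_derivatives[OF w] by blast
  define d P0 Q0 S0 where def: "d = (\<lambda>p. w' p - u' p)" "P0 = (\<lambda>p. P' p - P p)" "Q0 = (\<lambda>p. Q' p - Q p)" "S0 = (\<lambda>p. S' p - S p)"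
  have reps: "borel_rep (Dom X) (\<lambda>p. w p - u p) d" "borel_rep (Dom X) P0 P0" "borel_rep (Dom X) Q0 Q0" "borel_rep (Dom X) S0 S0"
    unfolding def by (intro borel_rep_diff 1 2)+
  note dd = borel_repD[OF reps(1)] and PD = borel_repD[OF reps(2)] and QD = borel_repD[OF reps(3)] and SD = borel_repD[OF reps(4)]
  have wt: "integrable lborel (\<lambda>p. h p * (\<alpha> (fst p) * \<beta> (snd p)))"
    if "borel_rep (Dom X) k h" "test_fun_real ?I \<alpha>" "test_fun_real ?J \<beta>" for h k \<alpha> \<beta>
    by (rule integrable_tensor_weight[OF borel_repD(2)[OF that(1)] that(2,3)])
  have minus: "(LINT p|lborel. (h p - k p) * (\<alpha> (fst p) * \<beta> (snd p)))
      = (LINT p|lborel. h p * (\<alpha> (fst p) * \<beta> (snd p))) - (LINT p|lborel. k p * (\<alpha> (fst p) * \<beta> (snd p)))"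
    if "borel_rep (Dom X) h' h" "borel_rep (Dom X) k' k" "test_fun_real ?I \<alpha>" "test_fun_real ?J \<beta>" for h k h' k' \<alpha> \<beta>
    using wt[OF that(1,3,4)] wt[OF that(2,3,4)] by (simp add: left_diff_distrib)
  have bd: "\<exists>v. (AE p in lborel. v p = d p \<or> p \<notin> Dom X) \<and>
      (AE s in lborel. s \<in> I \<longrightarrow> ((\<lambda>h. v (\<gamma> s + h *\<^sub>R n)) \<longlongrightarrow> 0) (at_right 0))"
    if "I \<in> sets borel" "has_trace (Dom X) u I \<gamma> n (\<lambda>_. 0)" "has_trace (Dom X) w I \<gamma> n (\<lambda>_. 0)" for I \<gamma> n
    by (rule has_trace_diff_zero[OF Dom_borel(1) that dd(5)]) blast
  have tr: "has_trace (Dom X) z {0<..<1} (\<lambda>y. (X 0, y)) (1, 0) (\<lambda>_. 0)"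
    "has_trace (Dom X) z {-1<..<0} (\<lambda>y. (X 1, y)) (-1, 0) (\<lambda>_. 0)"
    "has_trace (Dom X) z {X 0<..<X 1} (\<lambda>x. (x, -1)) (0, 1) (\<lambda>_. 0)"
    "has_trace (Dom X) z {X 0<..<X 1} (\<lambda>x. (x, 1)) (0, -1) (\<lambda>_. 0)" if "bvp_solution X f z" for z
    using that by (auto simp: bvp_solution_def)
  obtain v1 where v1: "AE p in lborel. v1 p = d p \<or> p \<notin> Dom X"
    "AE y in lborel. y \<in> {0<..<1} \<longrightarrow> ((\<lambda>h. v1 ((X 0, y) + h *\<^sub>R (1, 0))) \<longlongrightarrow> 0) (at_right 0)"
    using bd[OF _ tr(1)[OF u(2)] tr(1)[OF w(2)]] by auto
  obtain v2 where v2: "AE p in lborel. v2 p = d p \<or> p \<notin> Dom X"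
    "AE y in lborel. y \<in> {-1<..<0} \<longrightarrow> ((\<lambda>h. v2 ((X 1, y) + h *\<^sub>R (-1, 0))) \<longlongrightarrow> 0) (at_right 0)"
    using bd[OF _ tr(2)[OF u(2)] tr(2)[OF w(2)]] by auto
  obtain v3 where v3: "AE p in lborel. v3 p = d p \<or> p \<notin> Dom X"
    "AE x in lborel. x \<in> ?I \<longrightarrow> ((\<lambda>h. v3 ((x, -1) + h *\<^sub>R (0, 1))) \<longlongrightarrow> 0) (at_right 0)"
    using bd[OF _ tr(3)[OF u(2)] tr(3)[OF w(2)]] by auto
  obtain v4 where v4: "AE p in lborel. v4 p = d p \<or> p \<notin> Dom X"
    "AE x in lborel. x \<in> ?I \<longrightarrow> ((\<lambda>h. v4 ((x, 1) + h *\<^sub>R (0, -1))) \<longlongrightarrow> 0) (at_right 0)"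
    using bd[OF _ tr(4)[OF u(2)] tr(4)[OF w(2)]] by auto
  have "AE p in lborel. p \<in> ?I \<times> ?J \<longrightarrow> P0 p - S0 p = 0"
  proof (rule tensor_AE_zero)
    show "integrable lborel (\<lambda>p. P0 p - S0 p)" using PD SD by simp
    fix \<alpha> \<beta> assume ab: "test_fun_real ?I \<alpha>" "test_fun_real ?J \<beta>"
    show "(LINT p|lborel. (P0 p - S0 p) * (\<alpha> (fst p) * \<beta> (snd p))) = 0"
      unfolding minus[OF reps(2,4) ab] unfolding def minus[OF 2(2) 1(2) ab] minus[OF 2(4) 1(4) ab]
      using 1(8)[OF ab] 2(8)[OF ab] by simp
  qed
  then have PS: "AE p in lborel. P0 p = S0 p"
  proof eventually_elim
    case (elim p)
    then show ?case using PD(4)[of p] SD(4)[of p] by (cases "p \<in> Dom X") (simp_all add: Dom_def)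
  qed
  have yd: "(LINT p|lborel. snd p * d p * (deriv \<alpha> (fst p) * \<beta> (snd p))) = - (LINT p|lborel. P0 p * (\<alpha> (fst p) * \<beta> (snd p)))"
    if ab: "test_fun_real ?I \<alpha>" "test_fun_real ?J \<beta>" for \<alpha> \<beta>
  proof -
    \<comment> \<open>The factor y is absorbed into the test function, so that linearity of the
      integral can be used for the representatives \<open>w'\<close> and \<open>u'\<close>
      themselves.\<close>
    have yb: "test_fun_real ?J (\<lambda>y. y * \<beta> y)"
    proof -
      obtain c1 d1 where cd: "-1 < c1" "d1 < 1" "\<And>x. x \<notin> {c1..d1} \<Longrightarrow> \<beta> x = 0"
        by (rule test_fun_real_support_interval[OF ab(2)]) auto
      have "is_jet1 (\<lambda>n (x::real). if n = 0 then x else if n = 1 then 1 else 0)"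
        unfolding is_jet1_def by auto
      from smooth_real_jet1[OF this] have "smooth_real (\<lambda>x. x)" by simp
      then have "smooth_real (\<lambda>y. y * \<beta> y)" by (rule smooth_real_mult[OF _ test_fun_real_smooth[OF ab(2)]])
      then show ?thesis by (rule test_fun_real_supportI[of _ c1 d1]) (use cd in auto)
    qed
    have e: "snd p * k * (deriv \<alpha> (fst p) * \<beta> (snd p)) = k * (deriv \<alpha> (fst p) * (snd p * \<beta> (snd p)))" for k p
      by (simp add: mult_ac)
    have "(LINT p|lborel. snd p * d p * (deriv \<alpha> (fst p) * \<beta> (snd p)))
      = (LINT p|lborel. snd p * w' p * (deriv \<alpha> (fst p) * \<beta> (snd p))) - (LINT p|lborel. snd p * u' p * (deriv \<alpha> (fst p) * \<beta> (snd p)))"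
      unfolding e def(1) by (rule minus[OF 2(1) 1(1) test_fun_real_deriv[OF ab(1)] yb])
    then show ?thesis
      unfolding def minus[OF 2(2) 1(2) ab] using 1(5)[OF ab] 2(5)[OF ab] by simp
  qed
  have dQ: "(LINT p|lborel. d p * (\<alpha> (fst p) * deriv \<beta> (snd p))) = - (LINT p|lborel. Q0 p * (\<alpha> (fst p) * \<beta> (snd p)))"
    if ab: "test_fun_real ?I \<alpha>" "test_fun_real ?J \<beta>" for \<alpha> \<beta>
    unfolding def minus[OF 2(1) 1(1) ab(1) test_fun_real_deriv[OF ab(2)]] minus[OF 2(3) 1(3) ab]
    using 1(6)[OF ab] 2(6)[OF ab] by simp
  have QS: "(LINT p|lborel. Q0 p * (\<alpha> (fst p) * deriv \<beta> (snd p))) = - (LINT p|lborel. S0 p * (\<alpha> (fst p) * \<beta> (snd p)))"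
    if ab: "test_fun_real ?I \<alpha>" "test_fun_real ?J \<beta>" for \<alpha> \<beta>
    unfolding def minus[OF 2(3) 1(3) ab(1) test_fun_real_deriv[OF ab(2)]] minus[OF 2(4) 1(4) ab]
    using 1(7)[OF ab] 2(7)[OF ab] by simp
  have "AE p in lborel. d p = 0"
  proof (rule kinetic_uniqueness[of "X 0" "X 1" "-1" 1 d P0 Q0 S0 v1 v2 v3 v4, folded Dom_def])
    show "p \<notin> Dom X \<Longrightarrow> d p = 0" "p \<notin> Dom X \<Longrightarrow> P0 p = 0" "p \<notin> Dom X \<Longrightarrow> Q0 p = 0" "p \<notin> Dom X \<Longrightarrow> S0 p = 0" for p
      using dd(4) PD(4) QD(4) SD(4) by auto
    show "AE y in lborel. y \<in> {0<..<1} \<longrightarrow> ((\<lambda>h. v1 (X 0 + h, y)) \<longlongrightarrow> 0) (at_right 0)" using v1(2) by simp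
    show "AE y in lborel. y \<in> {-1<..<0} \<longrightarrow> ((\<lambda>h. v2 (X 1 - h, y)) \<longlongrightarrow> 0) (at_right 0)" using v2(2) by simp
    show "AE x in lborel. x \<in> ?I \<longrightarrow> ((\<lambda>h. v3 (x, -1 + h)) \<longlongrightarrow> 0) (at_right 0)" using v3(2) by simp
    show "AE x in lborel. x \<in> ?I \<longrightarrow> ((\<lambda>h. v4 (x, 1 - h)) \<longlongrightarrow> 0) (at_right 0)" using v4(2) by simp
  qed (use X dd PD QD SD yd dQ QS PS v1(1) v2(1) v3(1) v4(1) in \<open>simp_all\<close>)
  then have "AE p in lborel. p \<in> Dom X \<longrightarrow> w p = u p"
    using dd(5) by eventually_elim auto
  then show ?thesis by (simp add: AE_lebesgue_on_iff)
qed

section \<open>Integration by parts for classical derivatives\<close>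

lemma continuous_on_extend_zero:
  fixes f :: "'a::t2_space \<Rightarrow> real"
  assumes f: "continuous_on U f" "open U" and K: "compact K" "K \<subseteq> U" and 0: "\<And>p. p \<in> U - K \<Longrightarrow> f p = 0"
  shows "continuous_on UNIV (\<lambda>p. if p \<in> U then f p else 0)"
proof -
  have "continuous_on (U \<union> (- K)) (\<lambda>p. if p \<in> U then f p else 0)"
    using assms compact_imp_closed[OF K(1)]
    by (intro continuous_on_cases_local_open) (auto intro: open_subset)
  moreover have "U \<union> (- K) = UNIV" using K by auto
  ultimately show ?thesis by simp
qed

lemma integrable_extend_zero:
  fixes f :: "'a::euclidean_space \<Rightarrow> real"
  assumes f: "continuous_on U f" "open U" and K: "compact K" "K \<subseteq> U" and 0: "\<And>p. p \<in> U - K \<Longrightarrow> f p = 0"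
  shows "integrable lborel (\<lambda>p. if p \<in> U then f p else 0)"
proof -
  have "integrable lborel (\<lambda>p. indicator K p *\<^sub>R f p)"
    using f K by (intro borel_integrable_compact continuous_on_subset[OF f(1)])
  moreover have "(\<lambda>p. indicator K p *\<^sub>R f p) = (\<lambda>p. if p \<in> U then f p else 0)"
    using K 0 by (auto simp: fun_eq_iff indicator_def)
  ultimately show ?thesis by simp
qed

text \<open>The product of u and \<phi>, extended by zero, is continuously differentiable with
  bounded support on every horizontal line, so the fundamental theorem gives zero line by line. The
  behaviour of u at the boundary of \<open>U\<close> does not enter, which matters for a solution
  singular there.\<close>

lemma integral_parts_dx:
  fixes u ux \<phi> \<phi>x :: "real \<times> real \<Rightarrow> real"
  assumes U: "open U" and u: "continuous_on U u" "continuous_on U ux"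
    and du: "\<And>x y. (x, y) \<in> U \<Longrightarrow> ((\<lambda>s. u (s, y)) has_real_derivative ux (x, y)) (at x)"
    and \<phi>: "continuous_on U \<phi>" "continuous_on U \<phi>x"
    and d\<phi>: "\<And>x y. (x, y) \<in> U \<Longrightarrow> ((\<lambda>s. \<phi> (s, y)) has_real_derivative \<phi>x (x, y)) (at x)"
    and K: "compact K" "K \<subseteq> U" "\<And>p. p \<in> U - K \<Longrightarrow> \<phi> p = 0" "\<And>p. p \<in> U - K \<Longrightarrow> \<phi>x p = 0"
  shows "(LINT p|lborel. (if p \<in> U then u p * \<phi>x p else 0)) = - (LINT p|lborel. (if p \<in> U then ux p * \<phi> p else 0))"
proof -
  define W where "W p = (if p \<in> U then u p * \<phi> p else 0)" for p
  define D where "D p = (if p \<in> U then u p * \<phi>x p + ux p * \<phi> p else 0)" for p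
  have i: "integrable lborel (\<lambda>p. if p \<in> U then u p * \<phi>x p else 0)" "integrable lborel (\<lambda>p. if p \<in> U then ux p * \<phi> p else 0)"
    "integrable lborel D"
    unfolding D_def by (rule integrable_extend_zero[OF _ U K(1,2)]; use K in \<open>auto intro!: continuous_intros u \<phi>\<close>)+
  have cD: "continuous_on UNIV D"
    unfolding D_def by (rule continuous_on_extend_zero[OF _ U K(1,2)]; use K in \<open>auto intro!: continuous_intros u \<phi>\<close>)
  have dW: "((\<lambda>s. W (s, y)) has_real_derivative D (x, y)) (at x)" for x y
  proof (cases "(x, y) \<in> U")
    case True
    have "open ((\<lambda>s. (s, y)) -` U)" by (intro open_vimage U continuous_intros)
    then have "\<forall>\<^sub>F s in nhds x. (s, y) \<in> U" using True by (auto simp: eventually_nhds)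
    then have "\<forall>\<^sub>F s in nhds x. W (s, y) = u (s, y) * \<phi> (s, y)" by eventually_elim (simp add: W_def)
    then show ?thesis
      using True by (subst DERIV_cong_ev[OF refl _ refl]) (auto intro!: derivative_eq_intros du d\<phi> simp: D_def)
  next
    case False
    have "open ((\<lambda>s. (s, y)) -` (- K))" by (intro open_vimage continuous_intros open_Compl compact_imp_closed K)
    then have "\<forall>\<^sub>F s in nhds x. (s, y) \<notin> K" using False K(2) by (auto simp: eventually_nhds)
    then have "\<forall>\<^sub>F s in nhds x. W (s, y) = 0" by eventually_elim (use K in \<open>auto simp: W_def\<close>)
    then show ?thesis
      using False by (subst DERIV_cong_ev[OF refl _ refl, of _ "\<lambda>_. 0"]) (auto simp: D_def)
  qed
  obtain r where r: "\<And>p. p \<in> K \<Longrightarrow> norm p \<le> r" using compact_imp_bounded[OF K(1)] by (auto simp: bounded_iff)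
  define R where "R = \<bar>r\<bar> + 1"
  have far: "(x, y) \<notin> K" if "\<bar>x\<bar> \<ge> R" for x y
    using r[of "(x, y)"] norm_fst_le[of x y] that by (force simp: R_def)
  have line: "(LINT x|lborel. D (x, y)) = 0" for y
  proof -
    have "(LINT x|lborel. D (x, y)) = (LINT x|lborel. D (x, y) * indicator {-R..R} x)"
    proof (intro Bochner_Integration.integral_cong refl)
      fix x show "D (x, y) = D (x, y) * indicator {-R..R} x"
      proof (cases "x \<in> {-R..R}")
        case False
        then have "(x, y) \<notin> K" by (intro far) auto
        then show ?thesis using K False by (auto simp: D_def)
      qed simp
    qed
    also have "\<dots> = W (R, y) - W (-R, y)"
    proof (rule integral_FTC_Icc_real[OF _ dW])
      have "continuous_on UNIV (\<lambda>s. D (s, y))"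
        by (rule continuous_on_compose2[OF cD]) (auto intro!: continuous_intros)
      then show "isCont (\<lambda>s. D (s, y)) x" for x by (simp add: continuous_on_eq_continuous_at)
    qed (simp add: R_def)
    also have "\<dots> = 0" using far[of R y] far[of "-R" y] K by (auto simp: W_def R_def)
    finally show ?thesis .
  qed
  have "(LINT p|lborel. (if p \<in> U then u p * \<phi>x p else 0)) + (LINT p|lborel. (if p \<in> U then ux p * \<phi> p else 0))
      = (LINT p|lborel. D p)"
    by (subst Bochner_Integration.integral_add[OF i(1,2), symmetric])
       (auto simp: D_def intro!: Bochner_Integration.integral_cong)
  also have "\<dots> = 0" unfolding lborel_fubini_snd(3)[OF i(3)] line by simp
  finally show ?thesis by simp
qed

lemma integral_parts_dy:
  fixes u uy \<phi> \<phi>y :: "real \<times> real \<Rightarrow> real"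
  assumes U: "open U" and u: "continuous_on U u" "continuous_on U uy"
    and du: "\<And>x y. (x, y) \<in> U \<Longrightarrow> ((\<lambda>s. u (x, s)) has_real_derivative uy (x, y)) (at y)"
    and \<phi>: "continuous_on U \<phi>" "continuous_on U \<phi>y"
    and d\<phi>: "\<And>x y. (x, y) \<in> U \<Longrightarrow> ((\<lambda>s. \<phi> (x, s)) has_real_derivative \<phi>y (x, y)) (at y)"
    and K: "compact K" "K \<subseteq> U" "\<And>p. p \<in> U - K \<Longrightarrow> \<phi> p = 0" "\<And>p. p \<in> U - K \<Longrightarrow> \<phi>y p = 0"
  shows "(LINT p|lborel. (if p \<in> U then u p * \<phi>y p else 0)) = - (LINT p|lborel. (if p \<in> U then uy p * \<phi> p else 0))"
proof -
  have i: "integrable lborel (\<lambda>p. if p \<in> U then u p * \<phi>y p else 0)" "integrable lborel (\<lambda>p. if p \<in> U then uy p * \<phi> p else 0)"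
    by (rule integrable_extend_zero[OF _ U K(1,2)]; use K in \<open>auto intro!: continuous_intros u \<phi>\<close>)+
  let ?V = "prod.swap -` U"
  have cs: "continuous_on A (prod.swap :: real \<times> real \<Rightarrow> real \<times> real)" for A
    unfolding prod.swap_def by (intro continuous_intros)
  have c: "continuous_on ?V (\<lambda>p. h (prod.swap p))" if "continuous_on U h" for h :: "real \<times> real \<Rightarrow> real"
    by (rule continuous_on_compose2[OF that cs]) auto
  have "compact (prod.swap ` K)" by (intro compact_continuous_image cs K)
  moreover have "prod.swap ` K = prod.swap -` K" by force
  ultimately have sK: "compact (prod.swap -` K)" by simp
  have "(LINT p|lborel. (if p \<in> ?V then u (prod.swap p) * \<phi>y (prod.swap p) else 0))
      = - (LINT p|lborel. (if p \<in> ?V then uy (prod.swap p) * \<phi> (prod.swap p) else 0))"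
    by (rule integral_parts_dx[OF open_vimage[OF U cs] c[OF u(1)] c[OF u(2)] _ c[OF \<phi>(1)] c[OF \<phi>(2)] _ sK])
       (use K du d\<phi> in auto)
  then show ?thesis using lborel_swap(2)[OF i(1)] lborel_swap(2)[OF i(2)] by simp
qed

section \<open>Asymptotics of linear differential equations\<close>

text \<open>At the last point where f is nonpositive it would be zero with negative derivative,
  hence nonpositive a little later as well.\<close>

lemma stays_nonpos:
  fixes f f' :: "real \<Rightarrow> real"
  assumes d: "\<And>t. t \<in> {a..b} \<Longrightarrow> (f has_real_derivative f' t) (at t)"
    and z: "\<And>t. t \<in> {a..b} \<Longrightarrow> f t = 0 \<Longrightarrow> f' t < 0"
    and "f a \<le> 0" "a \<le> b"
  shows "f b \<le> 0"
proof (rule ccontr)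
  assume "\<not> f b \<le> 0"
  have cont: "continuous_on {a..b} f"
    using d by (meson DERIV_isCont continuous_at_imp_continuous_on)
  define Z where "Z = {t \<in> {a..b}. f t \<le> 0}"
  have "closed Z" unfolding Z_def
    using continuous_closed_preimage[OF cont closed_real_atLeastAtMost, of "{..0}"]
    by (simp add: vimage_def Int_def conj_commute)
  moreover have "bounded Z" by (rule bounded_subset[of "{a..b}"]) (auto simp: Z_def)
  ultimately have "compact Z" by (simp add: compact_eq_bounded_closed)
  moreover have "a \<in> Z" using assms by (auto simp: Z_def)
  ultimately obtain s where s: "s \<in> Z" "\<And>t. t \<in> Z \<Longrightarrow> t \<le> s"
    using compact_attains_sup[of Z] by auto
  have sb: "s \<in> {a..b}" "f s \<le> 0" "s < b"
    using s \<open>\<not> f b \<le> 0\<close> by (auto simp: Z_def order.order_iff_strict)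
  have "f s = 0"
  proof (rule ccontr)
    assume "f s \<noteq> 0"
    then have "f s < 0" using sb by simp
    moreover have "continuous_on {s..b} f" using cont by (rule continuous_on_subset) (use sb in auto)
    ultimately obtain r where "s \<le> r" "r \<le> b" "f r = 0"
      using IVT'[of f s 0 b] \<open>\<not> f b \<le> 0\<close> sb by auto
    then show False using s(2)[of r] \<open>f s \<noteq> 0\<close> sb by (auto simp: Z_def)
  qed
  then obtain h where h: "h > 0" "\<And>k. 0 < k \<Longrightarrow> k < h \<Longrightarrow> f (s + k) < f s"
    using DERIV_neg_dec_right[OF d z] sb by blast
  define k where "k = min (h / 2) (b - s)"
  have "0 < k" "k < h" "s + k \<in> {a..b}" using h sb by (auto simp: k_def min_def)
  then have "s + k \<in> Z" using h(2)[of k] \<open>f s = 0\<close> by (auto simp: Z_def)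
  then show False using s(2) \<open>0 < k\<close> by force
qed

text \<open>The sign \<open>\<sigma>\<close> distinguishes the attracting (1) from the repelling (-1) equilibrium; a solution
  that is bounded along a sequence must approach the repelling one as well.\<close>

lemma asymptotic_upper_bound:
  fixes Q a b c :: "real \<Rightarrow> real" and \<sigma> :: real
  assumes \<sigma>: "\<sigma> = 1 \<or> \<sigma> = -1"
    and d: "\<And>t. t > 0 \<Longrightarrow> (Q has_real_derivative - \<sigma> * a t * (b t * Q t - c t)) (at t)"
    and a: "\<forall>\<^sub>F t in at_top. 1 \<le> a t" and b: "(b \<longlongrightarrow> 1) at_top" and c: "(c \<longlongrightarrow> l) at_top"
    and freq: "\<sigma> = -1 \<Longrightarrow> \<exists>C. \<forall>T. \<exists>t\<ge>T. \<bar>Q t\<bar> \<le> C"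
    and "\<epsilon> > 0"
  shows "\<forall>\<^sub>F t in at_top. Q t \<le> l + \<epsilon>"
proof -
  \<comment> \<open>For \<open>Q\<close> = l + \<epsilon> + s with s \<ge> 0, replacing b by 1 costs
    at most \<delta> (\<bar>l\<bar> + \<epsilon> + s). The two bounds on \<delta> make this at most
    \<epsilon>/4 + s, so the excess s can absorb its own share.\<close>
  define \<delta> where "\<delta> = min 1 (\<epsilon> / (4 * (\<bar>l\<bar> + \<epsilon>)))"
  have "0 < \<delta>" using \<open>\<epsilon> > 0\<close> by (auto simp: \<delta>_def)
  have "\<delta> \<le> 1" by (simp add: \<delta>_def)
  have "\<delta> * (\<bar>l\<bar> + \<epsilon>) \<le> \<epsilon> / (4 * (\<bar>l\<bar> + \<epsilon>)) * (\<bar>l\<bar> + \<epsilon>)"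
    using \<open>\<epsilon> > 0\<close> by (intro mult_right_mono) (auto simp: \<delta>_def)
  also have "\<dots> = \<epsilon> / 4" using \<open>\<epsilon> > 0\<close> by (simp add: field_simps)
  finally have \<delta>l: "\<delta> * (\<bar>l\<bar> + \<epsilon>) \<le> \<epsilon> / 4" .
  define \<eta> where "\<eta> = \<epsilon> / 2"
  have "\<eta> > 0" using \<open>\<epsilon> > 0\<close> by (simp add: \<eta>_def)
  have "\<forall>\<^sub>F t in at_top. 1 - \<delta> < b t \<and> b t < 1 + \<delta> \<and> c t < l + \<epsilon> / 4 \<and> 1 \<le> a t \<and> 0 < t"
    using order_tendstoD[OF b] order_tendstoD(2)[OF c] a eventually_gt_at_top[of 0] \<open>0 < \<delta>\<close> \<open>\<epsilon> > 0\<close>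
    by (intro eventually_conj) auto
  then obtain T where T: "\<And>t. t \<ge> T \<Longrightarrow> 1 - \<delta> < b t \<and> b t < 1 + \<delta> \<and> c t < l + \<epsilon> / 4 \<and> 1 \<le> a t \<and> 0 < t"
    by (auto simp: eventually_at_top_linorder)
  define Q' where "Q' t = - \<sigma> * a t * (b t * Q t - c t)" for t
  have dQ: "(Q has_real_derivative Q' t) (at t)" if "t \<ge> T" for t using d[of t] T[OF that] by (simp add: Q'_def)
  \<comment> \<open>Above the level l + \<epsilon> the solution moves with speed at least \<eta>,
    downwards for \<sigma> = 1 and upwards for \<sigma> = -1. Half of \<epsilon> is spent on the
    errors in b and c.\<close>
  have drift: "\<sigma> * Q' t \<le> - \<eta>" if "t \<ge> T" "l + \<epsilon> \<le> Q t" for t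
  proof -
    define s where "s = Q t - (l + \<epsilon>)"
    have s: "s \<ge> 0" "Q t = l + \<epsilon> + s" using that by (auto simp: s_def)
    have "(1 - b t) * Q t \<le> \<bar>1 - b t\<bar> * \<bar>Q t\<bar>" by (metis abs_ge_self abs_mult)
    also have "\<dots> \<le> \<delta> * (\<bar>l\<bar> + \<epsilon> + s)"
      using T[OF that(1)] s \<open>\<epsilon> > 0\<close> by (intro mult_mono) auto
    also have "\<dots> \<le> \<epsilon> / 4 + 1 * s"
      using \<delta>l mult_right_mono[OF \<open>\<delta> \<le> 1\<close> s(1)] by (simp add: distrib_left)
    finally have "\<eta> \<le> b t * Q t - c t"
      using T[OF that(1)] s by (simp add: \<eta>_def algebra_simps)
    moreover have "1 * (b t * Q t - c t) \<le> a t * (b t * Q t - c t)"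
      using T[OF that(1)] \<open>\<eta> > 0\<close> calculation by (intro mult_right_mono) auto
    ultimately show ?thesis using \<sigma> by (auto simp: Q'_def)
  qed
  have growth: "\<sigma> * (Q t - Q u) \<le> - \<eta> * (t - u)"
    if "T \<le> u" "u \<le> t" "\<And>s. u \<le> s \<Longrightarrow> s \<le> t \<Longrightarrow> l + \<epsilon> \<le> Q s" for u t
  proof (cases "u = t")
    case False
    then have "u < t" using that by simp
    have "\<And>s. u \<le> s \<Longrightarrow> s \<le> t \<Longrightarrow> (Q has_real_derivative Q' s) (at s)" using dQ that by auto
    from MVT2[OF \<open>u < t\<close> this]
    obtain z where z: "u < z" "z < t" "Q t - Q u = (t - u) * Q' z" by auto
    have "(t - u) * (\<sigma> * Q' z) \<le> (t - u) * (- \<eta>)"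
      using z that by (intro mult_left_mono drift) auto
    then show ?thesis using z(3) by (simp add: mult_ac)
  qed simp
  show ?thesis
  proof (cases "\<sigma> = 1")
    case True
    have "\<exists>u\<ge>T. Q u \<le> l + \<epsilon>"
    proof (rule ccontr)
      assume neg: "\<not> (\<exists>u\<ge>T. Q u \<le> l + \<epsilon>)"
      \<comment> \<open>The time in which speed \<eta> uses up the initial excess, with 1 to
        spare.\<close>
      define t where "t = T + (\<bar>Q T - (l + \<epsilon>)\<bar> + 1) / \<eta>"
      have "T \<le> t" using \<open>\<eta> > 0\<close> by (simp add: t_def)
      have "Q t - Q T \<le> - \<eta> * (t - T)" using growth[of T t] neg \<open>T \<le> t\<close> True by force
      also have "\<dots> = - (\<bar>Q T - (l + \<epsilon>)\<bar> + 1)" using \<open>\<eta> > 0\<close> by (simp add: t_def)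
      finally have "Q t \<le> l + \<epsilon>" by linarith
      then show False using neg \<open>T \<le> t\<close> by auto
    qed
    then obtain u where u: "u \<ge> T" "Q u \<le> l + \<epsilon>" by auto
    have "Q t \<le> l + \<epsilon>" if "t \<ge> u" for t
    proof -
      have "Q t - (l + \<epsilon>) \<le> 0"
      proof (rule stays_nonpos[where f="\<lambda>t. Q t - (l + \<epsilon>)" and f'=Q' and a=u and b=t])
        show "((\<lambda>t. Q t - (l + \<epsilon>)) has_real_derivative Q' s) (at s)" if "s \<in> {u..t}" for s
          using dQ[of s] that u by (auto intro!: derivative_eq_intros)
        show "Q' s < 0" if "s \<in> {u..t}" "Q s - (l + \<epsilon>) = 0" for s
          using drift[of s] that u True \<open>\<eta> > 0\<close> by auto
      qed (use u that in auto)
      then show ?thesis by simp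
    qed
    then show ?thesis by (auto simp: eventually_at_top_linorder)
  next
    case False
    then have \<sigma>: "\<sigma> = -1" using \<sigma> by auto
    obtain C where C: "\<And>T. \<exists>t\<ge>T. \<bar>Q t\<bar> \<le> C" using freq \<sigma> by auto
    have "Q u \<le> l + \<epsilon>" if "u \<ge> T" for u
    proof (rule ccontr)
      assume "\<not> Q u \<le> l + \<epsilon>"
      \<comment> \<open>Upward drift at the level prevents a return below it; the solution then
        grows at least linearly, against boundedness along a sequence.\<close>
      have stay: "l + \<epsilon> \<le> Q t" if "t \<ge> u" for t
      proof -
        have "(l + \<epsilon>) - Q t \<le> 0"
        proof (rule stays_nonpos[where f="\<lambda>t. l + \<epsilon> - Q t" and f'="\<lambda>t. - Q' t" and a=u and b=t])
          show "((\<lambda>t. l + \<epsilon> - Q t) has_real_derivative - Q' s) (at s)" if "s \<in> {u..t}" for s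
            using dQ[of s] that \<open>u \<ge> T\<close> by (auto intro!: derivative_eq_intros)
          show "- Q' s < 0" if "s \<in> {u..t}" "l + \<epsilon> - Q s = 0" for s
            using drift[of s] that \<open>u \<ge> T\<close> \<sigma> \<open>\<eta> > 0\<close> by auto
        qed (use that \<open>\<not> Q u \<le> l + \<epsilon>\<close> in auto)
        then show ?thesis by simp
      qed
      obtain t where t: "t \<ge> u + (\<bar>Q u\<bar> + \<bar>C\<bar> + 1) / \<eta>" "\<bar>Q t\<bar> \<le> C" using C by blast
      have ut: "u \<le> t" using t(1) \<open>\<eta> > 0\<close> by (smt (verit) divide_nonneg_pos)
      have "\<eta> * ((\<bar>Q u\<bar> + \<bar>C\<bar> + 1) / \<eta>) \<le> \<eta> * (t - u)"
        using t(1) \<open>\<eta> > 0\<close> by (intro mult_left_mono) auto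
      also have "\<dots> \<le> Q t - Q u" using growth[of u t] stay ut \<open>u \<ge> T\<close> \<sigma> by auto
      finally have "\<bar>Q u\<bar> + \<bar>C\<bar> + 1 \<le> Q t - Q u" using \<open>\<eta> > 0\<close> by simp
      then show False using t(2) by linarith
    qed
    then show ?thesis by (auto simp: eventually_at_top_linorder)
  qed
qed

text \<open>The lower bound is the upper bound for -\<open>Q\<close>, whose equation has -c in place
  of c.\<close>

lemma asymptotic_limit:
  fixes Q a b c :: "real \<Rightarrow> real" and \<sigma> :: real
  assumes \<sigma>: "\<sigma> = 1 \<or> \<sigma> = -1"
    and d: "\<And>t. t > 0 \<Longrightarrow> (Q has_real_derivative - \<sigma> * a t * (b t * Q t - c t)) (at t)"
    and a: "\<forall>\<^sub>F t in at_top. 1 \<le> a t" and b: "(b \<longlongrightarrow> 1) at_top" and c: "(c \<longlongrightarrow> l) at_top"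
    and freq: "\<exists>C. \<forall>T. \<exists>t\<ge>T. \<bar>Q t\<bar> \<le> C"
  shows "(Q \<longlongrightarrow> l) at_top"
proof (rule tendstoI)
  fix e :: real assume "e > 0"
  have "((\<lambda>t. - Q t) has_real_derivative - \<sigma> * a t * (b t * (- Q t) - (- c t))) (at t)" if "t > 0" for t
    using DERIV_minus[OF d[OF that]] by (simp add: algebra_simps)
  from asymptotic_upper_bound[OF \<sigma> this a b tendsto_minus[OF c], of "e / 2"]
  have "\<forall>\<^sub>F t in at_top. - Q t \<le> - l + e / 2" using freq \<open>e > 0\<close> by simp
  moreover have "\<forall>\<^sub>F t in at_top. Q t \<le> l + e / 2"
    using asymptotic_upper_bound[OF \<sigma> d a b c, of "e / 2"] freq \<open>e > 0\<close> by simp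
  ultimately show "\<forall>\<^sub>F t in at_top. dist (Q t) l < e"
    by eventually_elim (use \<open>e > 0\<close> in \<open>simp add: dist_real_def abs_if\<close>)
qed

section \<open>The self-similar profile\<close>

text \<open>With \<open>g t = (1 + t\<^sup>2) powr (1 / 4) * \<Lambda> t\<close> the singular solution is
  \<open>x powr (1 / 6) * g (y * x powr (- 1 / 3))\<close>, and the equation becomes the differential equation assumed here.\<close>

locale profile =
  fixes g g1 :: "real \<Rightarrow> real"
  assumes g_deriv: "(g has_real_derivative g1 t) (at t)"
    and g1_deriv: "(g1 has_real_derivative t * (g t / 6 - t * g1 t / 3)) (at t)"
    and lim_top: "((\<lambda>t. t powr (-1/2) * g t) \<longlongrightarrow> 0) at_top"
    and lim_bot: "((\<lambda>t. t powr (-1/2) * g (- t)) \<longlongrightarrow> 1) at_top"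
begin

text \<open>The derivatives of g: the third equation is g'' = t g / 6 - t^2 g' / 3 differentiated k
  times by Leibniz. At k = 0 the truncated index \<open>k - 1\<close> is harmless because its
  coefficient vanishes.\<close>

fun gam :: "nat \<Rightarrow> real \<Rightarrow> real" where
  "gam 0 t = g t"
| "gam (Suc 0) t = g1 t"
| "gam (Suc (Suc k)) t = (1/6 - 2 * real k / 3) * t * gam k t
      + (real k / 6 - real k * (real k - 1) / 3) * gam (k - 1) t - t\<^sup>2 / 3 * gam (Suc k) t"

lemma gam_deriv: "(gam k has_real_derivative gam (Suc k) t) (at t)"
proof (induction k arbitrary: t rule: less_induct)
  case (less k)
  have e: "gam 0 = g" "gam (Suc 0) = g1" by auto
  consider "k = 0" | "k = Suc 0" | "k = Suc (Suc 0)" | i where "k = Suc (Suc (Suc i))"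
    by (metis not0_implies_Suc)
  then show ?case
  proof cases
    case 1
    then show ?thesis using g_deriv e by simp
  next
    case 2
    have "gam (Suc (Suc 0)) t = t * (g t / 6 - t * g1 t / 3)" by (simp add: field_simps power2_eq_square)
    then show ?thesis using g1_deriv[of t] unfolding 2 e by metis
  next
    case 3
    have "((\<lambda>t. 1/6 * t * gam 0 t - t\<^sup>2 / 3 * gam (Suc 0) t) has_real_derivative
       (1/6 * gam 0 t + 1/6 * t * gam (Suc 0) t) - (2 * t / 3 * gam (Suc 0) t + t\<^sup>2 / 3 * gam (Suc (Suc 0)) t)) (at t)"
      using less[of 0 t] less[of "Suc 0" t] 3
      by (auto intro!: derivative_eq_intros simp: field_simps simp del: gam.simps)
    moreover have "gam k = (\<lambda>t. 1/6 * t * gam 0 t - t\<^sup>2 / 3 * gam (Suc 0) t)"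
      unfolding 3 by (auto simp: fun_eq_iff)
    moreover have "gam (Suc k) t = (1/6 * gam 0 t + 1/6 * t * gam (Suc 0) t) - (2 * t / 3 * gam (Suc 0) t + t\<^sup>2 / 3 * gam (Suc (Suc 0)) t)"
      unfolding 3 gam.simps(3)[of "Suc 0"] by (simp add: algebra_simps del: gam.simps)
    ultimately show ?thesis by metis
  next
    case 4
    let ?A = "1/6 - 2 * real (Suc i) / 3" and ?B = "real (Suc i) / 6 - real (Suc i) * (real (Suc i) - 1) / 3"
    have "((\<lambda>t. ?A * t * gam (Suc i) t + ?B * gam i t - t\<^sup>2 / 3 * gam (Suc (Suc i)) t) has_real_derivative
        (?A * gam (Suc i) t + ?A * t * gam (Suc (Suc i)) t) + ?B * gam (Suc i) t
         - (2 * t / 3 * gam (Suc (Suc i)) t + t\<^sup>2 / 3 * gam (Suc (Suc (Suc i))) t)) (at t)"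
      using less[of i t] less[of "Suc i" t] less[of "Suc (Suc i)" t] 4
      by (auto intro!: derivative_eq_intros simp: field_simps simp del: gam.simps)
    moreover have "gam k = (\<lambda>t. ?A * t * gam (Suc i) t + ?B * gam i t - t\<^sup>2 / 3 * gam (Suc (Suc i)) t)"
      unfolding 4 by (rule ext) (simp only: gam.simps diff_Suc_1)
    moreover have "gam (Suc k) t = (?A * gam (Suc i) t + ?A * t * gam (Suc (Suc i)) t) + ?B * gam (Suc i) t
         - (2 * t / 3 * gam (Suc (Suc i)) t + t\<^sup>2 / 3 * gam (Suc (Suc (Suc i))) t)"
      unfolding 4 gam.simps(3)[of "Suc (Suc i)"] diff_Suc_1
      by (simp add: field_simps del: gam.simps)
    ultimately show ?thesis by metis
  qed
qed

text \<open>Each x-derivative lowers the power of x by 1 and each y-derivative by 1/3. Hence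
  \<open>3 * e j k\<close> is the degree of homogeneity when x has weight 3 and y weight 1.\<close>

definition e :: "nat \<Rightarrow> nat \<Rightarrow> real" where "e j k = 1/6 - real j - real k / 3"

text \<open>The derivative of order j in x and k in y of the singular solution is \<open>x powr e j k * G j k t\<close>.\<close>

fun G :: "nat \<Rightarrow> nat \<Rightarrow> real \<Rightarrow> real" where
  "G 0 k t = gam k t"
| "G (Suc j) k t = e j k * G j k t - t / 3 * G j (Suc k) t"

lemma G_deriv: "(G j k has_real_derivative G j (Suc k) t) (at t)"
proof (induction j arbitrary: k t)
  case 0
  have "G 0 k = gam k" by auto
  then show ?case using gam_deriv by (metis G.simps(1))
next
  case (Suc j)
  have "((\<lambda>t. e j k * G j k t - t / 3 * G j (Suc k) t) has_real_derivative
      e j k * G j (Suc k) t - (1 / 3 * G j (Suc k) t + t / 3 * G j (Suc (Suc k)) t)) (at t)"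
    using Suc[of k t] Suc[of "Suc k" t] by (auto intro!: derivative_eq_intros simp: field_simps simp del: G.simps)
  moreover have "G (Suc j) k = (\<lambda>t. e j k * G j k t - t / 3 * G j (Suc k) t)" by (simp add: fun_eq_iff)
  moreover have "G (Suc j) (Suc k) t = e j k * G j (Suc k) t - (1 / 3 * G j (Suc k) t + t / 3 * G j (Suc (Suc k)) t)"
    by (simp add: e_def field_simps)
  ultimately show ?case by metis
qed

lemma G_continuous: "continuous_on UNIV (G j k)"
  using DERIV_isCont[OF G_deriv] by (intro continuous_at_imp_continuous_on) blast

text \<open>This is the equation y v_x = v_yy differentiated j times in x and k times in y, read off
  on the profiles. Unlike the recursion that defines \<open>G\<close>, whose leading terms cancel at
  infinity, it passes to the next x-order with the sharp power of t.\<close>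

lemma G_rel: "t * G (Suc j) k t + real k * G (Suc j) (k - 1) t = G j (Suc (Suc k)) t"
proof (induction j arbitrary: k)
  case 0
  show ?case
  proof (cases k)
    case 0
    then show ?thesis by (simp add: e_def algebra_simps power2_eq_square)
  next
    case (Suc i)
    then show ?thesis by (simp add: e_def field_simps power2_eq_square del: gam.simps(1,2))
  qed
next
  case (Suc j)
  have "G (Suc j) (Suc (Suc k)) t = e j (Suc (Suc k)) * (t * G (Suc j) k t + real k * G (Suc j) (k - 1) t)
     - t / 3 * (t * G (Suc j) (Suc k) t + real (Suc k) * G (Suc j) k t)"
    using Suc[of k] Suc[of "Suc k"] by simp
  also have "\<dots> = t * G (Suc (Suc j)) k t + real k * G (Suc (Suc j)) (k - 1) t"
  proof (cases k)
    case 0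
    then show ?thesis unfolding G.simps(2)[of "Suc j"] by (simp add: e_def algebra_simps del: G.simps)
  next
    case (Suc i)
    then show ?thesis unfolding G.simps(2)[of "Suc j"] by (simp add: e_def field_simps del: G.simps)
  qed
  finally show ?case ..
qed

section \<open>Power asymptotics of the profiles\<close>

declare G.simps(2) [simp del] gam.simps(3) [simp del]

text \<open>g is of order t^(1/2), and each derivative is expected to lose one power;
  \<open>M\<close> divides by that order, on the positive or the negative ray according to
  \<sigma>.\<close>

definition M :: "real \<Rightarrow> nat \<Rightarrow> real \<Rightarrow> real" where
  "M \<sigma> k t = t powr (real k - 1/2) * gam k (\<sigma> * t)"

lemma M_deriv:
  assumes "t > 0"
  shows "(M \<sigma> k has_real_derivative ((real k - 1/2) * M \<sigma> k t + \<sigma> * M \<sigma> (Suc k) t) / t) (at t)"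
proof -
  have "((\<lambda>t. gam k (\<sigma> * t)) has_real_derivative gam (Suc k) (\<sigma> * t) * \<sigma>) (at t)"
    by (rule DERIV_chain2[OF gam_deriv]) (auto intro!: derivative_eq_intros)
  moreover have "((\<lambda>t. t powr (real k - 1/2)) has_real_derivative (real k - 1/2) * t powr (real k - 1/2 - 1)) (at t)"
    by (rule has_real_derivative_powr[OF assms])
  ultimately have "((\<lambda>t. t powr (real k - 1/2) * gam k (\<sigma> * t)) has_real_derivative
     (real k - 1/2) * t powr (real k - 1/2 - 1) * gam k (\<sigma> * t) + gam (Suc k) (\<sigma> * t) * \<sigma> * t powr (real k - 1/2)) (at t)"
    by (rule DERIV_mult[rotated])
  moreover have p1: "t powr (real k - 1/2 - 1) = t powr (real k - 1/2) / t"
  proof -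
    have "t powr 1 = t" using assms by simp
    then show ?thesis by (simp only: powr_diff)
  qed
  moreover have p2: "t powr (real (Suc k) - 1/2) = t * t powr (real k - 1/2)"
  proof -
    have "real (Suc k) - 1/2 = 1 + (real k - 1/2)" by simp
    then show ?thesis using assms by (simp only: powr_add powr_one)
  qed
  moreover have "(real k - 1/2) * (p / t) * a + b * \<sigma> * p = ((real k - 1/2) * (p * a) + \<sigma> * (t * p * b)) / t" for p a b
    using assms by (simp add: field_simps)
  ultimately show ?thesis
    unfolding M_def[abs_def] by (simp only: p1 p2)
qed

text \<open>In this shape the equation fits the asymptotic lemma: the rate t^2/3 is unbounded, the
  coefficient of the unknown tends to 1, and the forcing involves only lower orders, which converge
  by induction.\<close>

lemma M_ode:
  assumes "t > 0" and \<sigma>: "\<sigma> = 1 \<or> \<sigma> = -1"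
  shows "(M \<sigma> (Suc k) has_real_derivative - \<sigma> * (t\<^sup>2 / 3) * ((1 - 3 * \<sigma> * (real k + 1/2) / t ^ 3) * M \<sigma> (Suc k) t
      - (3 * \<sigma> * (1/6 - 2 * real k / 3) * M \<sigma> k t + 3 * (real k / 6 - real k * (real k - 1) / 3) * M \<sigma> (k - 1) t))) (at t)"
proof -
  let ?p = "t powr (real k - 1/2)"
  have p: "t powr (real (Suc k) - 1/2) = t * ?p" "t powr (real (Suc (Suc k)) - 1/2) = t\<^sup>2 * ?p"
    using assms powr_add[of t "real k - 1/2" 1] powr_add[of t "real k - 1/2" 2]
    by (simp_all add: algebra_simps)
  \<comment> \<open>The factor \<open>real k\<close> covers k = 0, where the truncated
    \<open>k - 1\<close> would give the wrong power.\<close>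
  have pm: "real k * (t\<^sup>2 * t powr (real (k - 1) - 1/2)) = real k * (t * ?p)"
  proof (cases k)
    case (Suc i)
    have "t powr (real i + 1/2) = t * t powr (real i - 1/2)"
      using assms powr_add[of t "real i - 1/2" 1] by (simp add: algebra_simps)
    then show ?thesis using Suc by (simp add: power2_eq_square algebra_simps)
  qed simp
  have ss: "\<sigma> * \<sigma> = 1" using \<sigma> by auto
  have B: "(real k / 6 - real k * (real k - 1) / 3) = real k * (1/6 - (real k - 1) / 3)" by (simp add: field_simps)
  have "\<sigma> * M \<sigma> (Suc (Suc k)) t = \<sigma> * (t\<^sup>2 * ?p) * ((1/6 - 2 * real k / 3) * (\<sigma> * t) * gam k (\<sigma> * t)
      + real k * (1/6 - (real k - 1) / 3) * gam (k - 1) (\<sigma> * t) - (\<sigma> * t)\<^sup>2 / 3 * gam (Suc k) (\<sigma> * t))"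
    unfolding M_def p gam.simps B by simp
  also have "\<dots> = t ^ 3 * (\<sigma> * \<sigma>) * (1/6 - 2 * real k / 3) * (?p * gam k (\<sigma> * t))
      + \<sigma> * t * (1/6 - (real k - 1) / 3) * (real k * (t * ?p)) * gam (k - 1) (\<sigma> * t)
      - \<sigma> * (\<sigma> * \<sigma>) * t ^ 3 / 3 * (t * ?p * gam (Suc k) (\<sigma> * t))"
    by (simp add: algebra_simps power2_eq_square power3_eq_cube del: gam.simps)
  also have "\<dots> = t ^ 3 * (1/6 - 2 * real k / 3) * M \<sigma> k t
      + \<sigma> * t * (1/6 - (real k - 1) / 3) * (real k * t\<^sup>2) * M \<sigma> (k - 1) t
      - \<sigma> * t ^ 3 / 3 * M \<sigma> (Suc k) t"
    unfolding pm[symmetric] M_def p ss by (simp add: algebra_simps del: gam.simps)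
  finally have eq: "\<sigma> * M \<sigma> (Suc (Suc k)) t = t ^ 3 * (1/6 - 2 * real k / 3) * M \<sigma> k t
      + \<sigma> * t * (1/6 - (real k - 1) / 3) * (real k * t\<^sup>2) * M \<sigma> (k - 1) t
      - \<sigma> * t ^ 3 / 3 * M \<sigma> (Suc k) t" .
  define m0 m1 m2 where m: "m0 = M \<sigma> (k - 1) t" "m1 = M \<sigma> k t" "m2 = M \<sigma> (Suc k) t"
  have "((real (Suc k) - 1/2) * m2 + \<sigma> * M \<sigma> (Suc (Suc k)) t) / t
    = - \<sigma> * (t\<^sup>2 / 3) * ((1 - 3 * \<sigma> * (real k + 1/2) / t ^ 3) * m2
      - (3 * \<sigma> * (1/6 - 2 * real k / 3) * m1 + 3 * (real k / 6 - real k * (real k - 1) / 3) * m0))"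
    unfolding eq m[symmetric] using \<sigma> \<open>t > 0\<close>
    by (auto simp: field_simps power2_eq_square power3_eq_cube)
  then show ?thesis using M_deriv[OF assms(1), of \<sigma> "Suc k"] unfolding m by simp
qed

text \<open>Strong induction on the order. The start is the behaviour of the profile at the two
  ends; on the repelling side, convergence also needs boundedness along a sequence, which comes from
  the previous order.\<close>

lemma M_limit:
  assumes \<sigma>: "\<sigma> = 1 \<or> \<sigma> = -1"
  shows "\<exists>L. (M \<sigma> k \<longlongrightarrow> L) at_top"
proof (induction k rule: less_induct)
  case (less k)
  show ?case
  proof (cases k)
    case 0
    have "M \<sigma> 0 = (\<lambda>t. t powr (-1/2) * g (\<sigma> * t))" by (simp add: M_def fun_eq_iff)
    then show ?thesis using 0 \<sigma> lim_top lim_bot by auto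
  next
    case (Suc i)
    obtain L where L: "(M \<sigma> i \<longlongrightarrow> L) at_top" using less Suc by auto
    have "i - 1 < k" using Suc by simp
    then obtain L' where L': "(M \<sigma> (i - 1) \<longlongrightarrow> L') at_top" using less by blast
    let ?a = "\<lambda>t :: real. t\<^sup>2 / 3" and ?b = "\<lambda>t. 1 - 3 * \<sigma> * (real i + 1/2) / t ^ 3"
    let ?c = "\<lambda>t. 3 * \<sigma> * (1/6 - 2 * real i / 3) * M \<sigma> i t + 3 * (real i / 6 - real i * (real i - 1) / 3) * M \<sigma> (i - 1) t"
    let ?l = "3 * \<sigma> * (1/6 - 2 * real i / 3) * L + 3 * (real i / 6 - real i * (real i - 1) / 3) * L'"
    have "(M \<sigma> (Suc i) \<longlongrightarrow> ?l) at_top"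
    proof (rule asymptotic_limit[OF \<sigma> M_ode[OF _ \<sigma>]])
      have "filterlim (\<lambda>t :: real. t ^ 3) at_top at_top" by (intro filterlim_pow_at_top filterlim_ident) simp
      then have "((\<lambda>t. 3 * \<sigma> * (real i + 1/2) / t ^ 3) \<longlongrightarrow> 0) at_top"
        by (intro tendsto_divide_0[OF tendsto_const] filterlim_at_top_imp_at_infinity)
      then show "(?b \<longlongrightarrow> 1) at_top" using tendsto_diff[OF tendsto_const, of _ 0 at_top "1 :: real"] by fastforce
      show "(?c \<longlongrightarrow> ?l) at_top" by (intro tendsto_intros L L')
      show "\<forall>\<^sub>F t in at_top. 1 \<le> ?a t"
        using eventually_ge_at_top[of 3]
      proof eventually_elim
        case (elim t)
        then have "3 * 3 \<le> t * t" by (intro mult_mono) auto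
        then show ?case by (simp add: power2_eq_square)
      qed
      obtain C where C0: "\<forall>\<^sub>F t in at_top. \<bar>M \<sigma> i t\<bar> \<le> C"
      proof -
        have "\<forall>\<^sub>F t in at_top. dist (M \<sigma> i t) L < 1" using L by (rule tendstoD) simp
        then have "\<forall>\<^sub>F t in at_top. \<bar>M \<sigma> i t\<bar> \<le> \<bar>L\<bar> + 1" by (rule eventually_mono) (simp add: dist_real_def)
        then show ?thesis by (rule that)
      qed
      then obtain T0 where C: "\<And>t. t \<ge> T0 \<Longrightarrow> \<bar>M \<sigma> i t\<bar> \<le> C" by (auto simp: eventually_at_top_linorder)
      \<comment> \<open>The mean value theorem on [u, 2u] bounds the next order at an intermediate
        point z by the current one: z / u < 2 times an increment of at most 2C gives 4C, and the
        remaining term comes from differentiating the power in \<open>M\<close>.\<close>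
      have "\<exists>t\<ge>T. \<bar>M \<sigma> (Suc i) t\<bar> \<le> 4 * C + \<bar>real i - 1/2\<bar> * C" for T
      proof -
        define u where "u = max (max T T0) 1"
        have u: "u > 0" "u \<ge> T" "u \<ge> T0" by (auto simp: u_def)
        have "u < 2 * u" using u by simp
        have "(M \<sigma> i has_real_derivative ((real i - 1/2) * M \<sigma> i t + \<sigma> * M \<sigma> (Suc i) t) / t) (at t)"
          if "u \<le> t" for t using that u by (intro M_deriv) auto
        from MVT2[OF \<open>u < 2 * u\<close> this]
        obtain z where z: "u < z" "z < 2 * u"
          "M \<sigma> i (2 * u) - M \<sigma> i u = (2 * u - u) * (((real i - 1/2) * M \<sigma> i z + \<sigma> * M \<sigma> (Suc i) z) / z)" by auto
        have "\<sigma> * M \<sigma> (Suc i) z = z / u * (M \<sigma> i (2 * u) - M \<sigma> i u) - (real i - 1/2) * M \<sigma> i z"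
          using z u by (simp add: field_simps)
        then have "\<bar>\<sigma> * M \<sigma> (Suc i) z\<bar> \<le> \<bar>z / u * (M \<sigma> i (2 * u) - M \<sigma> i u)\<bar> + \<bar>(real i - 1/2) * M \<sigma> i z\<bar>"
          by linarith
        also have "\<bar>z / u * (M \<sigma> i (2 * u) - M \<sigma> i u)\<bar> \<le> 2 * (2 * C)"
          unfolding abs_mult using z u C[of u] C[of "2 * u"] by (intro mult_mono) (auto simp: field_simps)
        also have "\<bar>(real i - 1/2) * M \<sigma> i z\<bar> \<le> \<bar>real i - 1/2\<bar> * C"
          unfolding abs_mult using z u C[of z] by (intro mult_left_mono) auto
        finally have "\<bar>\<sigma> * M \<sigma> (Suc i) z\<bar> \<le> 4 * C + \<bar>real i - 1/2\<bar> * C" by simp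
        then show ?thesis using z u \<sigma> by (intro exI[of _ z]) auto
      qed
      then show "\<exists>C. \<forall>T. \<exists>t\<ge>T. \<bar>M \<sigma> (Suc i) t\<bar> \<le> C" by blast
    qed
    then show ?thesis using Suc by auto
  qed
qed

text \<open>\<open>G_rel\<close> divided by t expresses order j + 1 in x by order j with two more
  y-derivatives and by a lower y-order, whence the nested induction. The powers match because three
  y-derivatives weigh as much as one x-derivative.\<close>

lemma G_limit:
  assumes \<sigma>: "\<sigma> = 1 \<or> \<sigma> = -1"
  shows "\<exists>L. ((\<lambda>t. t powr (- 3 * e j k) * G j k (\<sigma> * t)) \<longlongrightarrow> L) at_top"
proof (induction j arbitrary: k)
  case 0
  have "(\<lambda>t. t powr (- 3 * e 0 k) * G 0 k (\<sigma> * t)) = M \<sigma> k"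
    by (simp add: M_def fun_eq_iff e_def algebra_simps)
  then show ?case using M_limit[OF \<sigma>] by metis
next
  case (Suc j)
  show ?case
  proof (induction k)
    case (0)
    obtain L where L: "((\<lambda>t. t powr (- 3 * e j (Suc (Suc 0))) * G j (Suc (Suc 0)) (\<sigma> * t)) \<longlongrightarrow> L) at_top"
      using Suc by blast
    have "((\<lambda>t. t powr (- 3 * e (Suc j) 0) * G (Suc j) 0 (\<sigma> * t)) \<longlongrightarrow> \<sigma> * L) at_top"
    proof (rule Lim_transform_eventually[OF tendsto_mult_left[OF L, of \<sigma>]])
      show "\<forall>\<^sub>F t in at_top. \<sigma> * (t powr (- 3 * e j (Suc (Suc 0))) * G j (Suc (Suc 0)) (\<sigma> * t))
          = t powr (- 3 * e (Suc j) 0) * G (Suc j) 0 (\<sigma> * t)"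
        using eventually_gt_at_top[of 0]
      proof eventually_elim
        case (elim t)
        have "- 3 * e (Suc j) 0 = - 3 * e j (Suc (Suc 0)) + 1" by (simp add: e_def)
        then have p: "t powr (- 3 * e (Suc j) 0) = t powr (- 3 * e j (Suc (Suc 0))) * t"
          using elim by (simp only: powr_add powr_one)
        show ?case
          unfolding p G_rel[of "\<sigma> * t" j 0, symmetric] using \<sigma> by (auto simp: mult_ac simp del: G.simps)
      qed
    qed
    then show ?case by blast
  next
    case (Suc k)
    obtain L' where L': "((\<lambda>t. t powr (- 3 * e (Suc j) k) * G (Suc j) k (\<sigma> * t)) \<longlongrightarrow> L') at_top"
      using Suc by blast
    obtain L where L: "((\<lambda>t. t powr (- 3 * e j (Suc (Suc (Suc k)))) * G j (Suc (Suc (Suc k))) (\<sigma> * t)) \<longlongrightarrow> L) at_top"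
      using \<open>\<And>k. \<exists>L. ((\<lambda>t. t powr (- 3 * e j k) * G j k (\<sigma> * t)) \<longlongrightarrow> L) at_top\<close> by blast
    have "((\<lambda>t. t powr (- 3 * e (Suc j) (Suc k)) * G (Suc j) (Suc k) (\<sigma> * t)) \<longlongrightarrow> \<sigma> * (L - real (Suc k) * L')) at_top"
    proof (rule Lim_transform_eventually[OF tendsto_mult_left[OF tendsto_diff[OF L tendsto_mult_left[OF L']]]])
      show "\<forall>\<^sub>F t in at_top. \<sigma> * (t powr (- 3 * e j (Suc (Suc (Suc k)))) * G j (Suc (Suc (Suc k))) (\<sigma> * t)
            - real (Suc k) * (t powr (- 3 * e (Suc j) k) * G (Suc j) k (\<sigma> * t)))
          = t powr (- 3 * e (Suc j) (Suc k)) * G (Suc j) (Suc k) (\<sigma> * t)"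
        using eventually_gt_at_top[of 0]
      proof eventually_elim
        case (elim t)
        have "- 3 * e (Suc j) (Suc k) = - 3 * e j (Suc (Suc (Suc k))) + 1" by (simp add: e_def field_simps)
        then have p: "t powr (- 3 * e (Suc j) (Suc k)) = t powr (- 3 * e j (Suc (Suc (Suc k)))) * t"
          using elim by (simp only: powr_add powr_one)
        have q: "- 3 * e (Suc j) k = - 3 * e j (Suc (Suc (Suc k)))" by (simp add: e_def field_simps)
        show ?case
          unfolding p q G_rel[of "\<sigma> * t" j "Suc k", symmetric] diff_Suc_1
          using \<sigma> by (auto simp: algebra_simps simp del: G.simps)
      qed
    qed
    then show ?case by blast
  qed
qed

section \<open>The derivatives on the closed half plane\<close>

definition L :: "real \<Rightarrow> nat \<Rightarrow> nat \<Rightarrow> real" where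
  "L \<sigma> j k = Lim at_top (\<lambda>t. t powr (- 3 * e j k) * G j k (\<sigma> * t))"

lemma tendsto_L:
  assumes "\<sigma> = 1 \<or> \<sigma> = -1"
  shows "((\<lambda>t. t powr (- 3 * e j k) * G j k (\<sigma> * t)) \<longlongrightarrow> L \<sigma> j k) at_top"
proof -
  obtain l where l: "((\<lambda>t. t powr (- 3 * e j k) * G j k (\<sigma> * t)) \<longlongrightarrow> l) at_top"
    using G_limit[OF assms] by blast
  from tendsto_Lim[OF trivial_limit_at_top_linorder this] l show ?thesis unfolding L_def by simp
qed

lemma L_pos: "L 1 0 0 = 0"
  unfolding L_def using lim_top by (intro tendsto_Lim) (simp_all add: e_def)

text \<open>For large \<bar>t\<bar> the profile is close to \<open>L\<close> times \<bar>t\<bar> to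
  the power \<open>3 * e j k\<close>; the power of x in front then cancels and leaves the power of
  \<bar>y\<bar> put in at x = 0.\<close>

definition V :: "nat \<Rightarrow> nat \<Rightarrow> real \<times> real \<Rightarrow> real" where
  "V j k p = (if fst p > 0 then fst p powr e j k * G j k (snd p * fst p powr (-1/3))
     else \<bar>snd p\<bar> powr (3 * e j k) * L (sgn (snd p)) j k)"

text \<open>Isolates the quantity that converges as \<bar>t\<bar> tends to infinity; the remaining
  factor depends on y alone.\<close>

lemma V_eq:
  assumes "x > 0" "y \<noteq> 0"
  shows "V j k (x, y) = \<bar>y\<bar> powr (3 * e j k) *
    ((\<bar>y\<bar> * x powr (-1/3)) powr (- 3 * e j k) * G j k (sgn y * (\<bar>y\<bar> * x powr (-1/3))))"
proof -
  have "(\<bar>y\<bar> * x powr (-1/3)) powr (- 3 * e j k) = \<bar>y\<bar> powr (- 3 * e j k) * x powr (e j k)"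
    using assms by (simp add: powr_mult powr_powr)
  moreover have "\<bar>y\<bar> powr (3 * e j k) * \<bar>y\<bar> powr (- 3 * e j k) = 1"
    using assms by (simp flip: powr_add)
  moreover have "sgn y * (\<bar>y\<bar> * x powr (-1/3)) = y * x powr (-1/3)" by (simp add: sgn_mult_abs flip: mult.assoc)
  ultimately show ?thesis using assms(1) by (simp add: V_def mult.assoc[symmetric])
qed

abbreviation halfplane :: "(real \<times> real) set" where "halfplane \<equiv> {p. 0 \<le> fst p} - {(0, 0)}"

text \<open>Approach through x > 0 sends \<bar>t\<bar> to infinity, and approach within the line x =
  0 uses the explicit power. The sign of y is constant near the point, so one value of
  \<open>L\<close> serves both.\<close>

lemma V_tendsto_boundary:
  assumes "y0 \<noteq> 0"
  shows "(V j k \<longlongrightarrow> V j k (0, y0)) (at (0, y0) within {p. 0 \<le> fst p})"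
proof -
  let ?F = "at (0, y0) within {p. 0 < fst p}"
  have y: "((\<lambda>p. \<bar>snd p\<bar>) \<longlongrightarrow> \<bar>y0\<bar>) ?F" by (auto intro!: tendsto_eq_intros)
  have sgn_ev: "\<forall>\<^sub>F p in at (0, y0) within S. sgn (snd p) = sgn y0" for S
  proof -
    have "(snd \<longlongrightarrow> y0) (at (0, y0) within S)" by (auto intro!: tendsto_eq_intros)
    then have "\<forall>\<^sub>F p in at (0, y0) within S. dist (snd p) y0 < \<bar>y0\<bar>" by (rule tendstoD) (use assms in simp)
    then show ?thesis by (rule eventually_mono) (use assms in \<open>auto simp: dist_real_def sgn_if\<close>)
  qed
  have "filterlim fst (at_right 0) ?F"
    unfolding filterlim_at eventually_at_filter
    by (intro conjI always_eventually) (auto intro!: tendsto_eq_intros)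
  moreover have "filterlim (\<lambda>x :: real. x powr (-1/3)) at_top (at_right 0)"
  proof -
    have "filterlim (\<lambda>x :: real. - ln x) at_top (at_right 0)"
      using ln_at_0 by (simp add: filterlim_uminus_at_bot)
    then have "filterlim (\<lambda>x :: real. 1/3 * (- ln x)) at_top (at_right 0)"
      by (rule filterlim_tendsto_pos_mult_at_top[OF tendsto_const, rotated]) simp
    from filterlim_compose[OF exp_at_top this]
    have "filterlim (\<lambda>x :: real. exp (1/3 * (- ln x))) at_top (at_right 0)" .
    moreover have "\<forall>\<^sub>F x :: real in at_right 0. exp (1/3 * (- ln x)) = x powr (-1/3)"
      unfolding eventually_at_filter by (intro always_eventually) (simp add: powr_def)
    ultimately show ?thesis using filterlim_cong[OF refl refl] by fast
  qed
  ultimately have "filterlim (\<lambda>p :: real \<times> real. fst p powr (-1/3)) at_top ?F" by (rule filterlim_compose[rotated])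
  then have t: "filterlim (\<lambda>p. \<bar>snd p\<bar> * fst p powr (-1/3)) at_top ?F"
    by (rule filterlim_tendsto_pos_mult_at_top[OF y, rotated]) (use assms in simp)
  have s: "sgn y0 = 1 \<or> sgn y0 = -1" using assms by (auto simp: sgn_if)
  have "((\<lambda>p. \<bar>snd p\<bar> powr (3 * e j k) *
    ((\<bar>snd p\<bar> * fst p powr (-1/3)) powr (- 3 * e j k) * G j k (sgn y0 * (\<bar>snd p\<bar> * fst p powr (-1/3)))))
     \<longlongrightarrow> \<bar>y0\<bar> powr (3 * e j k) * L (sgn y0) j k) ?F"
    by (intro tendsto_mult tendsto_powr y tendsto_const filterlim_compose[OF tendsto_L[OF s] t]) (use assms in simp)
  then have "(V j k \<longlongrightarrow> \<bar>y0\<bar> powr (3 * e j k) * L (sgn y0) j k) ?F"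
  proof (rule Lim_transform_eventually)
    have "\<forall>\<^sub>F p in ?F. 0 < fst p" by (simp add: eventually_at_filter)
    then show "\<forall>\<^sub>F p in ?F. \<bar>snd p\<bar> powr (3 * e j k) *
      ((\<bar>snd p\<bar> * fst p powr (-1/3)) powr (- 3 * e j k) * G j k (sgn y0 * (\<bar>snd p\<bar> * fst p powr (-1/3)))) = V j k p"
      using sgn_ev
    proof eventually_elim
      case (elim p)
      have "snd p \<noteq> 0" using elim(2) assms by (auto simp: sgn_if split: if_splits)
      then show ?case using V_eq[of "fst p" "snd p" j k] elim by simp
    qed
  qed
  moreover have "(V j k \<longlongrightarrow> \<bar>y0\<bar> powr (3 * e j k) * L (sgn y0) j k) (at (0, y0) within {p. fst p = 0})"
  proof (rule Lim_transform_eventually)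
    show "((\<lambda>p. \<bar>snd p\<bar> powr (3 * e j k) * L (sgn y0) j k) \<longlongrightarrow> \<bar>y0\<bar> powr (3 * e j k) * L (sgn y0) j k) (at (0, y0) within {p. fst p = 0})"
      using assms by (auto intro!: tendsto_eq_intros)
    have "\<forall>\<^sub>F p in at (0, y0) within {p. fst p = 0}. fst p = 0" by (simp add: eventually_at_filter)
    then show "\<forall>\<^sub>F p in at (0, y0) within {p. fst p = 0}. \<bar>snd p\<bar> powr (3 * e j k) * L (sgn y0) j k = V j k p"
      using sgn_ev by eventually_elim (simp add: V_def)
  qed
  ultimately have "(V j k \<longlongrightarrow> \<bar>y0\<bar> powr (3 * e j k) * L (sgn y0) j k) (at (0, y0) within {p. 0 < fst p} \<union> {p. fst p = 0})"
    by (simp add: at_within_union filterlim_sup)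
  moreover have "{p :: real \<times> real. 0 < fst p} \<union> {p. fst p = 0} = {p. 0 \<le> fst p}" by auto
  ultimately show ?thesis by (simp add: V_def)
qed

lemma open_right_halfplane: "open {p :: real \<times> real. 0 < fst p}"
  by (intro open_Collect_less continuous_intros)

lemma V_jet: "is_jet2 halfplane V"
  unfolding is_jet2_def
proof (intro conjI allI impI)
  fix j k
  have pw: "continuous_on {p :: real \<times> real. 0 < fst p} (\<lambda>p. fst p powr a)" for a
    by (intro continuous_on_powr continuous_on_fst continuous_on_id continuous_on_const) auto
  have "continuous_on {p. 0 < fst p} (\<lambda>p. G j k (snd p * fst p powr (-1/3)))"
    by (rule continuous_on_compose2[OF G_continuous])
       (intro continuous_on_mult continuous_on_snd continuous_on_id pw, simp)
  then have "continuous_on {p. 0 < fst p} (\<lambda>p. fst p powr e j k * G j k (snd p * fst p powr (-1/3)))"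
    by (intro continuous_on_mult pw)
  then have "continuous_on {p. 0 < fst p} (V j k)"
    by (rule continuous_on_eq) (simp add: V_def)
  then have inner: "isCont (V j k) p" if "0 < fst p" for p
    using that open_right_halfplane by (cases p) (auto simp: continuous_on_eq_continuous_at)
  show "continuous_on halfplane (V j k)"
    unfolding continuous_on_def
  proof
    fix p :: "real \<times> real" assume p: "p \<in> halfplane"
    show "(V j k \<longlongrightarrow> V j k p) (at p within halfplane)"
    proof (cases "0 < fst p")
      case True
      then show ?thesis using inner[of p] by (simp add: isCont_def tendsto_within_subset[where S=UNIV])
    next
      case False
      then have "p = (0, snd p)" "snd p \<noteq> 0" using p by (auto simp: prod_eq_iff)
      then show ?thesis
        using V_tendsto_boundary[of "snd p" j k] by (metis Diff_subset tendsto_within_subset)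
    qed
  qed
next
  fix j k x y assume xy: "(x, y) \<in> interior halfplane"
  \<comment> \<open>Interior points lie off the line x = 0, so the differential relations concern
    the first branch of \<open>V\<close> only.\<close>
  have "x > 0"
  proof -
    obtain r where r: "r > 0" "ball (x, y) r \<subseteq> halfplane" using xy by (auto simp: mem_interior)
    have "(x - r / 2, y) \<in> ball (x, y) r" using r by (simp add: dist_prod_def dist_real_def)
    then show ?thesis using r by auto
  qed
  show "((\<lambda>s. V j k (x, s)) has_real_derivative V j (Suc k) (x, y)) (at y)"
  proof -
    have "((\<lambda>s. G j k (s * x powr (-1/3))) has_real_derivative G j (Suc k) (y * x powr (-1/3)) * x powr (-1/3)) (at y)"
      by (rule DERIV_chain2[OF G_deriv]) (auto intro!: derivative_eq_intros)
    moreover have "e j (Suc k) = e j k + -1/3" by (simp add: e_def field_simps)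
    then have "x powr e j (Suc k) = x powr e j k * x powr (-1/3)" by (simp only: powr_add)
    moreover note DERIV_cmult[OF calculation(1), of "x powr e j k"]
    ultimately show ?thesis using \<open>x > 0\<close> by (simp add: V_def mult_ac)
  qed
  show "((\<lambda>s. V j k (s, y)) has_real_derivative V (Suc j) k (x, y)) (at x)"
  proof -
    have "((\<lambda>s. y * s powr (-1/3)) has_real_derivative y * (-1/3 * x powr (-1/3 - 1))) (at x)"
      by (intro DERIV_cmult has_real_derivative_powr \<open>x > 0\<close>)
    from DERIV_chain2[OF G_deriv this]
    have "((\<lambda>s. G j k (y * s powr (-1/3))) has_real_derivative
        G j (Suc k) (y * x powr (-1/3)) * (y * (-1/3 * x powr (-1/3 - 1)))) (at x)" .
    from DERIV_mult[OF has_real_derivative_powr[OF \<open>x > 0\<close>, of "e j k"] this]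
    have D: "((\<lambda>s. s powr e j k * G j k (y * s powr (-1/3))) has_real_derivative
        e j k * x powr (e j k - 1) * G j k (y * x powr (-1/3))
        + G j (Suc k) (y * x powr (-1/3)) * (y * (-1/3 * x powr (-1/3 - 1))) * x powr e j k) (at x)" .
    have "x powr (-1/3 - 1) * x powr e j k = x powr (e j k - 1) * x powr (-1/3)"
      by (simp flip: powr_add)
    then have eq: "e j k * x powr (e j k - 1) * G j k (y * x powr (-1/3))
        + G j (Suc k) (y * x powr (-1/3)) * (y * (-1/3 * x powr (-1/3 - 1))) * x powr e j k = V (Suc j) k (x, y)"
      using \<open>x > 0\<close> by (simp add: V_def e_def G.simps(2) algebra_simps)
    have "\<forall>\<^sub>F s in nhds x. s \<in> {0<..}" by (rule eventually_nhds_in_open) (use \<open>x > 0\<close> in auto)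
    then have "\<forall>\<^sub>F s in nhds x. V j k (s, y) = s powr e j k * G j k (y * s powr (-1/3))"
      by (rule eventually_mono) (simp add: V_def)
    from DERIV_cong_ev[OF refl this eq[symmetric]] D show ?thesis by blast
  qed
qed

lemma V_pde: "x > 0 \<Longrightarrow> y * V 1 0 (x, y) = V 0 2 (x, y)"
proof -
  assume "x > 0"
  let ?t = "y * x powr (-1/3)"
  have "x powr e 1 0 = x powr (e 0 2 + -1/3)" by (simp add: e_def)
  then have "y * x powr e 1 0 = x powr e 0 2 * ?t" by (simp only: powr_add mult_ac)
  then have "y * x powr e 1 0 * G 1 0 ?t = x powr e 0 2 * (?t * G 1 0 ?t)" by (simp only: mult.assoc)
  also have "?t * G 1 0 ?t = G 0 2 ?t"
    using G_rel[of ?t 0 0] by (simp add: numeral_2_eq_2 del: G.simps)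
  finally show ?thesis using \<open>x > 0\<close> by (simp add: V_def mult.assoc del: G.simps)
qed

lemma V_trace: "y > 0 \<Longrightarrow> V 0 0 (0, y) = 0"
  by (simp add: V_def L_pos)

section \<open>Bounds for the derivatives of the singular solution\<close>

lemma bounded_of_eventually:
  fixes f :: "real \<Rightarrow> real"
  assumes f: "continuous_on UNIV f" and lim: "(f \<longlongrightarrow> a) at_top" "((\<lambda>t. f (- t)) \<longlongrightarrow> b) at_top"
  obtains C where "\<And>t. \<bar>f t\<bar> \<le> C"
proof -
  have "\<forall>\<^sub>F t in at_top. dist (f t) a < 1 \<and> dist (f (- t)) b < 1"
    using tendstoD[OF lim(1), of 1] tendstoD[OF lim(2), of 1] by (simp add: eventually_conj)
  then obtain T where T: "\<And>t. t \<ge> T \<Longrightarrow> dist (f t) a < 1 \<and> dist (f (- t)) b < 1"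
    by (auto simp: eventually_at_top_linorder)
  have "compact (f ` {-\<bar>T\<bar>..\<bar>T\<bar>})"
    by (intro compact_continuous_image continuous_on_subset[OF f]) auto
  then obtain B where B: "\<forall>z\<in>f ` {-\<bar>T\<bar>..\<bar>T\<bar>}. norm z \<le> B" using compact_imp_bounded bounded_iff by blast
  have "\<bar>f t\<bar> \<le> \<bar>a\<bar> + \<bar>b\<bar> + \<bar>B\<bar> + 1" for t
  proof -
    consider "t \<ge> T" | "- t \<ge> T" | "t \<in> {-\<bar>T\<bar>..\<bar>T\<bar>}" by force
    then show ?thesis
    proof cases
      case 1 then show ?thesis using T[of t] by (auto simp: dist_real_def)
    next
      case 2 then show ?thesis using T[of "- t"] by (auto simp: dist_real_def)
    next
      case 3
      then have "\<bar>f t\<bar> \<le> B" using B by auto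
      then show ?thesis by linarith
    qed
  qed
  then show ?thesis by (rule that)
qed

text \<open>\<open>G\<close> is at most of order \<open>3 * e j k\<close> at both ends, so a weight
  strictly below the critical power leaves the limit 0. The case s = 0 is separate because
  \<open>0 powr 0\<close> is 0, which makes the weight discontinuous at t = 0.\<close>

lemma G_weight_bounded:
  assumes "0 \<le> s" "s < - 3 * e j k"
  obtains C where "\<And>t. \<bar>\<bar>t\<bar> powr s * G j k t\<bar> \<le> C"
proof -
  note G = G_continuous[of j k]
  show ?thesis
  proof (cases "s = 0")
    case False
    have lim: "((\<lambda>t. \<bar>\<sigma> * t\<bar> powr s * G j k (\<sigma> * t)) \<longlongrightarrow> 0) at_top" if \<sigma>: "\<sigma> = 1 \<or> \<sigma> = -1" for \<sigma>
    proof -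
      have "((\<lambda>t :: real. t powr (s + 3 * e j k)) \<longlongrightarrow> 0) at_top"
        using tendsto_neg_powr[of "s + 3 * e j k" "\<lambda>t :: real. t" at_top] assms by (simp add: filterlim_ident)
      from tendsto_mult[OF this tendsto_L[OF \<sigma>, of j k]]
      have T: "((\<lambda>t. t powr (s + 3 * e j k) * (t powr (- 3 * e j k) * G j k (\<sigma> * t))) \<longlongrightarrow> 0) at_top"
        by (simp only: mult_zero_left)
      show ?thesis
      proof (rule Lim_transform_eventually[OF T])
        show "\<forall>\<^sub>F t in at_top. t powr (s + 3 * e j k) * (t powr (- 3 * e j k) * G j k (\<sigma> * t)) = \<bar>\<sigma> * t\<bar> powr s * G j k (\<sigma> * t)"
          using eventually_gt_at_top[of 0] proof eventually_elim
          case (elim t)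
          have "t powr (s + 3 * e j k) * t powr (- 3 * e j k) = t powr s" by (simp flip: powr_add)
          moreover have "\<bar>\<sigma> * t\<bar> = t" using \<sigma> elim by auto
          ultimately show ?case by (simp only: mult.assoc[symmetric])
        qed
      qed
    qed
    have "continuous_on UNIV (\<lambda>t. \<bar>t\<bar> powr s * G j k t)"
      using False assms by (intro continuous_intros continuous_on_powr' G) auto
    from bounded_of_eventually[OF this] lim[of 1] lim[of "-1"] that show ?thesis by auto
  next
    case True
    have lim: "((\<lambda>t. G j k (\<sigma> * t)) \<longlongrightarrow> 0) at_top" if \<sigma>: "\<sigma> = 1 \<or> \<sigma> = -1" for \<sigma>
    proof -
      have "((\<lambda>t :: real. t powr (3 * e j k)) \<longlongrightarrow> 0) at_top"
        using tendsto_neg_powr[of "3 * e j k" "\<lambda>t :: real. t" at_top] assms True by (simp add: filterlim_ident)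
      from tendsto_mult[OF this tendsto_L[OF \<sigma>, of j k]]
      have T: "((\<lambda>t. t powr (3 * e j k) * (t powr (- 3 * e j k) * G j k (\<sigma> * t))) \<longlongrightarrow> 0) at_top"
        by (simp only: mult_zero_left)
      show ?thesis
      proof (rule Lim_transform_eventually[OF T])
        show "\<forall>\<^sub>F t in at_top. t powr (3 * e j k) * (t powr (- 3 * e j k) * G j k (\<sigma> * t)) = G j k (\<sigma> * t)"
          using eventually_gt_at_top[of 0] proof eventually_elim
          case (elim t)
          have "t powr (3 * e j k) * t powr (- 3 * e j k) = 1" using elim by (simp flip: powr_add)
          then show ?case by (simp only: mult.assoc[symmetric] mult_1_left)
        qed
      qed
    qed
    obtain C where C: "\<And>t. \<bar>G j k t\<bar> \<le> C"
      using bounded_of_eventually[OF G] lim[of 1] lim[of "-1"] by auto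
    have "\<bar>\<bar>t\<bar> powr s * G j k t\<bar> \<le> C" for t
      using C[of t] True by (cases "t = 0") (auto intro: order_trans[OF abs_ge_zero])
    then show ?thesis by (rule that)
  qed
qed

text \<open>The profile of the first y-derivative has order -1/2 at infinity and is bounded;
  squaring its factor \<open>x powr (-1/6)\<close> gives the exponent -1/3. The point t = 0 is added
  by hand since the weight \<open>0 powr 0\<close> hides it.\<close>

lemma V_dy_bound:
  obtains C where "\<And>x y. x > 0 \<Longrightarrow> (V 0 1 (x, y))\<^sup>2 \<le> C * x powr (-1/3)"
proof -
  obtain C where C: "\<And>t. \<bar>\<bar>t\<bar> powr 0 * G 0 1 t\<bar> \<le> C" using G_weight_bounded[of 0 0 1] by (auto simp: e_def)
  have "(V 0 1 (x, y))\<^sup>2 \<le> (C\<^sup>2 + (G 0 1 0)\<^sup>2) * x powr (-1/3)" if "x > 0" for x y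
  proof -
    let ?t = "y * x powr (-1/3)"
    have "(G 0 1 ?t)\<^sup>2 \<le> C\<^sup>2 + (G 0 1 0)\<^sup>2"
    proof (cases "?t = 0")
      case False
      then have "\<bar>G 0 1 ?t\<bar> \<le> C" using C[of ?t] by simp
      then show ?thesis using abs_le_square_iff[of "G 0 1 ?t" C] by (smt (verit) zero_le_power2)
    next
      case True
      then have "G 0 1 ?t = G 0 1 0" by (simp only:)
      then show ?thesis by (simp del: G.simps)
    qed
    moreover have "(V 0 1 (x, y))\<^sup>2 = (G 0 1 ?t)\<^sup>2 * x powr (-1/3)"
      using that by (simp add: V_def power_mult_distrib e_def powr_power del: G.simps)
    ultimately show ?thesis by (simp add: mult_right_mono)
  qed
  then show ?thesis by (rule that)
qed

text \<open>The square is \<open>1 / x\<close> times the square of the profile, and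
  \<open>1 / x\<close> alone is not integrable. Part of the decay of the profile is spent:
  \<bar>t\<bar> to the power -3/4 contributes x to the power 1/4 and \<bar>y\<bar> to the power
  -3/4. The weight 3/8 is below the critical 3/2, and both resulting exponents exceed -1.\<close>

lemma V_dyy_bound:
  obtains C where "\<And>x y. x > 0 \<Longrightarrow> y \<noteq> 0 \<Longrightarrow> (V 0 2 (x, y))\<^sup>2 \<le> C * (x powr (-3/4) * \<bar>y\<bar> powr (-3/4))"
proof -
  obtain C where C: "\<And>t. \<bar>\<bar>t\<bar> powr (3/8) * G 0 2 t\<bar> \<le> C" using G_weight_bounded[of "3/8" 0 2] by (auto simp: e_def)
  have "(V 0 2 (x, y))\<^sup>2 \<le> C\<^sup>2 * (x powr (-3/4) * \<bar>y\<bar> powr (-3/4))" if "x > 0" "y \<noteq> 0" for x y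
  proof -
    let ?t = "y * x powr (-1/3)"
    have "(\<bar>?t\<bar> powr (3/8) * G 0 2 ?t)\<^sup>2 \<le> C\<^sup>2"
      using C[of ?t] by (metis abs_le_square_iff abs_of_nonneg order_trans[OF abs_ge_zero])
    moreover have "(\<bar>?t\<bar> powr (3/8))\<^sup>2 = \<bar>y\<bar> powr (3/4) * x powr (-1/4)"
      using that by (simp add: powr_power abs_mult powr_mult powr_powr power_mult_distrib)
    ultimately have "\<bar>y\<bar> powr (3/4) * x powr (-1/4) * (G 0 2 ?t)\<^sup>2 \<le> C\<^sup>2" by (simp add: power_mult_distrib)
    then have "(x powr (-3/4) * \<bar>y\<bar> powr (-3/4)) * (\<bar>y\<bar> powr (3/4) * x powr (-1/4) * (G 0 2 ?t)\<^sup>2)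
        \<le> (x powr (-3/4) * \<bar>y\<bar> powr (-3/4)) * C\<^sup>2"
      by (intro mult_left_mono) auto
    also have "(x powr (-3/4) * \<bar>y\<bar> powr (-3/4)) * (\<bar>y\<bar> powr (3/4) * x powr (-1/4) * (G 0 2 ?t)\<^sup>2)
        = (x powr (-3/4) * x powr (-1/4)) * (\<bar>y\<bar> powr (-3/4) * \<bar>y\<bar> powr (3/4)) * (G 0 2 ?t)\<^sup>2" by (simp add: mult_ac)
    also have "x powr (-3/4) * x powr (-1/4) = x powr (-1)" by (simp flip: powr_add)
    also have "\<bar>y\<bar> powr (-3/4) * \<bar>y\<bar> powr (3/4) = 1" using that by (simp flip: powr_add)
    also have "x powr (-1) * 1 * (G 0 2 ?t)\<^sup>2 = (V 0 2 (x, y))\<^sup>2"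
      using that by (simp add: V_def power_mult_distrib e_def powr_power del: G.simps)
    finally show ?thesis by (simp add: mult.commute)
  qed
  then show ?thesis by (rule that)
qed

text \<open>If the mixed profile vanished, that of the x-derivative would be a constant C, so g'' =
  C t by the equation, while the definition of the mixed profile gives g' = -2 C t^2. Comparing g''
  at t = 1 forces C = 0, then g = 0, against the limit 1 at minus infinity.\<close>

lemma G_mixed_nonzero: "\<exists>t. G 1 1 t \<noteq> 0"
proof (rule ccontr)
  assume "\<not> (\<exists>t. G 1 1 t \<noteq> 0)"
  then have 0: "G (Suc 0) (Suc 0) t = 0" for t by (simp del: G.simps)
  have "\<exists>C. \<forall>t\<in>UNIV. G (Suc 0) 0 t = C"
    by (rule has_field_derivative_zero_constant) (use G_deriv[of "Suc 0" 0] 0 in auto)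
  then obtain C where C: "\<And>t. G (Suc 0) 0 t = C" by auto
  have g2: "gam 2 t = t * C" for t
    using G_rel[of t 0 0] C[of t] by (simp add: numeral_2_eq_2 del: G.simps(2) gam.simps)
  have "- (g1 t / 2) = t * (t * C)" for t
    using 0[of t] g2[of t] by (simp add: G.simps(2) e_def numeral_2_eq_2)
  then have g1: "g1 t = - 2 * C * t\<^sup>2" for t
  proof -
    have "g1 t = - 2 * (t * (t * C))" using \<open>\<And>t. - (g1 t / 2) = t * (t * C)\<close>[of t] by linarith
    then show ?thesis by (simp add: power2_eq_square mult_ac)
  qed
  have "(g1 has_real_derivative gam 2 1) (at 1)"
  proof -
    have "gam 1 = g1" by auto
    then show ?thesis using gam_deriv[of 1 1] by (metis Suc_1)
  qed
  moreover have "(g1 has_real_derivative - 2 * C * 2) (at 1)"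
    unfolding g1[abs_def] by (auto intro!: derivative_eq_intros)
  ultimately have "gam 2 1 = - 2 * C * 2" by (rule DERIV_unique)
  then have "C = 0" using g2[of 1] by simp
  then have "g t = 0" for t using C[of t] g1[of t] by (simp add: G.simps(2) e_def)
  then have "((\<lambda>t :: real. 0 :: real) \<longlongrightarrow> 1) at_top" using lim_bot by simp
  then show False by (simp add: tendsto_const_iff)
qed

end

section \<open>The profile of the singular solution\<close>

text \<open>Taking \<open>x powr (2/3)\<close> out of the square of r leaves 1 + t^2, and its fourth
  root is the factor \<open>x powr (1/6)\<close>.\<close>

lemma v0_similarity:
  assumes "x > 0"
  shows "v0 \<Lambda> x y = x powr (1/6) * ((1 + (y * x powr (-1/3))\<^sup>2) powr (1/4) * \<Lambda> (y * x powr (-1/3)))"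
proof -
  have "x powr (2/3) * (x powr (-1/3))\<^sup>2 = 1"
    using assms by (simp add: powr_power flip: powr_add)
  then have "y\<^sup>2 + x powr (2/3) = x powr (2/3) * (1 + (y * x powr (-1/3))\<^sup>2)"
    by (simp add: algebra_simps power_mult_distrib)
  then have "(y\<^sup>2 + x powr (2/3)) powr (1/4) = x powr (1/6) * (1 + (y * x powr (-1/3))\<^sup>2) powr (1/4)"
    using assms by (simp add: powr_mult powr_powr add_pos_nonneg less_imp_le)
  then show ?thesis by (simp add: v0_def Let_def powr_powr)
qed

lemma sqrt_growth_limit: "((\<lambda>t :: real. t powr (-1/2) * (1 + t\<^sup>2) powr (1/4)) \<longlongrightarrow> 1) at_top"
proof -
  have "filterlim (\<lambda>t :: real. t\<^sup>2) at_top at_top" by (intro filterlim_pow_at_top filterlim_ident) simp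
  then have "((\<lambda>t :: real. (1 + inverse (t\<^sup>2)) powr (1/4)) \<longlongrightarrow> (1 + 0) powr (1/4)) at_top"
    by (intro tendsto_intros tendsto_inverse_0_at_top) simp_all
  moreover have "\<forall>\<^sub>F t :: real in at_top. (1 + inverse (t\<^sup>2)) powr (1/4) = t powr (-1/2) * (1 + t\<^sup>2) powr (1/4)"
    using eventually_gt_at_top[of 0]
  proof eventually_elim
    case (elim t)
    have "1 + inverse (t\<^sup>2) = t powr (-2) * (1 + t\<^sup>2)"
      using elim by (simp add: powr_minus field_simps)
    then show ?case using elim by (simp add: powr_mult powr_powr)
  qed
  ultimately have "((\<lambda>t :: real. t powr (-1/2) * (1 + t\<^sup>2) powr (1/4)) \<longlongrightarrow> (1 + 0) powr (1/4)) at_top"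
    by (rule Lim_transform_eventually)
  then show ?thesis by simp
qed

text \<open>At x = 1 the similarity variable equals y, so the partial differential equation on this
  single line already is the ordinary one for the profile.\<close>

lemma profile_of_Lambda0:
  assumes L: "is_Lambda0 \<Lambda>"
  shows "\<exists>g1. profile (\<lambda>t. (1 + t\<^sup>2) powr (1/4) * \<Lambda> t) g1"
proof -
  define g where "g t = (1 + t\<^sup>2) powr (1/4) * \<Lambda> t" for t
  define g1 where "g1 t = 1/4 * (1 + t\<^sup>2) powr (1/4 - 1) * (2 * t) * \<Lambda> t + (1 + t\<^sup>2) powr (1/4) * deriv \<Lambda> t" for t
  have sm: "smooth_real \<Lambda>" using L by (simp add: is_Lambda0_def)
  have pos: "0 < 1 + t\<^sup>2" for t :: real by (simp add: add_pos_nonneg)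
  have pw: "((\<lambda>t :: real. (1 + t\<^sup>2) powr s) has_real_derivative s * (1 + t\<^sup>2) powr (s - 1) * (2 * t)) (at t)" for s t
    by (rule DERIV_chain2[where f="\<lambda>z. z powr s" and g="\<lambda>t. 1 + t\<^sup>2", OF has_real_derivative_powr[OF pos]]) (auto intro!: derivative_eq_intros)
  have d0: "(g has_real_derivative g1 t) (at t)" for t
    using DERIV_mult[OF pw[of "1/4" t] smooth_real_has_deriv[OF sm, of t]]
    by (simp add: g_def[abs_def] g1_def mult_ac)
  have d1: "(g1 has_real_derivative deriv g1 t) (at t)" for t
  proof -
    have "\<exists>D. (g1 has_real_derivative D) (at t)"
      unfolding g1_def[abs_def]
      by (rule exI, rule DERIV_add[OF DERIV_mult[OF DERIV_mult[OF DERIV_cmult[OF pw]] smooth_real_has_deriv[OF sm]]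
          DERIV_mult[OF pw smooth_real_has_deriv[OF smooth_real_deriv[OF sm]]]])
         (rule derivative_eq_intros refl)+
    then show ?thesis using DERIV_imp_deriv by blast
  qed
  have "deriv g1 y = y * (g y / 6 - y * g1 y / 3)" for y
  proof -
    have "(\<lambda>s. v0 \<Lambda> 1 s) = g" by (auto simp: fun_eq_iff v0_similarity g_def)
    moreover have "deriv g = g1" using d0 by (auto intro!: DERIV_imp_deriv)
    ultimately have yy: "(deriv ^^ 2) (\<lambda>s. v0 \<Lambda> 1 s) y = deriv g1 y" by (simp add: numeral_2_eq_2)
    have ev: "\<forall>\<^sub>F s in nhds (1::real). s \<in> {0<..}" by (rule eventually_nhds_in_open) auto
    have ev': "\<forall>\<^sub>F s in nhds (1::real). v0 \<Lambda> s y = s powr (1/6) * g (y * s powr (-1/3))"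
      using ev by eventually_elim (simp add: v0_similarity g_def)
    have "((\<lambda>s. y * s powr (-1/3)) has_real_derivative y * (-1/3 * 1 powr (-1/3 - 1))) (at 1)"
      by (intro DERIV_cmult has_real_derivative_powr) simp
    from DERIV_chain2[OF d0 this]
    have "((\<lambda>s. g (y * s powr (-1/3))) has_real_derivative g1 (y * 1 powr (-1/3)) * (y * (-1/3 * 1 powr (-1/3 - 1)))) (at 1)" .
    from DERIV_mult[OF has_real_derivative_powr[of 1 "1/6"] this]
    have "((\<lambda>s. s powr (1/6) * g (y * s powr (-1/3))) has_real_derivative g y / 6 - y * g1 y / 3) (at 1)"
      by (simp add: mult.commute)
    then have "((\<lambda>s. v0 \<Lambda> s y) has_real_derivative g y / 6 - y * g1 y / 3) (at 1)"
      by (subst DERIV_cong_ev[OF refl ev' refl])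
    then have "deriv (\<lambda>s. v0 \<Lambda> s y) 1 = g y / 6 - y * g1 y / 3" by (rule DERIV_imp_deriv)
    moreover have "y * deriv (\<lambda>s. v0 \<Lambda> s y) 1 - (deriv ^^ 2) (\<lambda>s. v0 \<Lambda> 1 s) y = 0"
      using L unfolding is_Lambda0_def by (meson zero_less_one)
    ultimately show ?thesis using yy by simp
  qed
  then have d1': "(g1 has_real_derivative t * (g t / 6 - t * g1 t / 3)) (at t)" for t using d1[of t] by simp
  have top: "(\<Lambda> \<longlongrightarrow> 0) at_top" and bot: "((\<lambda>t. \<Lambda> (- t)) \<longlongrightarrow> 1) at_top"
    using L filterlim_compose[OF _ filterlim_uminus_at_bot_at_top, of \<Lambda>] by (auto simp: is_Lambda0_def)
  have "profile g g1"
  proof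
    show "((\<lambda>t. t powr (-1/2) * g t) \<longlongrightarrow> 0) at_top"
      using tendsto_mult[OF sqrt_growth_limit top] by (simp add: g_def mult.assoc)
    show "((\<lambda>t. t powr (-1/2) * g (- t)) \<longlongrightarrow> 1) at_top"
      using tendsto_mult[OF sqrt_growth_limit bot] by (simp add: g_def mult.assoc)
  qed (use d0 d1' in auto)
  then show ?thesis by (auto simp: g_def[abs_def])
qed

section \<open>The domain, majorants and distributional derivatives\<close>

lemma closure_Dom:
  assumes "X 0 < X 1"
  shows "closure (Dom X) = {X 0..X 1} \<times> {-1..1}"
  using assms by (simp add: Dom_def closure_Times)

lemma interior_closure_Dom:
  assumes "X 0 < X 1"
  shows "interior (closure (Dom X)) = Dom X"
  unfolding closure_Dom[OF assms] interior_Times interior_atLeastAtMost_real by (simp only: Dom_def)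

lemma integrable_powr_from_0:
  fixes s c :: real
  assumes "s > -1" "c \<ge> 0"
  shows "integrable lborel (\<lambda>x. indicator {0..c} x * x powr s)"
proof -
  have "(\<lambda>x. x powr s) absolutely_integrable_on {0..c}"
    using integrable_on_powr_from_0[OF assms] by (intro nonnegative_absolutely_integrable_1) auto
  then have "integrable lebesgue (\<lambda>x. indicator {0..c} x * x powr s)"
    by (simp add: set_integrable_def)
  then show ?thesis by (simp add: integrable_completion)
qed

lemma AE_snd_neq_0: "AE p in (lborel :: (real \<times> real) measure). snd p \<noteq> 0"
  by (rule AE_lborel_snd_lift[OF AE_lborel_singleton])

text \<open>The null set y = 0 is left out because the majorant to be used contains a negative power
  of \<bar>y\<bar>, which \<open>powr\<close> sets to 0 there.\<close>

lemma L2_of_bound: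
  fixes f h :: "real \<times> real \<Rightarrow> real"
  assumes f: "continuous_on (Dom X) f" and h: "integrable lborel h"
    and le: "\<And>p. p \<in> Dom X \<Longrightarrow> snd p \<noteq> 0 \<Longrightarrow> (f p)\<^sup>2 \<le> C * h p"
  shows "f \<in> L2 (Dom X)"
proof -
  have "f \<in> borel_measurable (lebesgue_on (Dom X))"
    by (rule continuous_imp_measurable_on_sets_lebesgue[OF f]) auto
  moreover have "integrable (lebesgue_on (Dom X)) (\<lambda>p. (f p)\<^sup>2)"
  proof (subst lebesgue_on_integrable_iff[OF Dom_borel(1)])
    show m: "(\<lambda>p. indicator (Dom X) p *\<^sub>R (f p)\<^sup>2) \<in> borel_measurable borel"
      by (intro borel_measurable_continuous_on_indicator continuous_intros f) simp
    show "integrable lborel (\<lambda>p. indicator (Dom X) p *\<^sub>R (f p)\<^sup>2)"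
    proof (rule Bochner_Integration.integrable_bound)
      show "integrable lborel (\<lambda>p. C * h p)" using h by simp
      show "AE p in lborel. norm (indicator (Dom X) p *\<^sub>R (f p)\<^sup>2) \<le> norm (C * h p)"
        using AE_snd_neq_0
      proof eventually_elim
        case (elim p)
        show ?case
        proof (cases "p \<in> Dom X")
          case True
          then show ?thesis using le[OF True elim] by simp
        qed simp
      qed
    qed (use m in simp)
  qed auto
  ultimately show ?thesis by (simp add: L2_def)
qed

text \<open>A test function has compact support in the open domain, so classical integration by
  parts applies even though the family may be singular at a boundary point.\<close>

lemma distr_of_parts:
  assumes D: "is_jet2 S D" and S: "interior S = Dom X" and \<phi>: "test_fun (Dom X) \<phi>"
  shows "distr_of (Dom X) (D j k) (\<lambda>(x, y). deriv (\<lambda>s. \<phi> (s, y)) x) = - distr_of (Dom X) (D (Suc j) k) \<phi>"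
    and "distr_of (Dom X) (D j k) (\<lambda>(x, y). deriv (\<lambda>s. \<phi> (x, s)) y) = - distr_of (Dom X) (D j (Suc k)) \<phi>"
    and "integrable (lebesgue_on (Dom X)) (\<lambda>p. D j k p * \<phi> p)"
proof -
  obtain P where P: "is_jet2 UNIV P" "P 0 0 = \<phi>"
    "(\<lambda>(x, y). deriv (\<lambda>s. \<phi> (s, y)) x) = P 1 0" "(\<lambda>(x, y). deriv (\<lambda>s. \<phi> (x, s)) y) = P 0 1"
    by (rule test_funE[OF \<phi>])
  define K where "K = closure {p. \<phi> p \<noteq> 0}"
  have K: "compact K" "K \<subseteq> Dom X" using \<phi> by (auto simp: test_fun_def K_def)
  have 0: "P 0 0 p = 0" "P 1 0 p = 0" "P 0 1 p = 0" if "p \<in> Dom X - K" for p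
  proof -
    have z: "P 0 0 q = 0" if "q \<in> - K \<inter> interior UNIV" for q
      using that closure_subset[of "{p. \<phi> p \<noteq> 0}"] unfolding P(2) K_def by blast
    have o: "open (- K)" using K by (simp add: compact_imp_closed open_Compl)
    show "P 0 0 p = 0" using z that by auto
    show "P 1 0 p = 0" "P 0 1 p = 0"
      using is_jet2_const_zero[OF P(1) _ o z, of 1 0 p] is_jet2_const_zero[OF P(1) _ o z, of 0 1 p] that by auto
  qed
  have cD: "continuous_on (Dom X) (D j k)" for j k
    using is_jet2_continuous[OF D] S interior_subset continuous_on_subset by metis
  have cP: "continuous_on (Dom X) (P j k)" for j k
    using is_jet2_continuous[OF P(1)] continuous_on_subset by blast
  have i: "integrable lborel (\<lambda>p. if p \<in> Dom X then D j k p * q p else 0)"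
    if "continuous_on (Dom X) q" "\<And>p. p \<in> Dom X - K \<Longrightarrow> q p = 0" for q j k
    by (rule integrable_extend_zero[OF _ Dom_borel(2) K]) (use that in \<open>auto intro!: continuous_intros cD\<close>)
  have conv: "distr_of (Dom X) (D j k) q = (LINT p|lborel. (if p \<in> Dom X then D j k p * q p else 0))"
    "integrable (lebesgue_on (Dom X)) (\<lambda>p. D j k p * q p)"
    if "continuous_on (Dom X) q" "\<And>p. p \<in> Dom X - K \<Longrightarrow> q p = 0" for q j k
  proof -
    have m: "(\<lambda>p. if p \<in> Dom X then D j k p * q p else 0) \<in> borel_measurable borel"
      using i[OF that, of j k] by simp
    show "distr_of (Dom X) (D j k) q = (LINT p|lborel. (if p \<in> Dom X then D j k p * q p else 0))"
      unfolding distr_of_def by (rule lebesgue_on_integral_eq[OF Dom_borel(1) m]) auto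
    show "integrable (lebesgue_on (Dom X)) (\<lambda>p. D j k p * q p)"
      using i[OF that, of j k] by (subst lebesgue_on_integrable_iff[OF Dom_borel(1) m]) auto
  qed
  have dD: "((\<lambda>s. D j k (s, y)) has_real_derivative D (Suc j) k (x, y)) (at x)"
    "((\<lambda>s. D j k (x, s)) has_real_derivative D j (Suc k) (x, y)) (at y)" if "(x, y) \<in> Dom X" for x y j k
    using is_jet2_dx[OF D] is_jet2_dy[OF D] that S by auto
  have dP: "((\<lambda>s. P 0 0 (s, y)) has_real_derivative P 1 0 (x, y)) (at x)"
    "((\<lambda>s. P 0 0 (x, s)) has_real_derivative P 0 1 (x, y)) (at y)" for x y
    using is_jet2_dx[OF P(1), of x y 0 0] is_jet2_dy[OF P(1), of x y 0 0] by auto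
  have c: "distr_of (Dom X) (D j k) (P 0 0) = (LINT p|lborel. (if p \<in> Dom X then D j k p * P 0 0 p else 0))"
    "distr_of (Dom X) (D j k) (P 1 0) = (LINT p|lborel. (if p \<in> Dom X then D j k p * P 1 0 p else 0))"
    "distr_of (Dom X) (D j k) (P 0 1) = (LINT p|lborel. (if p \<in> Dom X then D j k p * P 0 1 p else 0))" for j k
    by (rule conv(1)[OF cP 0(1)] conv(1)[OF cP 0(2)] conv(1)[OF cP 0(3)]; assumption)+
  show "integrable (lebesgue_on (Dom X)) (\<lambda>p. D j k p * \<phi> p)"
    unfolding P(2)[symmetric] by (rule conv(2)[OF cP 0(1)])
  show "distr_of (Dom X) (D j k) (\<lambda>(x, y). deriv (\<lambda>s. \<phi> (s, y)) x) = - distr_of (Dom X) (D (Suc j) k) \<phi>"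
    unfolding P(3) unfolding P(2)[symmetric] c
    by (rule integral_parts_dx[OF Dom_borel(2) cD cD dD(1) cP cP dP(1) K 0(1,2)])
  show "distr_of (Dom X) (D j k) (\<lambda>(x, y). deriv (\<lambda>s. \<phi> (x, s)) y) = - distr_of (Dom X) (D j (Suc k)) \<phi>"
    unfolding P(4) unfolding P(2)[symmetric] c
    by (rule integral_parts_dy[OF Dom_borel(2) cD cD dD(2) cP cP dP(2) K 0(1,3)])
qed

section \<open>The cut-off solution in the domain\<close>

locale singular = profile "\<lambda>t. (1 + t\<^sup>2) powr (1/4) * \<Lambda> t" g1 for \<Lambda> g1 :: "real \<Rightarrow> real" +
  fixes X :: "nat \<Rightarrow> real" and \<eta> :: "nat \<Rightarrow> real \<times> real \<Rightarrow> real" and i :: nat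
  assumes X01: "X 0 < X 1" and i01: "i = 0 \<or> i = 1" and cut: "cutoff X i (\<eta> i)" and bdd: "bounded (range \<Lambda>)"
begin

definition "a = X i"
definition "\<sigma> = (-1 :: real) ^ i"
definition "\<Omega> = closure (Dom X)"
definition "S = \<Omega> - {(a, 0)}"
abbreviation "u \<equiv> u_sing \<Lambda> X \<eta> i"

text \<open>The reflection by \<open>\<sigma>\<close> moves the singular point to the origin and the domain into the right half plane.\<close>

definition VV :: "nat \<Rightarrow> nat \<Rightarrow> real \<times> real \<Rightarrow> real" where
  "VV = (\<lambda>j k (x, y). \<sigma> ^ (j + k) * V j k (\<sigma> * (x - a), \<sigma> * y))"

lemma \<sigma>: "\<sigma> = 1 \<and> a = X 0 \<or> \<sigma> = -1 \<and> a = X 1"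
  using i01 by (auto simp: \<sigma>_def a_def)

lemma \<Omega>_eq: "\<Omega> = {X 0..X 1} \<times> {-1..1}"
  unfolding \<Omega>_def by (rule closure_Dom[OF X01])

lemma compact_\<Omega>: "compact \<Omega>"
  unfolding \<Omega>_eq by (intro compact_Times) auto

lemma int_\<Omega>: "interior \<Omega> = Dom X"
  unfolding \<Omega>_def by (rule interior_closure_Dom[OF X01])

lemma sing_notin_Dom: "(a, 0) \<notin> Dom X"
  using \<sigma> by (auto simp: Dom_def)

lemma Dom_sub_S: "Dom X \<subseteq> S"
  using sing_notin_Dom by (auto simp: S_def \<Omega>_eq Dom_def)

lemma int_S: "interior S = Dom X"
proof (rule antisym)
  show "interior S \<subseteq> Dom X" unfolding int_\<Omega>[symmetric] by (intro interior_mono) (auto simp: S_def)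
  show "Dom X \<subseteq> interior S" by (intro interior_maximal Dom_sub_S Dom_borel)
qed

lemma dense_S: "S \<subseteq> closure (interior S)"
proof -
  have "closure (interior S) = \<Omega>" unfolding int_S \<Omega>_def ..
  then show ?thesis by (simp add: S_def)
qed

lemma \<xi>_abs: "(x, y) \<in> \<Omega> \<Longrightarrow> \<sigma> * (x - a) = \<bar>x - a\<bar>"
  using \<sigma> by (auto simp: \<Omega>_eq)

lemma \<xi>_pos: "(x, y) \<in> Dom X \<Longrightarrow> 0 < \<sigma> * (x - a) \<and> \<sigma> * (x - a) < X 1 - X 0"
  using \<sigma> by (auto simp: Dom_def)

lemma VV_jet: "is_jet2 S VV"
proof -
  have "is_jet2 {(x, y). (\<sigma> * (x - a), \<sigma> * y) \<in> halfplane} VV"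
    unfolding VV_def by (rule is_jet2_affine[OF V_jet]) (use \<sigma> in auto)
  then show ?thesis
  proof (rule is_jet2_subset)
    show "S \<subseteq> {(x, y). (\<sigma> * (x - a), \<sigma> * y) \<in> halfplane}"
    proof
      fix p assume p: "p \<in> S"
      obtain x y where xy: "p = (x, y)" by (cases p)
      have "\<sigma> * (x - a) = \<bar>x - a\<bar>" by (rule \<xi>_abs[of x y]) (use p xy in \<open>simp add: S_def\<close>)
      moreover have "\<sigma> \<noteq> 0" using \<sigma> by auto
      ultimately show "p \<in> {(x, y). (\<sigma> * (x - a), \<sigma> * y) \<in> halfplane}" using p by (simp add: xy S_def)
    qed
  qed
qed

lemma sing_core_V:
  assumes "x \<noteq> a"
  shows "sing_core \<Lambda> X i x y = V 0 0 (\<bar>x - a\<bar>, \<sigma> * y)"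
proof -
  have "(\<sigma> * y)\<^sup>2 = y\<^sup>2" using \<sigma> by auto
  then have "sing_core \<Lambda> X i x y = v0 \<Lambda> \<bar>x - a\<bar> (\<sigma> * y)"
    unfolding sing_core_def v0_def Let_def by (simp add: a_def \<sigma>_def)
  also have "\<dots> = V 0 0 (\<bar>x - a\<bar>, \<sigma> * y)"
    using assms by (simp add: v0_similarity V_def e_def)
  finally show ?thesis .
qed

text \<open>\<open>sing_core\<close> depends on x through \<bar>x - a\<bar> only, so the two-sided
  limit in \<open>u_sing\<close> is the boundary value of \<open>V\<close> approached from inside
  the half plane.\<close>

lemma sing_core_Lim:
  assumes "y \<noteq> 0"
  shows "Lim (at a) (\<lambda>x. sing_core \<Lambda> X i x y) = V 0 0 (0, \<sigma> * y)"
proof (rule tendsto_Lim)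
  have ne: "\<sigma> * y \<noteq> 0" using assms \<sigma> by auto
  have "((\<lambda>x. (\<bar>x - a\<bar>, \<sigma> * y)) \<longlongrightarrow> (\<bar>a - a\<bar>, \<sigma> * y)) (at a)" by (intro tendsto_intros)
  then have "filterlim (\<lambda>x. (\<bar>x - a\<bar>, \<sigma> * y)) (at (0, \<sigma> * y) within {p. 0 \<le> fst p}) (at a)"
    unfolding filterlim_at by (auto simp: eventually_at_filter)
  from filterlim_compose[OF V_tendsto_boundary[OF ne] this]
  have "((\<lambda>x. V 0 0 (\<bar>x - a\<bar>, \<sigma> * y)) \<longlongrightarrow> V 0 0 (0, \<sigma> * y)) (at a)" .
  then show "((\<lambda>x. sing_core \<Lambda> X i x y) \<longlongrightarrow> V 0 0 (0, \<sigma> * y)) (at a)"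
    by (rule Lim_transform_eventually) (simp add: eventually_at_filter sing_core_V)
qed simp

lemma u_eq:
  assumes "p \<in> S"
  shows "u p = VV 0 0 p * \<eta> i p"
proof -
  obtain x y where p: "p = (x, y)" by (cases p)
  have xy: "(x, y) \<in> \<Omega>" "(x, y) \<noteq> (a, 0)" using assms by (auto simp: p S_def)
  show ?thesis
  proof (cases "x = a")
    case True
    then have "y \<noteq> 0" using xy by auto
    then show ?thesis using True sing_core_Lim by (simp add: p u_sing_def VV_def a_def)
  next
    case False
    then show ?thesis using sing_core_V[OF False, of y] \<xi>_abs[OF xy(1)] by (simp add: p u_sing_def VV_def a_def)
  qed
qed

lemma ex_U: "\<exists>U. is_jet2 S U \<and> (\<forall>p\<in>S. U 0 0 p = u p)"
proof -
  obtain H where H: "is_jet2 \<Omega> H" "\<And>p. p \<in> \<Omega> \<Longrightarrow> H 0 0 p = \<eta> i p"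
    using cut by (auto simp: cutoff_def smooth_on_iff_jet2 \<Omega>_def)
  have HS: "is_jet2 S H" by (rule is_jet2_subset[OF H(1)]) (auto simp: S_def)
  show ?thesis
    using is_jet2_mult[OF VV_jet HS] H(2) u_eq by (intro exI conjI) (auto simp: S_def)
qed

text \<open>No formula for the derivatives of the product with the cut-off is needed later: near the
  singular point they equal \<open>VV\<close>, and elsewhere continuity on a compact set bounds
  them.\<close>

definition U :: "nat \<Rightarrow> nat \<Rightarrow> real \<times> real \<Rightarrow> real" where
  "U = (SOME U. is_jet2 S U \<and> (\<forall>p\<in>S. U 0 0 p = u p))"

lemma U_jet: "is_jet2 S U" and U_eq: "p \<in> S \<Longrightarrow> U 0 0 p = u p"
  using someI_ex[OF ex_U] by (auto simp: U_def)

lemma cutoff_one: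
  obtains W where "open W" "(a, 0) \<in> W" "\<And>p. p \<in> W \<Longrightarrow> p \<in> \<Omega> \<Longrightarrow> \<eta> i p = 1"
  using cut by (auto simp: cutoff_def \<Omega>_def a_def)

text \<open>Where the cut-off is 1 the two families have the same function of order zero, and
  uniqueness of derivatives does the rest, boundary points included.\<close>

lemma U_near:
  assumes W: "open W" "\<And>p. p \<in> W \<Longrightarrow> p \<in> \<Omega> \<Longrightarrow> \<eta> i p = 1" and p: "p \<in> W" "p \<in> S"
  shows "U j k p = VV j k p"
proof -
  have D: "is_jet2 S (\<lambda>j k p. U j k p - VV j k p)" by (rule is_jet2_diff[OF U_jet VV_jet])
  have z: "U 0 0 q - VV 0 0 q = 0" if "q \<in> W \<inter> interior S" for q
  proof -
    have q: "q \<in> S" "q \<in> W" "q \<in> \<Omega>" using that int_S Dom_sub_S by (auto simp: S_def)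
    then show ?thesis using U_eq[OF q(1)] u_eq[OF q(1)] W(2)[OF q(2,3)] by simp
  qed
  have "U j k p - VV j k p = 0"
  proof (cases "j + k = 0")
    case True
    then show ?thesis using continuous_on_dense_eq[OF is_jet2_continuous[OF D] dense_S W(1) z, of p] p by auto
  next
    case False
    then show ?thesis using is_jet2_const_zero[OF D dense_S W(1) z, of j k p] p by auto
  qed
  then show ?thesis by simp
qed

text \<open>Both constants come from the bound on the radius: the support keeps away from y = 1 and
  y = -1 and from the opposite vertical side.\<close>

lemma cutoff_support:
  assumes "p \<in> \<Omega>" "\<eta> i p \<noteq> 0"
  shows "\<bar>snd p\<bar> < 1/2" "\<bar>fst p - a\<bar> < X 1 - X 0"
proof -
  obtain R where R: "R < min 1 (X 1 - X 0) / 2" "closure {p \<in> \<Omega>. \<eta> i p \<noteq> 0} \<subseteq> ball (a, 0) R"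
    using cut by (auto simp: cutoff_def \<Omega>_def a_def)
  have "p \<in> ball (a, 0) R" using R(2) assms closure_subset[of "{p \<in> \<Omega>. \<eta> i p \<noteq> 0}"] by blast
  then have "dist a (fst p) < R" "dist 0 (snd p) < R"
    using dist_fst_le[of "(a, 0)" p] dist_snd_le[of "(a, 0)" p] by auto
  then show "\<bar>snd p\<bar> < 1/2" "\<bar>fst p - a\<bar> < X 1 - X 0"
    using R(1) X01 by (auto simp: dist_real_def min_def split: if_splits)
qed

lemma U_far:
  assumes "p \<in> S" "\<bar>snd p\<bar> > 1/2"
  shows "U j k p = 0"
proof -
  have W: "open {p :: real \<times> real. 1/2 < \<bar>snd p\<bar>}" by (intro open_Collect_less continuous_intros)
  have z: "U 0 0 q = 0" if "q \<in> {p. 1/2 < \<bar>snd p\<bar>} \<inter> interior S" for q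
  proof -
    have "q \<in> S" using that interior_subset by auto
    moreover have "\<eta> i q = 0" using cutoff_support(1)[of q] that calculation by (force simp: S_def)
    ultimately show ?thesis by (simp add: U_eq u_eq)
  qed
  show ?thesis
  proof (cases "j + k = 0")
    case True
    then show ?thesis using continuous_on_dense_eq[OF is_jet2_continuous[OF U_jet] dense_S W z, of p] assms by auto
  next
    case False
    then show ?thesis using is_jet2_const_zero[OF U_jet dense_S W z, of j k p] assms by auto
  qed
qed

lemma VV_pde:
  assumes "p \<in> Dom X"
  shows "snd p * VV 1 0 p - VV 0 2 p = 0"
proof -
  obtain x y where p: "p = (x, y)" by (cases p)
  have "\<sigma> * y * V 1 0 (\<sigma> * (x - a), \<sigma> * y) = V 0 2 (\<sigma> * (x - a), \<sigma> * y)"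
    by (rule V_pde) (use assms \<xi>_pos p in auto)
  moreover have "\<sigma>\<^sup>2 = 1" using \<sigma> by auto
  ultimately show ?thesis by (simp add: p VV_def mult_ac)
qed

text \<open>Applying the operator to the cut-off solution gives a function smooth off the singular
  point. It is zero where the cut-off is 1, so the puncture can be filled, and zero for
  \<bar>y\<bar> > 1/2, where the cut-off vanishes.\<close>

lemma ex_rhs:
  "\<exists>f. smooth_on \<Omega> f \<and> (\<exists>W. open W \<and> (a, 0) \<in> W \<and> {X 0..X 1} \<times> {-1, 1} \<subseteq> W \<and> (\<forall>p\<in>W \<inter> \<Omega>. f p = 0)) \<and>
    (\<forall>p\<in>Dom X. f p = snd p * U 1 0 p - U 0 2 p)"
proof -
  obtain W where W: "open W" "(a, 0) \<in> W" "\<And>p. p \<in> W \<Longrightarrow> p \<in> \<Omega> \<Longrightarrow> \<eta> i p = 1" by (rule cutoff_one) blast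
  obtain E where E: "is_jet2 S E" "\<And>p. E 0 0 p = snd p * U 1 0 p"
    by (rule is_jet2_mult_snd[OF is_jet2_shift[OF U_jet, of 1 0]]) simp
  define F where "F = (\<lambda>j k p. E j k p - U (0 + j) (2 + k) p)"
  have F: "is_jet2 S F" unfolding F_def by (rule is_jet2_diff[OF E(1) is_jet2_shift[OF U_jet]])
  have F0: "F 0 0 p = snd p * U 1 0 p - U 0 2 p" for p by (simp add: F_def E numeral_2_eq_2)
  have near: "F 0 0 p = 0" if "p \<in> W \<inter> interior S" for p
  proof -
    have p: "p \<in> W" "p \<in> S" "p \<in> Dom X" using that int_S Dom_sub_S by auto
    have "U j k p = VV j k p" for j k by (rule U_near[OF W(1,3) p(1,2)])
    then show ?thesis unfolding F0 using VV_pde[OF p(3)] by simp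
  qed
  define f where "f q = (if q = (a, 0) then 0 else F 0 0 q)" for q
  have "is_jet2 \<Omega> (\<lambda>j k q. if q = (a, 0) then 0 else F j k q)"
  proof (rule is_jet2_extend_zero[OF F[unfolded S_def] _ _ W(1,2)])
    show "\<Omega> \<subseteq> closure (interior \<Omega>)" unfolding int_\<Omega> by (simp add: \<Omega>_def)
    show "(a, 0) \<notin> interior \<Omega>" using int_\<Omega> sing_notin_Dom by simp
    show "F 0 0 q = 0" if "q \<in> W \<inter> interior \<Omega>" for q using near that int_\<Omega> int_S by simp
  qed
  then have "smooth_on \<Omega> f" unfolding smooth_on_iff_jet2 f_def by blast
  moreover have "f p = 0" if "p \<in> (W \<union> {p. 1/2 < \<bar>snd p\<bar>}) \<inter> \<Omega>" for p
  proof (cases "p = (a, 0)")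
    case False
    then have S: "p \<in> S" using that by (simp add: S_def)
    show ?thesis
    proof (cases "p \<in> W")
      case True
      then show ?thesis
        using continuous_on_dense_eq[OF is_jet2_continuous[OF F] dense_S W(1) near, of p] S False by (simp add: f_def)
    next
      case False
      then have "1/2 < \<bar>snd p\<bar>" using that by auto
      then show ?thesis using U_far[OF S] by (simp add: f_def F0)
    qed
  qed (simp add: f_def)
  moreover have "open (W \<union> {p. 1/2 < \<bar>snd p\<bar>})"
    by (intro open_Un W open_Collect_less continuous_intros)
  moreover have "{X 0..X 1} \<times> {-1, 1} \<subseteq> W \<union> {p. 1/2 < \<bar>snd p\<bar>}" by auto
  moreover have "f p = snd p * U 1 0 p - U 0 2 p" if "p \<in> Dom X" for p
    using that sing_notin_Dom by (auto simp: f_def F0)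
  ultimately show ?thesis using W(2) by (intro exI[of _ f] conjI exI[of _ "W \<union> {p. 1/2 < \<bar>snd p\<bar>}"] ballI) auto
qed

text \<open>An integrable majorant for the squares of all derivatives in \<open>Z0\<close>, up to
  constants. The exponents are those of the second y-derivative, the most singular one; the two
  terms in the second factor serve the two signs of y.\<close>

definition weight :: "real \<times> real \<Rightarrow> real" where
  "weight p = (indicator {0..X 1 - X 0} (\<sigma> * (fst p - a)) * (\<sigma> * (fst p - a)) powr (-3/4)) *
    (indicator {0..1} (snd p) * snd p powr (-3/4) + indicator {0..1} (- snd p) * (- snd p) powr (-3/4))"

lemma integrable_weight: "integrable lborel weight"
  unfolding weight_def
proof (rule integrable_tensor)
  have "integrable lborel (\<lambda>x. indicator {0..X 1 - X 0} (- (\<sigma> * a) + \<sigma> * x) * (- (\<sigma> * a) + \<sigma> * x) powr (-3/4))"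
    by (rule lborel_integrable_real_affine[OF integrable_powr_from_0]) (use X01 \<sigma> in auto)
  then show "integrable lborel (\<lambda>x. indicator {0..X 1 - X 0} (\<sigma> * (x - a)) * (\<sigma> * (x - a)) powr (-3/4))"
    by (simp add: algebra_simps)
  have "integrable lborel (\<lambda>x :: real. indicator {0..1} (0 + -1 * x) * (0 + -1 * x) powr (-3/4))"
    by (rule lborel_integrable_real_affine[OF integrable_powr_from_0]) auto
  then show "integrable lborel (\<lambda>y :: real. indicator {0..1} y * y powr (-3/4) + indicator {0..1} (- y) * (- y) powr (-3/4))"
    using integrable_powr_from_0[of "-3/4" 1] by (intro Bochner_Integration.integrable_add) auto
qed

lemma weight_eq:
  assumes "(x, y) \<in> Dom X" "y \<noteq> 0"
  shows "weight (x, y) = (\<sigma> * (x - a)) powr (-3/4) * \<bar>y\<bar> powr (-3/4)"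
proof -
  have "-1 < y" "y < 1" using assms by (auto simp: Dom_def)
  then show ?thesis using \<xi>_pos[OF assms(1)] assms(2) by (cases "y > 0") (auto simp: weight_def indicator_def)
qed

text \<open>A milder power of \<bar>x - a\<bar> costs a constant depending on the length of the
  interval, and the y-factor is at least 1 because \<bar>y\<bar> \<le> 1.\<close>

lemma weight_ge:
  assumes "(x, y) \<in> Dom X" "y \<noteq> 0" "0 \<le> s" "s \<le> 3/4"
  shows "(\<sigma> * (x - a)) powr (- s) \<le> (X 1 - X 0) powr (3/4 - s) * weight (x, y)"
proof -
  let ?x = "\<sigma> * (x - a)"
  have x: "0 < ?x" "?x < X 1 - X 0" using \<xi>_pos[OF assms(1)] by auto
  have y: "\<bar>y\<bar> \<le> 1" using assms by (auto simp: Dom_def)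
  have "?x powr (- s) = ?x powr (3/4 - s) * ?x powr (-3/4)" using x by (simp flip: powr_add)
  also have "\<dots> \<le> (X 1 - X 0) powr (3/4 - s) * ?x powr (-3/4)"
    using x assms by (intro mult_right_mono powr_mono2) auto
  also have "\<dots> = (X 1 - X 0) powr (3/4 - s) * (?x powr (-3/4) * 1)" by simp
  also have "\<dots> \<le> (X 1 - X 0) powr (3/4 - s) * (?x powr (-3/4) * \<bar>y\<bar> powr (-3/4))"
  proof (intro mult_left_mono)
    show "1 \<le> \<bar>y\<bar> powr (-3/4)"
      using powr_mono2'[of "-3/4" "\<bar>y\<bar>" 1] y assms(2) by simp
  qed auto
  finally show ?thesis by (simp add: weight_eq[OF assms(1,2)])
qed

lemma weight_ge_const:
  assumes "(x, y) \<in> Dom X" "y \<noteq> 0"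
  shows "1 \<le> (X 1 - X 0) powr (3/4) * weight (x, y)"
proof -
  have "\<sigma> * (x - a) \<noteq> 0" using \<xi>_pos[OF assms(1)] by auto
  then have "(\<sigma> * (x - a)) powr (- 0) = 1" by (simp only: minus_zero powr_zero_eq_one if_False)
  then show ?thesis using weight_ge[OF assms, of 0] by simp
qed

text \<open>Near the singular point \<open>U\<close> is \<open>VV\<close>; on the compact rest it is
  bounded, and constants are below a multiple of \<open>weight\<close>.\<close>

lemma square_bound_by_weight:
  assumes near: "\<And>x y. (x, y) \<in> Dom X \<Longrightarrow> y \<noteq> 0 \<Longrightarrow> (VV j k (x, y))\<^sup>2 \<le> C * weight (x, y)"
  shows "\<exists>C'. \<forall>p\<in>Dom X. snd p \<noteq> 0 \<longrightarrow> (U j k p)\<^sup>2 \<le> C' * weight p"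
proof -
  obtain W where W: "open W" "(a, 0) \<in> W" "\<And>p. p \<in> W \<Longrightarrow> p \<in> \<Omega> \<Longrightarrow> \<eta> i p = 1" by (rule cutoff_one) blast
  have "compact (\<Omega> - W)" by (rule compact_diff[OF compact_\<Omega> W(1)])
  moreover have "continuous_on (\<Omega> - W) (U j k)"
    by (rule continuous_on_subset[OF is_jet2_continuous[OF U_jet]]) (use W in \<open>auto simp: S_def\<close>)
  ultimately have "bounded (U j k ` (\<Omega> - W))" by (intro compact_imp_bounded compact_continuous_image)
  then obtain B where B: "\<And>p. p \<in> \<Omega> - W \<Longrightarrow> \<bar>U j k p\<bar> \<le> B" by (auto simp: bounded_iff)
  define C' where "C' = max C (B\<^sup>2 * (X 1 - X 0) powr (3/4))"
  have "(U j k p)\<^sup>2 \<le> C' * weight p" if p: "p \<in> Dom X" "snd p \<noteq> 0" for p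
  proof -
    obtain x y where xy: "p = (x, y)" by (cases p)
    have w: "weight p \<ge> 0" using weight_eq[of x y] p by (simp add: xy)
    show ?thesis
    proof (cases "p \<in> W")
      case True
      have "(U j k p)\<^sup>2 \<le> C * weight p"
        using near[of x y] p U_near[OF W(1,3) True] Dom_sub_S by (auto simp: xy)
      also have "\<dots> \<le> C' * weight p" using w by (intro mult_right_mono) (auto simp: C'_def)
      finally show ?thesis .
    next
      case False
      then have "p \<in> \<Omega> - W" using p Dom_sub_S by (auto simp: S_def)
      then have "(U j k p)\<^sup>2 \<le> B\<^sup>2" using B by (metis abs_ge_zero power2_abs power_mono)
      also have "\<dots> = B\<^sup>2 * 1" by simp
      also have "\<dots> \<le> B\<^sup>2 * ((X 1 - X 0) powr (3/4) * weight p)"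
        using weight_ge_const[of x y] p by (intro mult_left_mono) (auto simp: xy)
      also have "\<dots> \<le> C' * weight p"
        unfolding mult.assoc[symmetric] using w by (intro mult_right_mono) (auto simp: C'_def)
      finally show ?thesis .
    qed
  qed
  then show ?thesis by blast
qed

lemma \<sigma>_power_sq: "(\<sigma> ^ n * r)\<^sup>2 = r\<^sup>2"
  using \<sigma> by (auto simp: power_mult_distrib simp flip: power_mult)

lemma U_bounds:
  shows "\<exists>C. \<forall>p\<in>Dom X. snd p \<noteq> 0 \<longrightarrow> (U 0 0 p)\<^sup>2 \<le> C * weight p"
    and "\<exists>C. \<forall>p\<in>Dom X. snd p \<noteq> 0 \<longrightarrow> (U 0 1 p)\<^sup>2 \<le> C * weight p"
    and "\<exists>C. \<forall>p\<in>Dom X. snd p \<noteq> 0 \<longrightarrow> (U 0 2 p)\<^sup>2 \<le> C * weight p"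
proof -
  let ?l = "X 1 - X 0"
  show "\<exists>C. \<forall>p\<in>Dom X. snd p \<noteq> 0 \<longrightarrow> (U 0 0 p)\<^sup>2 \<le> C * weight p"
  proof -
    obtain B where B: "\<And>t. \<bar>\<Lambda> t\<bar> \<le> B" using bdd by (auto simp: bounded_iff)
    let ?m = "((1 + ?l powr (2/3)) powr (1/4) * B)\<^sup>2"
    show ?thesis
    proof (rule square_bound_by_weight)
    fix x y assume xy: "(x, y) \<in> Dom X" "y \<noteq> 0"
    have x: "0 < \<sigma> * (x - a)" "\<sigma> * (x - a) < ?l" using \<xi>_pos[OF xy(1)] by auto
    have "(\<sigma> * y)\<^sup>2 = y\<^sup>2" using \<sigma> by auto
    moreover have "\<bar>y\<bar> \<le> 1" using xy by (auto simp: Dom_def)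
    then have "y\<^sup>2 \<le> 1" using abs_square_le_1 by blast
    moreover have "(\<sigma> * (x - a)) powr (2/3) \<le> ?l powr (2/3)" using x by (intro powr_mono2) auto
    ultimately have r: "((\<sigma> * y)\<^sup>2 + (\<sigma> * (x - a)) powr (2/3)) powr (1/4) \<le> (1 + ?l powr (2/3)) powr (1/4)"
      by (intro powr_mono2) auto
    have "\<bar>v0 \<Lambda> (\<sigma> * (x - a)) (\<sigma> * y)\<bar> \<le> (1 + ?l powr (2/3)) powr (1/4) * B"
      unfolding v0_def Let_def abs_mult using r B by (intro mult_mono) (auto simp: powr_powr)
    moreover have "VV 0 0 (x, y) = v0 \<Lambda> (\<sigma> * (x - a)) (\<sigma> * y)"
      using x by (simp add: VV_def v0_similarity V_def e_def)
    ultimately have "(VV 0 0 (x, y))\<^sup>2 \<le> ?m * 1" by (metis abs_ge_zero mult_1_right power2_abs power_mono)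
    also have "\<dots> \<le> ?m * (?l powr (3/4) * weight (x, y))"
      using weight_ge_const[OF xy] by (intro mult_left_mono) auto
    finally show "(VV 0 0 (x, y))\<^sup>2 \<le> (?m * ?l powr (3/4)) * weight (x, y)" by (simp only: mult.assoc)
    qed
  qed
  show "\<exists>C. \<forall>p\<in>Dom X. snd p \<noteq> 0 \<longrightarrow> (U 0 1 p)\<^sup>2 \<le> C * weight p"
  proof -
    obtain C where C: "\<And>x y. x > 0 \<Longrightarrow> (V 0 1 (x, y))\<^sup>2 \<le> C * x powr (-1/3)" by (rule V_dy_bound) blast
    have "C \<ge> 0" using order_trans[OF zero_le_power2 C[of 1 0]] by simp
    show ?thesis
    proof (rule square_bound_by_weight)
      fix x y assume xy: "(x, y) \<in> Dom X" "y \<noteq> 0"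
      have "(VV 0 1 (x, y))\<^sup>2 = (V 0 1 (\<sigma> * (x - a), \<sigma> * y))\<^sup>2" using \<sigma>_power_sq[of 1] by (simp add: VV_def)
      also have "\<dots> \<le> C * (\<sigma> * (x - a)) powr (-(1/3))" using C[of "\<sigma> * (x - a)"] \<xi>_pos[OF xy(1)] by simp
      also have "\<dots> \<le> C * (?l powr (3/4 - 1/3) * weight (x, y))"
        using weight_ge[OF xy, of "1/3"] \<open>C \<ge> 0\<close> by (intro mult_left_mono) auto
      finally show "(VV 0 1 (x, y))\<^sup>2 \<le> (C * ?l powr (3/4 - 1/3)) * weight (x, y)" by (simp only: mult.assoc)
    qed
  qed
  show "\<exists>C. \<forall>p\<in>Dom X. snd p \<noteq> 0 \<longrightarrow> (U 0 2 p)\<^sup>2 \<le> C * weight p"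
  proof -
    obtain C where C: "\<And>x y. x > 0 \<Longrightarrow> y \<noteq> 0 \<Longrightarrow> (V 0 2 (x, y))\<^sup>2 \<le> C * (x powr (-3/4) * \<bar>y\<bar> powr (-3/4))"
      by (rule V_dyy_bound) blast
    show ?thesis
    proof (rule square_bound_by_weight)
      fix x y assume xy: "(x, y) \<in> Dom X" "y \<noteq> 0"
      have "\<bar>\<sigma> * y\<bar> = \<bar>y\<bar>" "\<sigma> * y \<noteq> 0" using \<sigma> xy by auto
      then show "(VV 0 2 (x, y))\<^sup>2 \<le> C * weight (x, y)"
        using C[of "\<sigma> * (x - a)" "\<sigma> * y"] \<xi>_pos[OF xy(1)] \<sigma>_power_sq[of 2]
        by (simp add: VV_def weight_eq[OF xy])
    qed
  qed
qed

section \<open>Weak derivatives and membership in \<open>Z0\<close>\<close>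

lemma U_continuous_Dom: "continuous_on (Dom X) (U j k)"
  by (rule continuous_on_subset[OF is_jet2_continuous[OF U_jet] Dom_sub_S])

lemma distr_of_u: "distr_of (Dom X) u = distr_of (Dom X) (U 0 0)"
  unfolding distr_of_def
  by (intro ext Bochner_Integration.integral_cong) (use U_eq Dom_sub_S in auto)

lemma L2_cong: "(\<And>p. p \<in> Dom X \<Longrightarrow> f p = g p) \<Longrightarrow> f \<in> L2 (Dom X) \<Longrightarrow> g \<in> L2 (Dom X)"
  unfolding L2_def
  using measurable_cong[of "lebesgue_on (Dom X)" f g borel]
    Bochner_Integration.integrable_cong[of "lebesgue_on (Dom X)" "lebesgue_on (Dom X)" "\<lambda>p. (f p)\<^sup>2" "\<lambda>p. (g p)\<^sup>2"]
  by auto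

lemma u_L2: "u \<in> L2 (Dom X)"
proof -
  have "U 0 0 \<in> L2 (Dom X)"
    using U_bounds(1) L2_of_bound[OF U_continuous_Dom integrable_weight] by blast
  then show ?thesis by (rule L2_cong[rotated]) (use U_eq Dom_sub_S in auto)
qed

lemma transport_distr:
  assumes "test_fun (Dom X) \<phi>"
  shows "distr_mult snd (distr_dx (distr_of (Dom X) u)) \<phi> = distr_of (Dom X) (\<lambda>p. snd p * U 1 0 p) \<phi>"
  using distr_of_parts(1)[OF U_jet int_S test_fun_mult_snd[OF assms], of 0 0]
  unfolding distr_mult_def distr_dx_def distr_of_u
  by (simp add: distr_of_def mult_ac)

lemma dy_distr:
  assumes "test_fun (Dom X) \<phi>"
  shows "distr_dy (distr_of (Dom X) u) \<phi> = distr_of (Dom X) (U 0 1) \<phi>"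
  using distr_of_parts(2)[OF U_jet int_S assms, of 0 0] unfolding distr_dy_def distr_of_u by simp

lemma dyy_distr:
  assumes "test_fun (Dom X) \<phi>"
  shows "distr_dy (distr_dy (distr_of (Dom X) u)) \<phi> = distr_of (Dom X) (U 0 2) \<phi>"
  using distr_of_parts(2)[OF U_jet int_S assms, of 0 1] dy_distr[OF test_fun_deriv(2)[OF assms]]
  unfolding distr_dy_def[of "distr_dy _"] by (simp add: numeral_2_eq_2)

text \<open>The transport term is not estimated directly: by the equation it is the bounded function
  f plus the second y-derivative, whose square is already dominated.\<close>

lemma u_Z0:
  assumes f: "continuous_on \<Omega> f" "\<And>p. p \<in> Dom X \<Longrightarrow> f p = snd p * U 1 0 p - U 0 2 p"
  shows "u \<in> Z0 (Dom X)"
proof -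
  obtain B where B: "\<And>p. p \<in> \<Omega> \<Longrightarrow> \<bar>f p\<bar> \<le> B"
    using compact_imp_bounded[OF compact_continuous_image[OF f(1) compact_\<Omega>]] by (auto simp: bounded_iff)
  obtain C where C: "\<And>p. p \<in> Dom X \<Longrightarrow> snd p \<noteq> 0 \<Longrightarrow> (U 0 2 p)\<^sup>2 \<le> C * weight p" using U_bounds(3) by blast
  have "(\<lambda>p. snd p * U 1 0 p) \<in> L2 (Dom X)"
  proof (rule L2_of_bound[OF _ integrable_weight])
    show "continuous_on (Dom X) (\<lambda>p. snd p * U 1 0 p)" by (intro continuous_intros U_continuous_Dom)
    fix p assume p: "p \<in> Dom X" "snd p \<noteq> 0"
    obtain x y where xy: "p = (x, y)" by (cases p)
    have "snd p * U 1 0 p = f p + U 0 2 p" using f(2)[OF p(1)] by simp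
    then have "(snd p * U 1 0 p)\<^sup>2 \<le> 2 * (f p)\<^sup>2 + 2 * (U 0 2 p)\<^sup>2"
      using sum_squares_bound[of "f p" "U 0 2 p"] by (simp add: power2_sum)
    moreover have "(f p)\<^sup>2 \<le> B\<^sup>2 * ((X 1 - X 0) powr (3/4) * weight p)"
    proof -
      have "p \<in> \<Omega>" using p(1) Dom_sub_S by (auto simp: S_def)
      from power_mono[OF B[OF this] abs_ge_zero, of 2] have "(f p)\<^sup>2 \<le> B\<^sup>2 * 1" by simp
      also have "\<dots> \<le> B\<^sup>2 * ((X 1 - X 0) powr (3/4) * weight p)"
        using weight_ge_const[of x y] p by (intro mult_left_mono) (auto simp: xy)
      finally show ?thesis .
    qed
    ultimately show "(snd p * U 1 0 p)\<^sup>2 \<le> (2 * (B\<^sup>2 * (X 1 - X 0) powr (3/4)) + 2 * C) * weight p"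
      using C[OF p] by (simp add: algebra_simps)
  qed
  moreover have "U 0 1 \<in> L2 (Dom X)" "U 0 2 \<in> L2 (Dom X)"
    using U_bounds(2,3) L2_of_bound[OF U_continuous_Dom integrable_weight] by blast+
  ultimately show ?thesis
    unfolding Z0_def distr_in_L2_def distr_eq_def
    using u_L2 transport_distr dy_distr dyy_distr by blast
qed

section \<open>Boundary values and the boundary value problem\<close>

lemma u_trace:
  assumes "\<And>s. s \<in> I \<Longrightarrow> \<gamma> s \<in> S \<and> u (\<gamma> s) = 0 \<and> (\<forall>\<^sub>F h in at_right 0. \<gamma> s + h *\<^sub>R n \<in> Dom X)" and I: "I \<in> sets borel"
  shows "has_trace (Dom X) u I \<gamma> n (\<lambda>_. 0)"
  unfolding has_trace_def
proof (intro exI conjI)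
  have "((\<lambda>h. u (\<gamma> s + h *\<^sub>R n)) \<longlongrightarrow> 0) (at_right 0)" if "s \<in> I" for s
  proof -
    have s: "\<gamma> s \<in> S" "u (\<gamma> s) = 0" "\<forall>\<^sub>F h in at_right 0. \<gamma> s + h *\<^sub>R n \<in> Dom X" using assms(1)[OF that] by auto
    have ev: "\<forall>\<^sub>F h in at_right 0. \<gamma> s + h *\<^sub>R n \<in> S" using s(3) by eventually_elim (use Dom_sub_S in auto)
    have "((\<lambda>h. \<gamma> s + h *\<^sub>R n) \<longlongrightarrow> \<gamma> s + 0 *\<^sub>R n) (at_right 0)" by (intro tendsto_intros)
    then have "((\<lambda>h. U 0 0 (\<gamma> s + h *\<^sub>R n)) \<longlongrightarrow> U 0 0 (\<gamma> s)) (at_right 0)"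
      by (intro continuous_on_tendsto_compose[OF is_jet2_continuous[OF U_jet] _ s(1) ev]) simp
    then have "((\<lambda>h. U 0 0 (\<gamma> s + h *\<^sub>R n)) \<longlongrightarrow> 0) (at_right 0)" using s by (simp add: U_eq)
    then show ?thesis by (rule Lim_transform_eventually) (use ev in \<open>eventually_elim; simp add: U_eq\<close>)
  qed
  then show "AE s in lebesgue_on I. ((\<lambda>h. u (\<gamma> s + h *\<^sub>R n)) \<longlongrightarrow> 0) (at_right 0)"
    unfolding AE_lebesgue_on_iff[OF I] by simp
qed simp

text \<open>If the singular point is on this side, the value is the limit of the profile at plus
  infinity, which is zero; otherwise the cut-off vanishes here.\<close>

lemma u_zero_left: "0 < y \<Longrightarrow> y < 1 \<Longrightarrow> u (X 0, y) = 0"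
proof -
  assume y: "0 < y" "y < 1"
  then have S: "(X 0, y) \<in> S" using X01 by (auto simp: S_def \<Omega>_eq)
  show ?thesis
  proof (cases "\<sigma> = 1")
    case True
    then have "a = X 0" using \<sigma> by auto
    then show ?thesis using V_trace[OF y(1)] True by (simp add: u_eq[OF S] VV_def)
  next
    case False
    then have "a = X 1" using \<sigma> by auto
    then have "\<eta> i (X 0, y) = 0" using cutoff_support(2)[of "(X 0, y)"] S X01 by (force simp: S_def)
    then show ?thesis by (simp add: u_eq[OF S])
  qed
qed

lemma u_zero_right: "-1 < y \<Longrightarrow> y < 0 \<Longrightarrow> u (X 1, y) = 0"
proof -
  assume y: "-1 < y" "y < 0"
  then have S: "(X 1, y) \<in> S" using X01 by (auto simp: S_def \<Omega>_eq)
  show ?thesis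
  proof (cases "\<sigma> = 1")
    case False
    then have "a = X 1" "\<sigma> = -1" using \<sigma> by auto
    then show ?thesis unfolding u_eq[OF S] using V_trace[of "- y"] y by (simp add: VV_def)
  next
    case True
    then have "a = X 0" using \<sigma> by auto
    then have "\<eta> i (X 1, y) = 0" using cutoff_support(2)[of "(X 1, y)"] S X01 by (force simp: S_def)
    then show ?thesis unfolding u_eq[OF S] by simp
  qed
qed

lemma u_zero_horizontal: "(x, y) \<in> S \<Longrightarrow> \<bar>y\<bar> = 1 \<Longrightarrow> u (x, y) = 0"
  using U_far[of "(x, y)" 0 0] U_eq[of "(x, y)"] by simp

lemma u_bvp:
  assumes f: "continuous_on \<Omega> f" "\<And>p. p \<in> Dom X \<Longrightarrow> f p = snd p * U 1 0 p - U 0 2 p"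
  shows "bvp_solution X f u"
  unfolding bvp_solution_def
proof (intro conjI)
  show "distr_eq (Dom X) (distr_diff (distr_mult snd (distr_dx (distr_of (Dom X) u))) (distr_dy (distr_dy (distr_of (Dom X) u))))
     (distr_of (Dom X) f)"
    unfolding distr_eq_def distr_diff_def
  proof (intro allI impI)
    fix \<phi> assume t: "test_fun (Dom X) \<phi>"
    have i: "integrable (lebesgue_on (Dom X)) (\<lambda>p. snd p * U 1 0 p * \<phi> p)" "integrable (lebesgue_on (Dom X)) (\<lambda>p. U 0 2 p * \<phi> p)"
      using distr_of_parts(3)[OF U_jet int_S test_fun_mult_snd[OF t], of 1 0] distr_of_parts(3)[OF U_jet int_S t, of 0 2]
      by (simp_all add: mult_ac)
    have "distr_of (Dom X) (\<lambda>p. snd p * U 1 0 p) \<phi> - distr_of (Dom X) (U 0 2) \<phi>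
        = integral\<^sup>L (lebesgue_on (Dom X)) (\<lambda>p. snd p * U 1 0 p * \<phi> p - U 0 2 p * \<phi> p)"
      unfolding distr_of_def using i by (rule Bochner_Integration.integral_diff[symmetric])
    also have "\<dots> = distr_of (Dom X) f \<phi>"
      unfolding distr_of_def by (intro Bochner_Integration.integral_cong refl) (simp add: f(2) left_diff_distrib)
    finally show "distr_mult snd (distr_dx (distr_of (Dom X) u)) \<phi> - distr_dy (distr_dy (distr_of (Dom X) u)) \<phi> = distr_of (Dom X) f \<phi>"
      by (simp add: transport_distr[OF t] dyy_distr[OF t])
  qed
  have small: "\<forall>\<^sub>F h in at_right 0. 0 < h \<and> h < c" if "c > 0" for c :: real
    using eventually_at_right_less[of "0::real"] order_tendstoD(2)[OF tendsto_ident_at that] by (rule eventually_conj)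
  have l: "0 < X 1 - X 0" using X01 by simp
  show "has_trace (Dom X) u {0<..<1} (\<lambda>y. (X 0, y)) (1, 0) (\<lambda>_. 0)"
  proof (rule u_trace)
    fix y :: real assume y: "y \<in> {0<..<1}"
    have "\<forall>\<^sub>F h in at_right 0. (X 0, y) + h *\<^sub>R (1, 0) \<in> Dom X"
      using small[OF l] by eventually_elim (use y in \<open>simp add: Dom_def\<close>)
    then show "(X 0, y) \<in> S \<and> u (X 0, y) = 0 \<and> (\<forall>\<^sub>F h in at_right 0. (X 0, y) + h *\<^sub>R (1, 0) \<in> Dom X)"
      using X01 u_zero_left[of y] y by (simp add: S_def \<Omega>_eq)
  qed simp
  show "has_trace (Dom X) u {-1<..<0} (\<lambda>y. (X 1, y)) (-1, 0) (\<lambda>_. 0)"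
  proof (rule u_trace)
    fix y :: real assume y: "y \<in> {-1<..<0}"
    have "\<forall>\<^sub>F h in at_right 0. (X 1, y) + h *\<^sub>R (-1, 0) \<in> Dom X"
      using small[OF l] by eventually_elim (use y in \<open>simp add: Dom_def\<close>)
    then show "(X 1, y) \<in> S \<and> u (X 1, y) = 0 \<and> (\<forall>\<^sub>F h in at_right 0. (X 1, y) + h *\<^sub>R (-1, 0) \<in> Dom X)"
      using X01 u_zero_right[of y] y by (simp add: S_def \<Omega>_eq)
  qed simp
  have two: "0 < (2::real)" by simp
  show "has_trace (Dom X) u {X 0<..<X 1} (\<lambda>x. (x, -1)) (0, 1) (\<lambda>_. 0)"
  proof (rule u_trace)
    fix x assume x: "x \<in> {X 0<..<X 1}"
    have "\<forall>\<^sub>F h in at_right 0. (x, -1) + h *\<^sub>R (0, 1) \<in> Dom X"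
      using small[OF two] by eventually_elim (use x in \<open>simp add: Dom_def\<close>)
    moreover have "(x, -1) \<in> S" using x by (simp add: S_def \<Omega>_eq)
    ultimately show "(x, -1) \<in> S \<and> u (x, -1) = 0 \<and> (\<forall>\<^sub>F h in at_right 0. (x, -1) + h *\<^sub>R (0, 1) \<in> Dom X)"
      using u_zero_horizontal[of x "-1"] by simp
  qed simp
  show "has_trace (Dom X) u {X 0<..<X 1} (\<lambda>x. (x, 1)) (0, -1) (\<lambda>_. 0)"
  proof (rule u_trace)
    fix x assume x: "x \<in> {X 0<..<X 1}"
    have "\<forall>\<^sub>F h in at_right 0. (x, 1) + h *\<^sub>R (0, -1) \<in> Dom X"
      using small[OF two] by eventually_elim (use x in \<open>simp add: Dom_def\<close>)
    moreover have "(x, 1) \<in> S" using x by (simp add: S_def \<Omega>_eq)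
    ultimately show "(x, 1) \<in> S \<and> u (x, 1) = 0 \<and> (\<forall>\<^sub>F h in at_right 0. (x, 1) + h *\<^sub>R (0, -1) \<in> Dom X)"
      using u_zero_horizontal[of x 1] by simp
  qed simp
qed

end

section \<open>Failure of the regularity\<close>

text \<open>Turns identities valid for almost every slice, as in the definition of the
  Bochner-Sobolev space, into identities against tensor products. It will be used with a derivative
  on one side and the function itself on the other.\<close>

lemma slicewise_integral_dx:
  fixes F G :: "real \<times> real \<Rightarrow> real"
  assumes F: "integrable lborel F" and G: "integrable lborel G"
    and a: "test_fun_real A \<alpha>" and a': "test_fun_real A' \<alpha>'" and b: "test_fun_real B \<beta>"
    and eq: "AE y in lborel. (LINT x|lborel. F (x, y) * \<alpha> x) = - (LINT x|lborel. G (x, y) * \<alpha>' x)"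
  shows "(LINT p|lborel. F p * (\<alpha> (fst p) * \<beta> (snd p))) = - (LINT p|lborel. G p * (\<alpha>' (fst p) * \<beta> (snd p)))"
proof -
  note iF = integrable_tensor_weight[OF F a b] and iG = integrable_tensor_weight[OF G a' b]
  have "(LINT y|lborel. LINT x|lborel. F (x, y) * (\<alpha> x * \<beta> y)) = (LINT y|lborel. - (LINT x|lborel. G (x, y) * (\<alpha>' x * \<beta> y)))"
  proof (rule integral_cong_AE)
    show "(\<lambda>y. LINT x|lborel. F (x, y) * (\<alpha> x * \<beta> y)) \<in> borel_measurable lborel"
      "(\<lambda>y. - (LINT x|lborel. G (x, y) * (\<alpha>' x * \<beta> y))) \<in> borel_measurable lborel"
      using lborel_fubini_snd(2)[OF iF] lborel_fubini_snd(2)[OF iG] by simp_all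
    show "AE y in lborel. (LINT x|lborel. F (x, y) * (\<alpha> x * \<beta> y)) = - (LINT x|lborel. G (x, y) * (\<alpha>' x * \<beta> y))"
      using eq by eventually_elim (simp flip: mult.assoc)
  qed
  then show ?thesis unfolding lborel_fubini_snd(3)[OF iF] lborel_fubini_snd(3)[OF iG] by simp
qed

lemma slicewise_integral_dy:
  fixes F G :: "real \<times> real \<Rightarrow> real"
  assumes F: "integrable lborel F" and G: "integrable lborel G"
    and a: "test_fun_real A \<alpha>" and b: "test_fun_real B \<beta>" and b': "test_fun_real B' \<beta>'"
    and eq: "AE x in lborel. (LINT y|lborel. F (x, y) * \<beta> y) = - (LINT y|lborel. G (x, y) * \<beta>' y)"
  shows "(LINT p|lborel. F p * (\<alpha> (fst p) * \<beta> (snd p))) = - (LINT p|lborel. G p * (\<alpha> (fst p) * \<beta>' (snd p)))"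
proof -
  have "(LINT p|lborel. F (prod.swap p) * (\<beta> (fst p) * \<alpha> (snd p))) = - (LINT p|lborel. G (prod.swap p) * (\<beta>' (fst p) * \<alpha> (snd p)))"
    by (rule slicewise_integral_dx[OF lborel_swap(1)[OF F] lborel_swap(1)[OF G] b b' a]) (use eq in simp)
  then show ?thesis
    using lborel_swap(2)[OF integrable_tensor_weight[OF F a b]] lborel_swap(2)[OF integrable_tensor_weight[OF G a b']]
    by (simp add: mult.commute mult.left_commute)
qed

text \<open>By Fubini, almost every slice of u agrees almost everywhere with that of its Borel
  representative.\<close>

lemma slice_integral_eq:
  assumes r: "borel_rep (Dom X) u u'" and \<psi>: "\<psi> \<in> borel_measurable borel"
  shows "AE y in lborel. y \<in> {-1<..<1} \<longrightarrow>
      integral\<^sup>L (lebesgue_on {X 0<..<X 1}) (\<lambda>x. u (x, y) * \<psi> x) = (LINT x|lborel. u' (x, y) * \<psi> x)"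
    and "AE x in lborel. x \<in> {X 0<..<X 1} \<longrightarrow>
      integral\<^sup>L (lebesgue_on {-1<..<1}) (\<lambda>y. u (x, y) * \<psi> y) = (LINT y|lborel. u' (x, y) * \<psi> y)"
proof -
  note m = borel_measurable_curry[OF borel_repD(1)[OF r]]
  show "AE y in lborel. y \<in> {-1<..<1} \<longrightarrow>
      integral\<^sup>L (lebesgue_on {X 0<..<X 1}) (\<lambda>x. u (x, y) * \<psi> x) = (LINT x|lborel. u' (x, y) * \<psi> x)"
    using AE_lborel_snd[OF borel_repD(5)[OF r]]
  proof eventually_elim
    case (elim y)
    show ?case
    proof
      assume y: "y \<in> {-1<..<1}"
      show "integral\<^sup>L (lebesgue_on {X 0<..<X 1}) (\<lambda>x. u (x, y) * \<psi> x) = (LINT x|lborel. u' (x, y) * \<psi> x)"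
      proof (rule lebesgue_on_integral_eq)
        show "(\<lambda>x. u' (x, y) * \<psi> x) \<in> borel_measurable borel" using m(2)[of y] \<psi> by simp
        show "AE x in lborel. x \<in> {X 0<..<X 1} \<longrightarrow> u (x, y) * \<psi> x = u' (x, y) * \<psi> x"
          using elim by eventually_elim (use y in \<open>simp add: Dom_def\<close>)
        show "u' (x, y) * \<psi> x = 0" if "x \<notin> {X 0<..<X 1}" for x
          using borel_repD(4)[OF r, of "(x, y)"] that by (auto simp: Dom_def)
      qed simp
    qed
  qed
  show "AE x in lborel. x \<in> {X 0<..<X 1} \<longrightarrow>
      integral\<^sup>L (lebesgue_on {-1<..<1}) (\<lambda>y. u (x, y) * \<psi> y) = (LINT y|lborel. u' (x, y) * \<psi> y)"
    using AE_lborel_fst[OF borel_repD(5)[OF r]]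
  proof eventually_elim
    case (elim x)
    show ?case
    proof
      assume x: "x \<in> {X 0<..<X 1}"
      show "integral\<^sup>L (lebesgue_on {-1<..<1}) (\<lambda>y. u (x, y) * \<psi> y) = (LINT y|lborel. u' (x, y) * \<psi> y)"
      proof (rule lebesgue_on_integral_eq)
        show "(\<lambda>y. u' (x, y) * \<psi> y) \<in> borel_measurable borel" using m(1)[of x] \<psi> by simp
        show "AE y in lborel. y \<in> {-1<..<1} \<longrightarrow> u (x, y) * \<psi> y = u' (x, y) * \<psi> y"
          using elim by eventually_elim (use x in \<open>simp add: Dom_def\<close>)
        show "u' (x, y) * \<psi> y = 0" if "y \<notin> {-1<..<1}" for y
          using borel_repD(4)[OF r, of "(x, y)"] that by (auto simp: Dom_def)
      qed simp
    qed
  qed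
qed

lemma test_fun_real_mono: "test_fun_real I \<psi> \<Longrightarrow> I \<subseteq> J \<Longrightarrow> test_fun_real J \<psi>"
  by (auto simp: test_fun_real_def)

text \<open>Derivatives of the singular solution need not be integrable up to the boundary, so
  identities are proved on rectangles at positive distance from it; countably many of these fill the
  domain.\<close>

lemma AE_zero_exhaustion:
  fixes a b c d :: real
  assumes "\<And>a' b' c' d'. a < a' \<Longrightarrow> b' < b \<Longrightarrow> c < c' \<Longrightarrow> d' < d \<Longrightarrow>
      AE p in lborel. p \<in> {a'<..<b'} \<times> {c'<..<d'} \<longrightarrow> Q p"
  shows "AE p in lborel. p \<in> {a<..<b} \<times> {c<..<d} \<longrightarrow> Q p"
proof -
  define h where "h n = 1 / real (Suc n)" for n
  have h: "h n > 0" for n by (simp add: h_def)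
  have "AE p in lborel. \<forall>n. p \<in> {a + h n<..<b - h n} \<times> {c + h n<..<d - h n} \<longrightarrow> Q p"
    unfolding AE_all_countable by (intro allI assms) (use h in auto)
  then show ?thesis
  proof eventually_elim
    case (elim p)
    show ?case
    proof
      assume p: "p \<in> {a<..<b} \<times> {c<..<d}"
      then obtain x y where xy: "p = (x, y)" "a < x" "x < b" "c < y" "y < d" by auto
      have "h \<longlonglongrightarrow> 0" unfolding h_def by (rule LIMSEQ_Suc[OF lim_1_over_n])
      then have "\<forall>\<^sub>F n in sequentially. h n < min (min (x - a) (b - x)) (min (y - c) (d - y))"
        by (rule order_tendstoD) (use xy in auto)
      then obtain n where "h n < min (min (x - a) (b - x)) (min (y - c) (d - y))"
        by (auto simp: eventually_sequentially)
      then have "p \<in> {a + h n<..<b - h n} \<times> {c + h n<..<d - h n}" using xy by auto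
      then show "Q p" using elim by blast
    qed
  qed
qed

lemma measure_reflected_interval:
  fixes \<sigma> a p q :: real
  assumes "\<sigma> = 1 \<or> \<sigma> = -1" "p \<le> q"
  shows "{x. \<sigma> * (x - a) \<in> {p..q}} \<in> sets borel"
    and "integrable lborel (indicator {x. \<sigma> * (x - a) \<in> {p..q}} :: real \<Rightarrow> real)"
    and "(LINT x|lborel. indicator {x. \<sigma> * (x - a) \<in> {p..q}} x) = q - p"
proof -
  have "{x. \<sigma> * (x - a) \<in> {p..q}} = {a + p..a + q} \<or> {x. \<sigma> * (x - a) \<in> {p..q}} = {a - q..a - p}"
    using assms(1) by auto
  then show "{x. \<sigma> * (x - a) \<in> {p..q}} \<in> sets borel"
    "integrable lborel (indicator {x. \<sigma> * (x - a) \<in> {p..q}} :: real \<Rightarrow> real)"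
    "(LINT x|lborel. indicator {x. \<sigma> * (x - a) \<in> {p..q}} x) = q - p"
    using assms(2) by (auto intro!: integrable_real_indicator)
qed

section \<open>Weak derivatives against classical ones, and the mixed derivative\<close>

context singular
begin

lemma U_integrable_subrect:
  assumes "X 0 < a'" "b' < X 1" "-1 < c'" "d' < 1"
  shows "integrable lborel (\<lambda>p. indicator ({a'<..<b'} \<times> {c'<..<d'}) p * U j k p)"
proof -
  let ?C = "{a'..b'} \<times> {c'..d'}"
  have "continuous_on ?C (U j k)"
    by (rule continuous_on_subset[OF U_continuous_Dom]) (use assms in \<open>auto simp: Dom_def\<close>)
  then have "integrable lborel (\<lambda>p. indicator ?C p *\<^sub>R U j k p)"
    by (intro borel_integrable_compact compact_Times) auto
  from integrable_mult_indicator[OF _ this, of "{a'<..<b'} \<times> {c'<..<d'}"]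
  have "integrable lborel (\<lambda>p. indicator ({a'<..<b'} \<times> {c'<..<d'}) p *\<^sub>R (indicator ?C p *\<^sub>R U j k p))"
    by (simp add: borel_open open_Times)
  then show ?thesis
    by (rule Bochner_Integration.integrable_cong[THEN iffD1, rotated 2]) (auto simp: indicator_def)
qed

lemma U_tensor_integral:
  assumes a: "test_fun_real {a'<..<b'} \<alpha>" and b: "test_fun_real {c'<..<d'} \<beta>"
    and ab: "X 0 < a'" "b' < X 1" "-1 < c'" "d' < 1"
  shows "(LINT p|lborel. indicator ({a'<..<b'} \<times> {c'<..<d'}) p * U j k p * (\<alpha> (fst p) * \<beta> (snd p)))
    = distr_of (Dom X) (U j k) (\<lambda>(x, y). \<alpha> x * \<beta> y)"
proof -
  have "integrable lborel (\<lambda>p. indicator ({a'<..<b'} \<times> {c'<..<d'}) p * U j k p * (\<alpha> (fst p) * \<beta> (snd p)))"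
    by (rule integrable_tensor_weight[OF U_integrable_subrect[OF ab] a b])
  then have m: "(\<lambda>p. indicator ({a'<..<b'} \<times> {c'<..<d'}) p * U j k p * (\<alpha> (fst p) * \<beta> (snd p))) \<in> borel_measurable borel" by simp
  show ?thesis
    unfolding distr_of_def
  proof (rule lebesgue_on_integral_eq[OF Dom_borel(1) m, symmetric])
    have z: "\<alpha> (fst p) * \<beta> (snd p) = 0" if "p \<notin> {a'<..<b'} \<times> {c'<..<d'}" for p
      using that test_fun_real_outside[OF a, of "fst p"] test_fun_real_outside[OF b, of "snd p"] by (cases p) auto
    show "AE p in lborel. p \<in> Dom X \<longrightarrow> U j k p * (case p of (x, y) \<Rightarrow> \<alpha> x * \<beta> y)
        = indicator ({a'<..<b'} \<times> {c'<..<d'}) p * U j k p * (\<alpha> (fst p) * \<beta> (snd p))"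
    proof (intro AE_I2 impI)
      fix p show "U j k p * (case p of (x, y) \<Rightarrow> \<alpha> x * \<beta> y)
        = indicator ({a'<..<b'} \<times> {c'<..<d'}) p * U j k p * (\<alpha> (fst p) * \<beta> (snd p))"
        using z[of p] by (cases "p \<in> {a'<..<b'} \<times> {c'<..<d'}") (auto simp: split_beta)
    qed
    show "indicator ({a'<..<b'} \<times> {c'<..<d'}) p * U j k p * (\<alpha> (fst p) * \<beta> (snd p)) = 0" if "p \<notin> Dom X" for p
      using that ab by (auto simp: indicator_def Dom_def)
  qed
qed

text \<open>On a rectangle well inside the domain both sides act equally on tensor products, the
  classical one by parts, so the fundamental lemma identifies them.\<close>

lemma weak_dx_eq_U:
  assumes r: "borel_rep (Dom X) u u'" and w: "integrable lborel w'"
    and weak: "\<And>\<alpha> \<beta>. test_fun_real {X 0<..<X 1} \<alpha> \<Longrightarrow> test_fun_real {-1<..<1} \<beta> \<Longrightarrow>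
      (LINT p|lborel. u' p * (deriv \<alpha> (fst p) * \<beta> (snd p))) = - (LINT p|lborel. w' p * (\<alpha> (fst p) * \<beta> (snd p)))"
  shows "AE p in lborel. p \<in> Dom X \<longrightarrow> w' p = U 1 0 p"
  unfolding Dom_def
proof (rule AE_zero_exhaustion)
  fix a' b' c' d' :: real assume ab: "X 0 < a'" "b' < X 1" "-1 < c'" "d' < 1"
  let ?R = "{a'<..<b'} \<times> {c'<..<d'}"
  note i = U_integrable_subrect[OF ab, of 1 0]
  have "AE p in lborel. p \<in> ?R \<longrightarrow> indicator ?R p * U 1 0 p - w' p = 0"
  proof (rule tensor_AE_zero)
    show "integrable lborel (\<lambda>p. indicator ?R p * U 1 0 p - w' p)" using i w by simp
    fix \<alpha> \<beta> assume a: "test_fun_real {a'<..<b'} \<alpha>" and b: "test_fun_real {c'<..<d'} \<beta>"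
    have a1: "test_fun_real {X 0<..<X 1} \<alpha>" by (rule test_fun_real_mono[OF a]) (use ab in auto)
    have b1: "test_fun_real {-1<..<1} \<beta>" by (rule test_fun_real_mono[OF b]) (use ab in auto)
    have t: "test_fun (Dom X) (\<lambda>(x, y). \<alpha> x * \<beta> y)" unfolding Dom_def by (rule test_fun_tensor[OF a1 b1])
    have "(LINT p|lborel. indicator ?R p * U 1 0 p * (\<alpha> (fst p) * \<beta> (snd p))) = distr_of (Dom X) (U 1 0) (\<lambda>(x, y). \<alpha> x * \<beta> y)"
      by (rule U_tensor_integral[OF a b ab])
    also have "\<dots> = - distr_of (Dom X) u (\<lambda>(x, y). deriv \<alpha> x * \<beta> y)"
      using distr_of_parts(1)[OF U_jet int_S t, of 0 0] unfolding tensor_dx[OF test_fun_real_smooth[OF a]] distr_of_u by simp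
    also have "\<dots> = - (LINT p|lborel. u' p * (deriv \<alpha> (fst p) * \<beta> (snd p)))"
      using distr_of_rep[OF r Dom_borel(1) tensor_measurable[OF test_fun_real_measurable[OF test_fun_real_deriv[OF a]] test_fun_real_measurable[OF b]]]
      by (simp add: split_beta)
    also have "\<dots> = (LINT p|lborel. w' p * (\<alpha> (fst p) * \<beta> (snd p)))" using weak[OF a1 b1] by simp
    finally show "(LINT p|lborel. (indicator ?R p * U 1 0 p - w' p) * (\<alpha> (fst p) * \<beta> (snd p))) = 0"
      using integrable_tensor_weight[OF i a b] integrable_tensor_weight[OF w a b] by (simp add: left_diff_distrib)
  qed
  then show "AE p in lborel. p \<in> ?R \<longrightarrow> w' p = U 1 0 p" by eventually_elim auto
qed

lemma weak_dy_eq_U: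
  assumes w: "integrable lborel w'" and wU: "AE p in lborel. p \<in> Dom X \<longrightarrow> w' p = U 1 0 p" and g: "integrable lborel g'"
    and weak: "\<And>\<alpha> \<beta>. test_fun_real {X 0<..<X 1} \<alpha> \<Longrightarrow> test_fun_real {-1<..<1} \<beta> \<Longrightarrow>
      (LINT p|lborel. w' p * (\<alpha> (fst p) * deriv \<beta> (snd p))) = - (LINT p|lborel. g' p * (\<alpha> (fst p) * \<beta> (snd p)))"
  shows "AE p in lborel. p \<in> Dom X \<longrightarrow> g' p = U 1 1 p"
  unfolding Dom_def
proof (rule AE_zero_exhaustion)
  fix a' b' c' d' :: real assume ab: "X 0 < a'" "b' < X 1" "-1 < c'" "d' < 1"
  let ?R = "{a'<..<b'} \<times> {c'<..<d'}"
  note i = U_integrable_subrect[OF ab]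
  have "AE p in lborel. p \<in> ?R \<longrightarrow> indicator ?R p * U 1 1 p - g' p = 0"
  proof (rule tensor_AE_zero)
    show "integrable lborel (\<lambda>p. indicator ?R p * U 1 1 p - g' p)" using i g by simp
    fix \<alpha> \<beta> assume a: "test_fun_real {a'<..<b'} \<alpha>" and b: "test_fun_real {c'<..<d'} \<beta>"
    note b' = test_fun_real_deriv[OF b]
    have a1: "test_fun_real {X 0<..<X 1} \<alpha>" by (rule test_fun_real_mono[OF a]) (use ab in auto)
    have b1: "test_fun_real {-1<..<1} \<beta>" by (rule test_fun_real_mono[OF b]) (use ab in auto)
    have t: "test_fun (Dom X) (\<lambda>(x, y). \<alpha> x * \<beta> y)" unfolding Dom_def by (rule test_fun_tensor[OF a1 b1])
    have "(LINT p|lborel. indicator ?R p * U 1 1 p * (\<alpha> (fst p) * \<beta> (snd p))) = distr_of (Dom X) (U 1 1) (\<lambda>(x, y). \<alpha> x * \<beta> y)"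
      by (rule U_tensor_integral[OF a b ab])
    also have "\<dots> = - distr_of (Dom X) (U 1 0) (\<lambda>(x, y). \<alpha> x * deriv \<beta> y)"
      using distr_of_parts(2)[OF U_jet int_S t, of 1 0] unfolding tensor_dy[OF test_fun_real_smooth[OF b]] by simp
    also have "\<dots> = - (LINT p|lborel. indicator ?R p * U 1 0 p * (\<alpha> (fst p) * deriv \<beta> (snd p)))"
      using U_tensor_integral[OF a b' ab] by simp
    also have "(LINT p|lborel. indicator ?R p * U 1 0 p * (\<alpha> (fst p) * deriv \<beta> (snd p)))
        = (LINT p|lborel. w' p * (\<alpha> (fst p) * deriv \<beta> (snd p)))"
    proof (rule integral_cong_AE)
      show "(\<lambda>p. indicator ?R p * U 1 0 p * (\<alpha> (fst p) * deriv \<beta> (snd p))) \<in> borel_measurable lborel"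
        "(\<lambda>p. w' p * (\<alpha> (fst p) * deriv \<beta> (snd p))) \<in> borel_measurable lborel"
        using integrable_tensor_weight[OF i a b'] integrable_tensor_weight[OF w a b'] by (auto dest: borel_measurable_integrable)
      show "AE p in lborel. indicator ?R p * U 1 0 p * (\<alpha> (fst p) * deriv \<beta> (snd p)) = w' p * (\<alpha> (fst p) * deriv \<beta> (snd p))"
        using wU
      proof eventually_elim
        case (elim p)
        show ?case
        proof (cases "p \<in> ?R")
          case True
          then show ?thesis using elim ab by (auto simp: Dom_def)
        next
          case False
          then have "\<alpha> (fst p) * deriv \<beta> (snd p) = 0"
            using test_fun_real_outside[OF a, of "fst p"] test_fun_real_outside[OF b', of "snd p"] by (cases p) auto
          then show ?thesis by simp
        qed
      qed
    qed
    also have "- (LINT p|lborel. w' p * (\<alpha> (fst p) * deriv \<beta> (snd p))) = (LINT p|lborel. g' p * (\<alpha> (fst p) * \<beta> (snd p)))"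
      using weak[OF a1 b1] by simp
    finally show "(LINT p|lborel. (indicator ?R p * U 1 1 p - g' p) * (\<alpha> (fst p) * \<beta> (snd p))) = 0"
      using integrable_tensor_weight[OF i a b] integrable_tensor_weight[OF g a b] by (simp add: left_diff_distrib)
  qed
  then show "AE p in lborel. p \<in> ?R \<longrightarrow> g' p = U 1 1 p" by eventually_elim auto
qed

text \<open>The mixed derivative is homogeneous of degree -7/2 under \<open>(x, y) \<mapsto> (s\<^sup>3 x, s y)\<close>, a scaling with
  Jacobian of degree 4, so its square is not integrable at the singular point.\<close>

lemma mixed_slice_lower_bound:
  obtains c \<delta> where "c > 0" "\<delta> > 0"
    "\<And>x g. x \<in> {x. 0 < \<sigma> * (x - a) \<and> \<sigma> * (x - a) < \<delta>} \<Longrightarrow> integrable lborel (\<lambda>y. (g y)\<^sup>2) \<Longrightarrow>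
      AE y in lborel. (x, y) \<in> Dom X \<longrightarrow> g y = U 1 1 (x, y) \<Longrightarrow>
      c * (\<sigma> * (x - a)) powr (-2) \<le> (LINT y|lborel. (g y)\<^sup>2)"
proof -
  obtain t0 where t0: "G 1 1 t0 \<noteq> 0" using G_mixed_nonzero by blast
  have "isCont (G 1 1) t0" by (rule DERIV_isCont[OF G_deriv])
  then have "(G 1 1 \<longlongrightarrow> G 1 1 t0) (nhds t0)" by (simp add: isCont_def tendsto_at_iff_tendsto_nhds)
  then have "\<forall>\<^sub>F t in nhds t0. (G 1 1 t0)\<^sup>2 / 2 < (G 1 1 t)\<^sup>2"
    by (intro order_tendstoD(1)[OF tendsto_power[of "G 1 1" "G 1 1 t0"]]) (use t0 in \<open>auto simp del: G.simps\<close>)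
  then obtain r where r: "r > 0" "\<And>t. dist t t0 < r \<Longrightarrow> (G 1 1 t0)\<^sup>2 / 2 < (G 1 1 t)\<^sup>2"
    unfolding eventually_nhds_metric by blast
  define c0 where "c0 = (G 1 1 t0)\<^sup>2 / 2"
  define t1 where "t1 = t0 + r / 2"
  have c0: "c0 > 0" using t0 by (simp add: c0_def del: G.simps)
  have t: "t0 < t1" "\<And>t. t0 \<le> t \<Longrightarrow> t \<le> t1 \<Longrightarrow> c0 \<le> (G 1 1 t)\<^sup>2"
    using r by (auto simp: t1_def c0_def dist_real_def abs_if less_imp_le)
  define m where "m = \<bar>t0\<bar> + \<bar>t1\<bar>"
  obtain W where W: "open W" "(a, 0) \<in> W" "\<And>p. p \<in> W \<Longrightarrow> p \<in> \<Omega> \<Longrightarrow> \<eta> i p = 1" by (rule cutoff_one) blast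
  obtain \<rho> where \<rho>: "\<rho> > 0" "ball (a, 0) \<rho> \<subseteq> W" using W(1,2) by (meson open_contains_ball)
  \<comment> \<open>At distance z from the singular side, points with t between \<open>t0\<close>
    and \<open>t1\<close> have \<bar>y\<bar> at most \<open>m * z powr (1/3)\<close>. Smallness of
    this sum keeps them where the cut-off is 1 and inside the domain.\<close>
  have "((\<lambda>z :: real. z + m * z powr (1/3)) \<longlongrightarrow> 0 + m * 0 powr (1/3)) (at_right 0)"
    by (intro tendsto_intros tendsto_powr') (auto simp: eventually_at_filter)
  then have "\<forall>\<^sub>F z :: real in at_right 0. z + m * z powr (1/3) < min \<rho> 1"
    by (rule order_tendstoD(2)) (use \<rho> in simp)
  moreover have "\<forall>\<^sub>F z :: real in at_right 0. z < X 1 - X 0"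
    by (rule order_tendstoD(2)[OF tendsto_ident_at]) (use X01 in simp)
  ultimately have "\<forall>\<^sub>F z :: real in at_right 0. z + m * z powr (1/3) < min \<rho> 1 \<and> z < X 1 - X 0"
    by (rule eventually_conj)
  then obtain \<delta> where \<delta>: "\<delta> > 0" "\<And>z. 0 < z \<Longrightarrow> z < \<delta> \<Longrightarrow> z + m * z powr (1/3) < min \<rho> 1 \<and> z < X 1 - X 0"
    by (auto simp: eventually_at_right_field)
  show ?thesis
  proof (rule that[of "c0 * (t1 - t0)" \<delta>])
    fix x g assume x: "x \<in> {x. 0 < \<sigma> * (x - a) \<and> \<sigma> * (x - a) < \<delta>}"
      and g: "integrable lborel (\<lambda>y. (g y)\<^sup>2)" "AE y in lborel. (x, y) \<in> Dom X \<longrightarrow> g y = U 1 1 (x, y)"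
    define z where "z = \<sigma> * (x - a)"
    define q where "q = z powr (1/3)"
    have z: "0 < z" "z + m * q < \<rho>" "z + m * q < 1" "z < X 1 - X 0"
      using x \<delta>(2)[of z] by (auto simp: z_def q_def)
    have q: "q > 0" using z by (simp add: q_def)
    let ?Y = "{y. \<sigma> * (y - 0) \<in> {t0 * q..t1 * q}}"
    have sg: "\<sigma> = 1 \<or> \<sigma> = -1" using \<sigma> by auto
    have tq: "t0 * q \<le> t1 * q" using t q by simp
    note Y = measure_reflected_interval[OF sg tq, of 0]
    have lower: "c0 * z powr (-7/3) \<le> (U 1 1 (x, y))\<^sup>2 \<and> (x, y) \<in> Dom X" if y: "y \<in> ?Y" for y
    proof -
      have y': "t0 * q \<le> \<sigma> * y" "\<sigma> * y \<le> t1 * q" using y by auto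
      have "\<bar>\<sigma> * y\<bar> \<le> m * q"
      proof -
        have "\<bar>t0 * q\<bar> \<le> m * q" "\<bar>t1 * q\<bar> \<le> m * q" using q by (auto simp: m_def abs_mult)
        then show ?thesis using y' by linarith
      qed
      then have ym: "\<bar>y\<bar> \<le> m * q" using sg by auto
      have xz: "\<bar>x - a\<bar> = z" using sg z(1) by (auto simp: z_def)
      have dom: "(x, y) \<in> Dom X"
        using \<sigma> z ym by (auto simp: Dom_def z_def abs_le_iff)
      have "dist (a, 0) (x, y) \<le> \<bar>x - a\<bar> + \<bar>y\<bar>"
        unfolding dist_prod_def dist_real_def by (simp add: sqrt_sum_squares_le_sum_abs abs_minus_commute)
      then have in_W: "(x, y) \<in> W" using \<rho> xz ym z by (auto intro!: subsetD[OF \<rho>(2)])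
      have "U 1 1 (x, y) = VV 1 1 (x, y)" by (rule U_near[OF W(1,3) in_W]) (use dom Dom_sub_S in auto)
      also have "\<dots> = \<sigma> ^ 2 * V 1 1 (z, \<sigma> * y)" by (simp add: VV_def z_def numeral_2_eq_2)
      also have "\<dots> = z powr e 1 1 * G 1 1 (\<sigma> * y * z powr (-1/3))"
        using sg z(1) by (auto simp: V_def)
      finally have "(U 1 1 (x, y))\<^sup>2 = (z powr e 1 1)\<^sup>2 * (G 1 1 (\<sigma> * y * z powr (-1/3)))\<^sup>2"
        by (simp only: power_mult_distrib)
      moreover have "(z powr e 1 1)\<^sup>2 = z powr (-7/3)" using z(1) by (simp add: powr_power e_def)
      ultimately have sq: "(U 1 1 (x, y))\<^sup>2 = z powr (-7/3) * (G 1 1 (\<sigma> * y * z powr (-1/3)))\<^sup>2" by (simp only:)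
      have "c0 \<le> (G 1 1 (\<sigma> * y * z powr (-1/3)))\<^sup>2"
      proof (rule t(2))
        have "q * z powr (-1/3) = 1" using z(1) by (simp add: q_def flip: powr_add)
        then have "t0 = t0 * q * z powr (-1/3)" "t1 = t1 * q * z powr (-1/3)" by (simp_all add: mult.assoc)
        then show "t0 \<le> \<sigma> * y * z powr (-1/3)" "\<sigma> * y * z powr (-1/3) \<le> t1"
          using y' by (metis mult_right_mono powr_ge_zero)+
      qed
      then have "z powr (-7/3) * c0 \<le> z powr (-7/3) * (G 1 1 (\<sigma> * y * z powr (-1/3)))\<^sup>2"
        by (rule mult_left_mono) simp
      then show ?thesis using dom unfolding sq by (simp only: mult.commute[of c0])
    qed
    \<comment> \<open>The squared derivative contributes z to the power -7/3 and the length of the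
      y-interval z to the power 1/3.\<close>
    have "z powr (-2) = z powr (-7/3) * q" using z(1) by (simp add: q_def flip: powr_add)
    then have "c0 * (t1 - t0) * z powr (-2) = c0 * (t1 - t0) * (z powr (-7/3) * q)" by (simp only:)
    also have "\<dots> = c0 * z powr (-7/3) * (t1 * q - t0 * q)" by (simp add: algebra_simps)
    also have "\<dots> = (LINT y|lborel. c0 * z powr (-7/3) * indicator ?Y y)" using Y(3) by simp
    also have "\<dots> \<le> (LINT y|lborel. (g y)\<^sup>2)"
    proof (rule integral_mono_AE)
      show "integrable lborel (\<lambda>y. c0 * z powr (-7/3) * indicator ?Y y)" using Y(2) by simp
      show "AE y in lborel. c0 * z powr (-7/3) * indicator ?Y y \<le> (g y)\<^sup>2"
        using g(2)
      proof eventually_elim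
        case (elim y)
        show ?case
        proof (cases "y \<in> ?Y")
          case True
          then show ?thesis using lower[OF True] elim by simp
        next
          case False
          have "indicator ?Y y = (0 :: real)" by (rule indicator_simps(2)[OF False])
          then show ?thesis by (simp only: mult_zero_right) simp
        qed
      qed
    qed (rule g(1))
    finally show "c0 * (t1 - t0) * (\<sigma> * (x - a)) powr (-2) \<le> (LINT y|lborel. (g y)\<^sup>2)" by (simp add: z_def)
  qed (use c0 t \<delta> in auto)
qed

text \<open>The slice norms are at least c z^(-2), so the strip between distances s and 2s
  contributes at least c (2s)^(-2) s = c/(4s), which is unbounded as s tends to 0.\<close>

lemma mixed_not_L2:
  assumes g: "integrable lborel (\<lambda>p. (g p)\<^sup>2)" and eq: "AE p in lborel. p \<in> Dom X \<longrightarrow> g p = U 1 1 p"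
  shows False
proof -
  obtain c \<delta> where c: "c > 0" "\<delta> > 0"
    "\<And>x g. x \<in> {x. 0 < \<sigma> * (x - a) \<and> \<sigma> * (x - a) < \<delta>} \<Longrightarrow> integrable lborel (\<lambda>y. (g y)\<^sup>2) \<Longrightarrow>
      AE y in lborel. (x, y) \<in> Dom X \<longrightarrow> g y = U 1 1 (x, y) \<Longrightarrow>
      c * (\<sigma> * (x - a)) powr (-2) \<le> (LINT y|lborel. (g y)\<^sup>2)"
    by (rule mixed_slice_lower_bound) blast
  define N where "N x = (LINT y|lborel. (g (x, y))\<^sup>2)" for x
  have N: "integrable lborel N" unfolding N_def using lborel_fubini_fst(2)[OF g] .
  have N0: "N x \<ge> 0" for x unfolding N_def by (rule Bochner_Integration.integral_nonneg) simp
  define M where "M = (LINT x|lborel. N x)"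
  have M0: "M \<ge> 0" unfolding M_def by (rule Bochner_Integration.integral_nonneg) (rule N0)
  have sg: "\<sigma> = 1 \<or> \<sigma> = -1" using \<sigma> by auto
  have bound: "c / (4 * s) \<le> M" if s: "0 < s" "2 * s < \<delta>" for s
  proof -
    let ?I = "{x. \<sigma> * (x - a) \<in> {s..2 * s}}"
    have s2: "s \<le> 2 * s" using s by simp
    note I = measure_reflected_interval[OF sg s2, of a]
    have "c / (4 * s) = c * (2 * s) powr (-2) * (2 * s - s)"
      using s by (simp add: powr_minus field_simps power2_eq_square)
    also have "\<dots> = (LINT x|lborel. c * (2 * s) powr (-2) * indicator ?I x)" using I(3) by simp
    also have "\<dots> \<le> (LINT x|lborel. N x)"
    proof (rule integral_mono_AE)
      show "integrable lborel (\<lambda>x. c * (2 * s) powr (-2) * indicator ?I x)" using I(2) by simp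
      show "AE x in lborel. c * (2 * s) powr (-2) * indicator ?I x \<le> N x"
        using AE_lborel_fst[OF eq] lborel_fubini_fst(1)[OF g]
      proof eventually_elim
        case (elim x)
        show ?case
        proof (cases "x \<in> ?I")
          case True
          then have x: "s \<le> \<sigma> * (x - a)" "\<sigma> * (x - a) \<le> 2 * s" by auto
          have "c * (2 * s) powr (-2) \<le> c * (\<sigma> * (x - a)) powr (-2)"
            using c(1) s x by (intro mult_left_mono powr_mono2') auto
          also have "\<dots> \<le> N x" unfolding N_def by (rule c(3)) (use x s elim in auto)
          finally show ?thesis using True by simp
        next
          case False
          have "indicator ?I x = (0 :: real)" by (rule indicator_simps(2)[OF False])
          then show ?thesis using N0 by (simp only: mult_zero_right)
        qed
      qed
    qed (rule N)
    finally show ?thesis by (simp add: M_def)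
  qed
  \<comment> \<open>The second bound makes the finite integral \<open>M\<close> force c \<le> c/2,
    with \<open>M + 1\<close> keeping the denominator positive.\<close>
  define s where "s = min (\<delta> / 4) (c / (8 * (M + 1)))"
  have "s \<le> \<delta> / 4" unfolding s_def by (rule min.cobounded1)
  then have "2 * s < \<delta>" using c(2) by linarith
  have "0 < s" using c M0 by (simp add: s_def)
  have "c / (4 * s) \<le> M" by (rule bound) fact+
  then have "c \<le> M * (4 * s)" using \<open>0 < s\<close> by (simp add: field_simps)
  also have "\<dots> \<le> (M + 1) * (4 * (c / (8 * (M + 1))))"
    using M0 \<open>0 < s\<close> c by (intro mult_mono) (auto simp: s_def)
  also have "\<dots> = c / 2" using M0 by (simp add: field_simps)
  finally show False using c(1) by simp
qed

text \<open>Membership would provide a square-integrable y-derivative g of the weak x-derivative w.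
  Almost everywhere w is the classical x-derivative and hence g the classical mixed derivative,
  which is not square integrable.\<close>

lemma u_not_H1: "u \<notin> H1x_H1y {X 0<..<X 1} {-1<..<1}"
proof
  let ?I = "{X 0<..<X 1}" and ?J = "{-1<..<1::real}"
  assume "u \<in> H1x_H1y ?I ?J"
  then obtain w where w: "w \<in> L2x_H1y ?I ?J" and weak: "\<And>\<psi>. test_fun_real ?I \<psi> \<Longrightarrow>
       AE y in lebesgue_on ?J. integral\<^sup>L (lebesgue_on ?I) (\<lambda>x. u (x, y) * deriv \<psi> x)
           = - integral\<^sup>L (lebesgue_on ?I) (\<lambda>x. w (x, y) * \<psi> x)"
    by (auto simp: H1x_H1y_def)
  obtain g where wL: "w \<in> L2 (Dom X)" and g: "g \<in> L2 (Dom X)"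
    and H1: "AE x in lebesgue_on ?I. H1_deriv ?J (\<lambda>y. w (x, y)) (\<lambda>y. g (x, y))"
    using w unfolding L2x_H1y_def Dom_def by blast
  obtain u' where u': "borel_rep (Dom X) u u'" by (rule ex_borel_rep[OF u_L2 Dom_borel(1) Dom_bounded])
  obtain w' where w': "borel_rep (Dom X) w w'" by (rule ex_borel_rep[OF wL Dom_borel(1) Dom_bounded])
  obtain g' where g': "borel_rep (Dom X) g g'" by (rule ex_borel_rep[OF g Dom_borel(1) Dom_bounded])
  have J: "?J \<in> sets borel" and I: "?I \<in> sets borel" by auto
  have ux: "(LINT p|lborel. u' p * (deriv \<alpha> (fst p) * \<beta> (snd p))) = - (LINT p|lborel. w' p * (\<alpha> (fst p) * \<beta> (snd p)))"
    if a: "test_fun_real ?I \<alpha>" and b: "test_fun_real ?J \<beta>" for \<alpha> \<beta>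
  proof (rule slicewise_integral_dx[OF borel_repD(2)[OF u'] borel_repD(2)[OF w'] test_fun_real_deriv[OF a] a b])
    show "AE y in lborel. (LINT x|lborel. u' (x, y) * deriv \<alpha> x) = - (LINT x|lborel. w' (x, y) * \<alpha> x)"
      using weak[OF a, unfolded AE_lebesgue_on_iff[OF J]]
        slice_integral_eq(1)[OF u' test_fun_real_measurable[OF test_fun_real_deriv[OF a]]]
        slice_integral_eq(1)[OF w' test_fun_real_measurable[OF a]]
    proof eventually_elim
      case (elim y)
      show ?case
      proof (cases "y \<in> ?J")
        case False
        then have "u' (x, y) = 0" "w' (x, y) = 0" for x
          using borel_repD(4)[OF u', of "(x, y)"] borel_repD(4)[OF w', of "(x, y)"] by (auto simp: Dom_def)
        then show ?thesis by simp
      qed (use elim in simp)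
    qed
  qed
  have wy: "(LINT p|lborel. w' p * (\<alpha> (fst p) * deriv \<beta> (snd p))) = - (LINT p|lborel. g' p * (\<alpha> (fst p) * \<beta> (snd p)))"
    if a: "test_fun_real ?I \<alpha>" and b: "test_fun_real ?J \<beta>" for \<alpha> \<beta>
  proof (rule slicewise_integral_dy[OF borel_repD(2)[OF w'] borel_repD(2)[OF g'] a test_fun_real_deriv[OF b] b])
    show "AE x in lborel. (LINT y|lborel. w' (x, y) * deriv \<beta> y) = - (LINT y|lborel. g' (x, y) * \<beta> y)"
      using H1[unfolded AE_lebesgue_on_iff[OF I]]
        slice_integral_eq(2)[OF w' test_fun_real_measurable[OF test_fun_real_deriv[OF b]]]
        slice_integral_eq(2)[OF g' test_fun_real_measurable[OF b]]
    proof eventually_elim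
      case (elim x)
      show ?case
      proof (cases "x \<in> ?I")
        case False
        then have "w' (x, y) = 0" "g' (x, y) = 0" for y
          using borel_repD(4)[OF w', of "(x, y)"] borel_repD(4)[OF g', of "(x, y)"] by (auto simp: Dom_def)
        then show ?thesis by simp
      next
        case True
        then have "integral\<^sup>L (lebesgue_on ?J) (\<lambda>y. w (x, y) * deriv \<beta> y) = - integral\<^sup>L (lebesgue_on ?J) (\<lambda>y. g (x, y) * \<beta> y)"
          using elim(1) b by (auto simp: H1_deriv_def)
        then show ?thesis using elim(2,3) True by simp
      qed
    qed
  qed
  have "AE p in lborel. p \<in> Dom X \<longrightarrow> w' p = U 1 0 p"
    by (rule weak_dx_eq_U[OF u' borel_repD(2)[OF w'] ux])
  from weak_dy_eq_U[OF borel_repD(2)[OF w'] this borel_repD(2)[OF g'] wy]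
  have "AE p in lborel. p \<in> Dom X \<longrightarrow> g' p = U 1 1 p" .
  from mixed_not_L2[OF borel_repD(3)[OF g'] this] show False .
qed

end

theorem lemma2p3:
  fixes X :: "nat \<Rightarrow> real" and \<Lambda>0 :: "real \<Rightarrow> real"
    and \<eta> :: "nat \<Rightarrow> real \<times> real \<Rightarrow> real"
  assumes "X 0 < X 1"
    and "is_Lambda0 \<Lambda>0"
    and "\<And>i. i \<in> {0, 1} \<Longrightarrow> cutoff X i (\<eta> i)"
  shows "\<forall>i\<in>{0, 1}.
    (\<exists>f. smooth_on (closure (Dom X)) f \<and>
      (\<exists>U. open U \<and> (X i, 0) \<in> U \<and> {X 0..X 1} \<times> {-1, 1} \<subseteq> U \<and>
           (\<forall>p \<in> U \<inter> closure (Dom X). f p = 0)) \<and>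
      u_sing \<Lambda>0 X \<eta> i \<in> Z0 (Dom X) \<and>
      bvp_solution X f (u_sing \<Lambda>0 X \<eta> i) \<and>
      (\<forall>w \<in> Z0 (Dom X). bvp_solution X f w \<longrightarrow>
        (AE p in lebesgue_on (Dom X). w p = u_sing \<Lambda>0 X \<eta> i p))) \<and>
    smooth_on (closure (Dom X) - {(X i, 0)}) (u_sing \<Lambda>0 X \<eta> i) \<and>
    u_sing \<Lambda>0 X \<eta> i \<notin> H1x_H1y {X 0<..<X 1} {-1<..<1}"
proof
  fix i :: nat assume i: "i \<in> {0, 1}"
  obtain g1 where "profile (\<lambda>t. (1 + t\<^sup>2) powr (1/4) * \<Lambda>0 t) g1"
    using profile_of_Lambda0[OF assms(2)] by blast
  then interpret singular \<Lambda>0 g1 X \<eta> i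
    using assms i by (intro singular.intro singular_axioms.intro) (auto simp: is_Lambda0_def)
  obtain f where f: "smooth_on \<Omega> f"
    "\<exists>W. open W \<and> (a, 0) \<in> W \<and> {X 0..X 1} \<times> {-1, 1} \<subseteq> W \<and> (\<forall>p\<in>W \<inter> \<Omega>. f p = 0)"
    "\<And>p. p \<in> Dom X \<Longrightarrow> f p = snd p * U 1 0 p - U 0 2 p"
    using ex_rhs by blast
  obtain D where "is_jet2 \<Omega> D" "\<forall>p\<in>\<Omega>. D 0 0 p = f p" using f(1) by (auto simp: smooth_on_iff_jet2)
  then have cf: "continuous_on \<Omega> f" using is_jet2_continuous continuous_on_eq by blast
  note Z = u_Z0[OF cf f(3)] and B = u_bvp[OF cf f(3)]
  have "AE p in lebesgue_on (Dom X). w p = u p" if "w \<in> Z0 (Dom X)" "bvp_solution X f w" for w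
    by (rule bvp_unique[OF X01 Z B that])
  moreover have "smooth_on S u" unfolding smooth_on_iff_jet2 using U_jet U_eq by blast
  ultimately show "(\<exists>f. smooth_on (closure (Dom X)) f \<and>
      (\<exists>U. open U \<and> (X i, 0) \<in> U \<and> {X 0..X 1} \<times> {-1, 1} \<subseteq> U \<and>
           (\<forall>p \<in> U \<inter> closure (Dom X). f p = 0)) \<and>
      u_sing \<Lambda>0 X \<eta> i \<in> Z0 (Dom X) \<and>
      bvp_solution X f (u_sing \<Lambda>0 X \<eta> i) \<and>
      (\<forall>w \<in> Z0 (Dom X). bvp_solution X f w \<longrightarrow>
        (AE p in lebesgue_on (Dom X). w p = u_sing \<Lambda>0 X \<eta> i p))) \<and>
    smooth_on (closure (Dom X) - {(X i, 0)}) (u_sing \<Lambda>0 X \<eta> i) \<and>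
    u_sing \<Lambda>0 X \<eta> i \<notin> H1x_H1y {X 0<..<X 1} {-1<..<1}"
    using f(1,2) Z B u_not_H1 unfolding S_def \<Omega>_def a_def by blast
qed

end
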